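(* Let $\mathfrak{g}$ be a six-dimensional real nilpotent noncommutative Lie algebra. Then $\mathfrak g$ admits a para-Kähler structure if and only if there is a symplectic form on $\mathfrak g$ with which $\mathfrak g$ is symplecto-isomorphic to one of the following symplectic Lie algebras. Each is given by its nonzero brackets in a basis $e_1,\dots,e_6$ (up to antisymmetry; all other brackets of basis vectors are zero) and by one of the listed symplectic forms, with $e^1,\dots,e^6$ the dual basis, $e^{ij}:=e^i\wedge e^j$ and $\lambda$ a real parameter: - $\mathfrak G_6$: $[e_1,e_2]=e_3$, $[e_1,e_3]=e_4$, $[e_1,e_4]=e_5$, $[e_2,e_3]=e_6$; $\omega=e^{16}+e^{24}+e^{25}-e^{34}$. - $\mathfrak G_{10}$: $[e_1,e_2]=e_4$, $[e_1,e_4]=e_5$, $[e_1,e_3]=e_6$, $[e_2,e_4]=e_6$; $\omega=e^{16}+e^{25}-e^{34}-e^{26}$. - $\mathfrak G_{11}$: $[e_1,e_2]=e_4$, $[e_1,e_4]=e_5$, $[e_2,e_3]=e_6$, $[e_2,e_4]=e_6$; $\omega=e^{16}+e^{25}-e^{34}+\lambda e^{26}$. - $\mathfrak G_{12}$: $[e_1,e_2]=e_4$, $[e_1,e_4]=e_5$, $[e_2,e_3]=-e_5$, $[e_1,e_3]=e_6$, $[e_2,e_4]=e_6$; $\omega=-e^{15}+\lambda e^{26}+(\lambda-1)e^{34}$, $\lambda\notin\{0,1,-1\}$. - $\mathfrak G_{13}$: $[e_1,e_2]=e_4$, $[e_1,e_3]=e_5$, $[e_1,e_4]=e_6$, $[e_2,e_3]=e_6$;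 $\omega_1=e^{16}+\lambda e^{25}+(\lambda-1)e^{34}$, $\lambda\notin\{0,1\}$; or $\omega_2=e^{16}+e^{24}+\tfrac12 e^{25}-\tfrac12 e^{34}$. - $\mathfrak G_{14}$: $[e_1,e_2]=e_4$, $[e_1,e_3]=e_5$, $[e_1,e_4]=e_6$; $\omega=e^{16}+e^{25}+e^{34}$. - $\mathfrak G_{15}$: $[e_1,e_2]=e_4$, $[e_2,e_3]=e_5$, $[e_1,e_4]=e_6$; $\omega=-e^{15}+e^{16}+e^{25}+e^{34}$. - $\mathfrak G_{16}$: $[e_1,e_2]=e_5$, $[e_3,e_4]=-e_5$, $[e_1,e_3]=e_6$, $[e_2,e_4]=e_6$; $\omega=e^{16}+e^{23}-e^{45}$. - $\mathfrak G_{17}$: $[e_1,e_3]=e_5$, $[e_1,e_4]=e_6$, $[e_2,e_3]=e_6$; $\omega=e^{16}+e^{25}+e^{34}$. - $\mathfrak G_{18}$: $[e_1,e_2]=e_4$, $[e_1,e_3]=e_5$, $[e_2,e_3]=e_6$; $\omega_1=e^{16}+\lambda e^{25}+(\lambda-1)e^{34}$, $\lambda\notin\{0,1\}$; or $\omega_2=e^{15}+\lambda e^{16}-\lambda e^{25}+e^{26}-2\lambda e^{34}$, $\lambda\neq0$; or $\omega_3=-e^{16}+e^{25}+2e^{34}+e^{35}$. - $\mathfrak G_{19}$: $[e_1,e_2]=e_4$, $[e_1,e_4]=e_5$, $[e_1,e_5]=e_6$; $\omega=e^{13}+e^{26}-e^{45}$. - $\mathfrak G_{21}$: $[e_1,e_2]=e_4$,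 $[e_1,e_4]=e_6$, $[e_2,e_3]=e_6$; $\omega=e^{16}+e^{25}-e^{34}$. - $\mathfrak G_{23}$: $[e_1,e_2]=e_5$, $[e_1,e_3]=e_6$; $\omega_1=e^{16}+e^{25}+e^{34}$; or $\omega_2=e^{14}+e^{26}+e^{35}$; or $\omega_3=e^{14}+e^{25}-e^{36}$. - $\mathfrak G_{24}$: $[e_2,e_3]=e_5$, $[e_1,e_4]=e_6$; $\omega=e^{16}+e^{25}+e^{34}$. - $\mathfrak G_{25}$: $[e_1,e_2]=e_6$; $\omega=e^{16}+e^{25}+e^{34}$. Moreover, for these symplectic Lie algebras $(\mathfrak g,\omega)$, the admissible para-complex structures $J$ (i.e. all para-complex structures $J$ on $\mathfrak g$ compatible with $\omega$) are nilpotent, and the corresponding pseudo-Riemannian metrics $g(X,Y)=\omega(X,JY)$ are Ricci-flat.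
   Context: All Lie algebras are real and finite-dimensional. A symplectic form on $\mathfrak g$ is a nondegenerate alternating bilinear form $\omega$ with $\omega([X,Y],Z)-\omega([X,Z],Y)+\omega([Y,Z],X)=0$ for all $X,Y,Z\in\mathfrak g$. Symplectic Lie algebras $(\mathfrak g,\omega)$, $(\mathfrak g',\omega')$ are symplecto-isomorphic if there is a Lie algebra isomorphism $\varphi:\mathfrak g\to\mathfrak g'$ with $\varphi^*\omega'=\omega$. An almost para-complex structure on $\mathfrak g$ is a linear map $J:\mathfrak g\to\mathfrak g$ with $J^2=\mathrm{Id}$ whose eigenspaces $\mathfrak g^{\pm}=\ker(\mathrm{Id}\mp J)$ have equal dimension. It is a para-complex structure (integrable) if $N_J(X,Y)=[X,Y]+[JX,JY]-J[JX,Y]-J[X,JY]=0$ for all $X,Y\in\mathfrak g$. $J$ is compatible with $\omega$ if $\omega(JX,JY)=-\omega(X,Y)$ for all $X,Y$. A para-Kähler structure on $\mathfrak g$ is a pair $(J,\omega)$ consisting of a symplectic form $\omega$ and a para-complex structure $J$ compatible with $\omega$; its metric is the pseudo-Riemannian (nondegenerate symmetric) form $g(X,Y)=\omega(X,JY)$. Define $\mathfrak a_0(J)=\{0\}$ and $\mathfrak a_k(J)=\{X\in\mathfrak g : [X,\mathfrak g]\subset\mathfrak a_{k-1}(J),\ [JX,\mathfrak g]\subset\mathfrak a_{k-1}(J)\}$ for $k\ge1$. $J$ is called nilpotent if $\mathfrak a_s(J)=\mathfrak g$ for some $s$. The Levi-Civita connection of $g$ on left-invariant fields is the bilinear map $\nabla:\mathfrak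 g\times\mathfrak g\to\mathfrak g$ given by $2g(\nabla_XY,Z)=g([X,Y],Z)+g([Z,X],Y)+g([Z,Y],X)$. The curvature is $R(X,Y)=[\nabla_X,\nabla_Y]-\nabla_{[X,Y]}$, with components $R(e_i,e_j)e_k=\sum_l R_{ijk}^l e_l$ in a basis; $Ric_{jk}=\sum_i R_{ijk}^i$; $g$ is Ricci-flat if $Ric=0$. *)

theory Defs
  imports "HOL-Analysis.Analysis"
begin

definition lie_algebra :: "('a::real_vector \<Rightarrow> 'a \<Rightarrow> 'a) \<Rightarrow> bool" where
  "lie_algebra br \<longleftrightarrow> bilinear br \<and> (\<forall>x. br x x = 0) \<and>
     (\<forall>x y z. br x (br y z) + br y (br z x) + br z (br x y) = 0)"

primrec lower_central :: "('a::real_vector \<Rightarrow> 'a \<Rightarrow> 'a) \<Rightarrow> nat \<Rightarrow> 'a set" where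
  "lower_central br 0 = UNIV"
| "lower_central br (Suc k) = span {br x y | x y. y \<in> lower_central br k}"

definition nilpotent_lie :: "('a::real_vector \<Rightarrow> 'a \<Rightarrow> 'a) \<Rightarrow> bool" where
  "nilpotent_lie br \<longleftrightarrow> (\<exists>k. lower_central br k = {0})"

definition commutative_lie :: "('a::real_vector \<Rightarrow> 'a \<Rightarrow> 'a) \<Rightarrow> bool" where
  "commutative_lie br \<longleftrightarrow> (\<forall>x y. br x y = 0)"

definition symplectic_form ::
    "('a::real_vector \<Rightarrow> 'a \<Rightarrow> 'a) \<Rightarrow> ('a \<Rightarrow> 'a \<Rightarrow> real) \<Rightarrow> bool" where
  "symplectic_form br \<omega> \<longleftrightarrow> bilinear \<omega> \<and> (\<forall>x. \<omega> x x = 0) \<and>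
     (\<forall>x. (\<forall>y. \<omega> x y = 0) \<longrightarrow> x = 0) \<and>
     (\<forall>x y z. \<omega> (br x y) z - \<omega> (br x z) y + \<omega> (br y z) x = 0)"

definition symplecto_isomorphic ::
    "('a::real_vector \<Rightarrow> 'a \<Rightarrow> 'a) \<Rightarrow> ('a \<Rightarrow> 'a \<Rightarrow> real) \<Rightarrow>
     ('b::real_vector \<Rightarrow> 'b \<Rightarrow> 'b) \<Rightarrow> ('b \<Rightarrow> 'b \<Rightarrow> real) \<Rightarrow> bool" where
  "symplecto_isomorphic br \<omega> br' \<omega>' \<longleftrightarrow>
     (\<exists>\<phi>. linear \<phi> \<and> bij \<phi> \<and> (\<forall>x y. \<phi> (br x y) = br' (\<phi> x) (\<phi> y)) \<and>
        (\<forall>x y. \<omega>' (\<phi> x) (\<phi> y) = \<omega> x y))"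

definition almost_para_complex :: "('a::real_vector \<Rightarrow> 'a) \<Rightarrow> bool" where
  "almost_para_complex J \<longleftrightarrow> linear J \<and> (\<forall>x. J (J x) = x) \<and>
     dim {x. x - J x = 0} = dim {x. x + J x = 0}"

definition nijenhuis ::
    "('a::real_vector \<Rightarrow> 'a \<Rightarrow> 'a) \<Rightarrow> ('a \<Rightarrow> 'a) \<Rightarrow> 'a \<Rightarrow> 'a \<Rightarrow> 'a" where
  "nijenhuis br J x y = br x y + br (J x) (J y) - J (br (J x) y) - J (br x (J y))"

definition para_complex :: "('a::real_vector \<Rightarrow> 'a \<Rightarrow> 'a) \<Rightarrow> ('a \<Rightarrow> 'a) \<Rightarrow> bool" where
  "para_complex br J \<longleftrightarrow> almost_para_complex J \<and> (\<forall>x y. nijenhuis br J x y = 0)"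

definition compatible :: "('a::real_vector \<Rightarrow> 'a) \<Rightarrow> ('a \<Rightarrow> 'a \<Rightarrow> real) \<Rightarrow> bool" where
  "compatible J \<omega> \<longleftrightarrow> (\<forall>x y. \<omega> (J x) (J y) = - \<omega> x y)"

definition para_kaehler ::
    "('a::real_vector \<Rightarrow> 'a \<Rightarrow> 'a) \<Rightarrow> ('a \<Rightarrow> 'a) \<Rightarrow> ('a \<Rightarrow> 'a \<Rightarrow> real) \<Rightarrow> bool" where
  "para_kaehler br J \<omega> \<longleftrightarrow> symplectic_form br \<omega> \<and> para_complex br J \<and> compatible J \<omega>"

definition assoc_metric ::
    "('a::real_vector \<Rightarrow> 'a) \<Rightarrow> ('a \<Rightarrow> 'a \<Rightarrow> real) \<Rightarrow> 'a \<Rightarrow> 'a \<Rightarrow> real" where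
  "assoc_metric J \<omega> x y = \<omega> x (J y)"

primrec asc_series ::
    "('a::real_vector \<Rightarrow> 'a \<Rightarrow> 'a) \<Rightarrow> ('a \<Rightarrow> 'a) \<Rightarrow> nat \<Rightarrow> 'a set" where
  "asc_series br J 0 = {0}"
| "asc_series br J (Suc k) =
     {x. (\<forall>y. br x y \<in> asc_series br J k) \<and> (\<forall>y. br (J x) y \<in> asc_series br J k)}"

definition nilpotent_structure ::
    "('a::real_vector \<Rightarrow> 'a \<Rightarrow> 'a) \<Rightarrow> ('a \<Rightarrow> 'a) \<Rightarrow> bool" where
  "nilpotent_structure br J \<longleftrightarrow> (\<exists>s. asc_series br J s = UNIV)"

(* Koszul formula; the vector is unique because g is nondegenerate, and exists because the
   space is finite-dimensional. *)
definition levi_civita ::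
    "('a::real_vector \<Rightarrow> 'a \<Rightarrow> 'a) \<Rightarrow> ('a \<Rightarrow> 'a \<Rightarrow> real) \<Rightarrow> 'a \<Rightarrow> 'a \<Rightarrow> 'a" where
  "levi_civita br g x y =
     (THE v. \<forall>z. 2 * g v z = g (br x y) z + g (br z x) y + g (br z y) x)"

definition curvature ::
    "('a::real_vector \<Rightarrow> 'a \<Rightarrow> 'a) \<Rightarrow> ('a \<Rightarrow> 'a \<Rightarrow> real) \<Rightarrow> 'a \<Rightarrow> 'a \<Rightarrow> 'a \<Rightarrow> 'a" where
  "curvature br g x y z =
     levi_civita br g x (levi_civita br g y z) - levi_civita br g y (levi_civita br g x z)
       - levi_civita br g (br x y) z"

(* Ric(y, z) is the sum over a basis B of the b-th coordinates of R(b, y) z, b in B. *)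
definition ricci ::
    "('a::real_vector \<Rightarrow> 'a \<Rightarrow> 'a) \<Rightarrow> ('a \<Rightarrow> 'a \<Rightarrow> real) \<Rightarrow> 'a set \<Rightarrow> 'a \<Rightarrow> 'a \<Rightarrow> real" where
  "ricci br g B y z = (\<Sum>b\<in>B. representation B (curvature br g b y z) b)"

definition ricci_flat ::
    "('a::real_vector \<Rightarrow> 'a \<Rightarrow> 'a) \<Rightarrow> ('a \<Rightarrow> 'a \<Rightarrow> real) \<Rightarrow> bool" where
  "ricci_flat br g \<longleftrightarrow>
     (\<forall>B. independent B \<and> span B = UNIV \<longrightarrow> (\<forall>y\<in>B. \<forall>z\<in>B. ricci br g B y z = 0))"

(* The models live on real^6 with e_i = axis i 1. The six indices are the elements
   1, ..., 6 of the type 6, where 6 = 0. An entry (i, j, c, k) of a bracket list stands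
   for [e_i, e_j] = c e_k together with [e_j, e_i] = - c e_k; an entry (c, i, j) of a form
   list stands for the summand c (e^i \<and> e^j), with
   (e^i \<and> e^j)(x, y) = x_i y_j - x_j y_i. *)
definition bracket_of :: "(6 \<times> 6 \<times> real \<times> 6) list \<Rightarrow> real^6 \<Rightarrow> real^6 \<Rightarrow> real^6" where
  "bracket_of L x y =
     (\<Sum>(i, j, c, k)\<leftarrow>L. ((x $ i * y $ j - x $ j * y $ i) * c) *\<^sub>R axis k 1)"

definition form_of :: "(real \<times> 6 \<times> 6) list \<Rightarrow> real^6 \<Rightarrow> real^6 \<Rightarrow> real" where
  "form_of L x y = (\<Sum>(c, i, j)\<leftarrow>L. c * (x $ i * y $ j - x $ j * y $ i))"

inductive listed :: "(real^6 \<Rightarrow> real^6 \<Rightarrow> real^6) \<Rightarrow> (real^6 \<Rightarrow> real^6 \<Rightarrow> real) \<Rightarrow> bool" where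
  G6: "listed (bracket_of [(1,2,1,3), (1,3,1,4), (1,4,1,5), (2,3,1,6)])
         (form_of [(1,1,6), (1,2,4), (1,2,5), (-1,3,4)])"
| G10: "listed (bracket_of [(1,2,1,4), (1,4,1,5), (1,3,1,6), (2,4,1,6)])
         (form_of [(1,1,6), (1,2,5), (-1,3,4), (-1,2,6)])"
| G11: "listed (bracket_of [(1,2,1,4), (1,4,1,5), (2,3,1,6), (2,4,1,6)])
         (form_of [(1,1,6), (1,2,5), (-1,3,4), (t,2,6)])"
| G12: "t \<notin> {0, 1, -1} \<Longrightarrow>
        listed (bracket_of [(1,2,1,4), (1,4,1,5), (2,3,-1,5), (1,3,1,6), (2,4,1,6)])
         (form_of [(-1,1,5), (t,2,6), (t - 1,3,4)])"
| G13_1: "t \<notin> {0, 1} \<Longrightarrow>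
        listed (bracket_of [(1,2,1,4), (1,3,1,5), (1,4,1,6), (2,3,1,6)])
         (form_of [(1,1,6), (t,2,5), (t - 1,3,4)])"
| G13_2: "listed (bracket_of [(1,2,1,4), (1,3,1,5), (1,4,1,6), (2,3,1,6)])
         (form_of [(1,1,6), (1,2,4), (1/2,2,5), (-1/2,3,4)])"
| G14: "listed (bracket_of [(1,2,1,4), (1,3,1,5), (1,4,1,6)])
         (form_of [(1,1,6), (1,2,5), (1,3,4)])"
| G15: "listed (bracket_of [(1,2,1,4), (2,3,1,5), (1,4,1,6)])
         (form_of [(-1,1,5), (1,1,6), (1,2,5), (1,3,4)])"
| G16: "listed (bracket_of [(1,2,1,5), (3,4,-1,5), (1,3,1,6), (2,4,1,6)])
         (form_of [(1,1,6), (1,2,3), (-1,4,5)])"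
| G17: "listed (bracket_of [(1,3,1,5), (1,4,1,6), (2,3,1,6)])
         (form_of [(1,1,6), (1,2,5), (1,3,4)])"
| G18_1: "t \<notin> {0, 1} \<Longrightarrow>
        listed (bracket_of [(1,2,1,4), (1,3,1,5), (2,3,1,6)])
         (form_of [(1,1,6), (t,2,5), (t - 1,3,4)])"
| G18_2: "t \<noteq> 0 \<Longrightarrow>
        listed (bracket_of [(1,2,1,4), (1,3,1,5), (2,3,1,6)])
         (form_of [(1,1,5), (t,1,6), (-t,2,5), (1,2,6), (-2 * t,3,4)])"
| G18_3: "listed (bracket_of [(1,2,1,4), (1,3,1,5), (2,3,1,6)])
         (form_of [(-1,1,6), (1,2,5), (2,3,4), (1,3,5)])"
| G19: "listed (bracket_of [(1,2,1,4), (1,4,1,5), (1,5,1,6)])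
         (form_of [(1,1,3), (1,2,6), (-1,4,5)])"
| G21: "listed (bracket_of [(1,2,1,4), (1,4,1,6), (2,3,1,6)])
         (form_of [(1,1,6), (1,2,5), (-1,3,4)])"
| G23_1: "listed (bracket_of [(1,2,1,5), (1,3,1,6)])
         (form_of [(1,1,6), (1,2,5), (1,3,4)])"
| G23_2: "listed (bracket_of [(1,2,1,5), (1,3,1,6)])
         (form_of [(1,1,4), (1,2,6), (1,3,5)])"
| G23_3: "listed (bracket_of [(1,2,1,5), (1,3,1,6)])
         (form_of [(1,1,4), (1,2,5), (-1,3,6)])"
| G24: "listed (bracket_of [(2,3,1,5), (1,4,1,6)])
         (form_of [(1,1,6), (1,2,5), (1,3,4)])"
| G25: "listed (bracket_of [(1,2,1,6)])
         (form_of [(1,1,6), (1,2,5), (1,3,4)])"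

end

theory Submission
  imports Defs
begin

text \<open>
  Let \<^term>\<open>U\<close> and \<^term>\<open>V\<close> be the eigenspaces of a compatible para-complex structure. They are
  complementary Lagrangian subalgebras of dimension 3, paired by \<^term>\<open>\<omega>\<close>, and para-Kaehler
  structures will be studied through this pair.

  The key point (\<open>central_pair_exists\<close>) is that both \<^term>\<open>U\<close> and \<^term>\<open>V\<close> contain a nonzero
  vector that is central in the whole algebra, and that these vectors \<^term>\<open>c\<close> and \<^term>\<open>d\<close> may be
  taken orthogonal. A three-dimensional nilpotent algebra is abelian or the Heisenberg algebra. If
  \<^term>\<open>U\<close> is not abelian, its commutator is central in the whole algebra, because the form is closed
  and because iterated brackets vanish. If \<^term>\<open>U\<close> and \<^term>\<open>V\<close> are both abelian, the components
  of any central vector are central. What remains is to find a partner in an abelian \<^term>\<open>V\<close> for a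
  given central vector of \<^term>\<open>U\<close>; Engel's theorem supplies it.

  In a basis dual with respect to \<^term>\<open>\<omega>\<close> and containing \<^term>\<open>c\<close> and \<^term>\<open>d\<close>, nilpotency kills
  most structure constants and closedness relates the others (\<open>normal_form_exists\<close>). Two things
  follow from these structure equations. There is a flag of ideals, invariant under the structure and
  equal to its own dual under the form, which brackets lower. Hence the structure is nilpotent; and
  by Koszul's formula the Levi-Civita connection lowers the flag too, so the traces that make up the
  Ricci tensor vanish. On the other hand the structure equations are so explicit that the algebra can
  be recognised: apart from a few degenerate cases it is given by a pencil of 2 by 2 matrices, whose
  type (real, double or complex eigenvalues, or lower rank) decides which of the fifteen algebras it
  is (\<open>has_model_normal_form\<close>).

  The existence of a para-Kaehler structure depends on the Lie algebra alone, so for the converse one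
  structure on each of the fifteen algebras is enough. The statement about all compatible
  structures on the listed algebras is the general result on nilpotency and Ricci-flatness, once the
  listed forms are known to be symplectic.
\<close>

section \<open>Nilpotent Lie algebras\<close>

locale nilpotent_lie_algebra =
  fixes br :: "'a::real_vector \<Rightarrow> 'a \<Rightarrow> 'a"
  assumes lie: "lie_algebra br" and nil: "nilpotent_lie br"
begin

lemma bilinear_br: "bilinear br"
  using lie by (simp add: lie_algebra_def)

lemmas br_simps =
  bilinear_ladd[OF bilinear_br] bilinear_radd[OF bilinear_br]
  bilinear_lsub[OF bilinear_br] bilinear_rsub[OF bilinear_br]
  bilinear_lneg[OF bilinear_br] bilinear_rneg[OF bilinear_br]
  bilinear_lmul[OF bilinear_br] bilinear_rmul[OF bilinear_br]
  bilinear_lzero[OF bilinear_br] bilinear_rzero[OF bilinear_br]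

lemma br_self [simp]: "br x x = 0"
  using lie by (simp add: lie_algebra_def)

lemma br_flip: "br x y = - br y x"
proof -
  have "br y x + br x y = br (x + y) (x + y)"
    by (simp only: br_simps br_self[of x] br_self[of y] add_0_left add_0_right)
  also have "\<dots> = 0" by (rule br_self)
  finally show ?thesis by (simp only: eq_neg_iff_add_eq_0 add.commute[of "br x y"])
qed

lemma br_zero_flip: "br x y = 0 \<Longrightarrow> br y x = 0"
  using br_flip[of y x] by simp

lemma jacobi: "br x (br y z) = br (br x y) z + br y (br x z)"
proof -
  have "br x (br y z) + br y (br z x) + br z (br x y) = 0"
    using lie by (simp add: lie_algebra_def)
  moreover have "br y (br z x) = - br y (br x z)"
    using br_flip[of z x] by (simp add: br_simps)
  moreover have "br z (br x y) = - br (br x y) z"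
    by (rule br_flip)
  ultimately show ?thesis by (simp add: algebra_simps)
qed

text \<open>This is the form of Engel's theorem on which everything rests. Otherwise an element of
  \<^term>\<open>M - I\<close> could be bracketed with elements of \<^term>\<open>A\<close> forever without leaving
  \<^term>\<open>M - I\<close>, whereas an iterated bracket of large length vanishes. Neither \<^term>\<open>M\<close> nor
  \<^term>\<open>I\<close> has to be a subspace.\<close>

lemma engel:
  assumes "0 \<in> I" "m0 \<in> M" "m0 \<notin> I" and stable: "\<And>a m. a \<in> A \<Longrightarrow> m \<in> M \<Longrightarrow> br a m \<in> M"
  shows "\<exists>m\<in>M. m \<notin> I \<and> (\<forall>a\<in>A. br a m \<in> I)"
proof (rule ccontr)
  assume "\<not> ?thesis"
  then have escape: "\<exists>a\<in>A. br a m \<notin> I" if "m \<in> M" "m \<notin> I" for m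
    using that by blast
  have long: "\<exists>m\<in>M. m \<notin> I \<and> m \<in> lower_central br k" for k
  proof (induction k)
    case 0
    then show ?case using assms by auto
  next
    case (Suc k)
    then obtain m where m: "m \<in> M" "m \<notin> I" "m \<in> lower_central br k" by blast
    with escape obtain a where "a \<in> A" "br a m \<notin> I" by blast
    then show ?case using m stable by (auto intro!: bexI[of _ "br a m"] span_base)
  qed
  obtain k where "lower_central br k = {0}"
    using nil by (auto simp: nilpotent_lie_def)
  then show False using long[of k] \<open>0 \<in> I\<close> by auto
qed

text \<open>Infinitesimally: a nilpotent operator has no eigenvalue except 0, also on a quotient.\<close>

lemma eigenvalue_zero:
  assumes I: "subspace I" "\<And>i. i \<in> I \<Longrightarrow> br a i \<in> I"
    and m: "m \<notin> I" "br a m - r *\<^sub>R m \<in> I"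
  shows "r = 0"
proof (rule ccontr)
  assume "r \<noteq> 0"
  define M where "M = {t *\<^sub>R m + i | t i. i \<in> I}"
  have Mstable: "br a v \<in> M" if "v \<in> M" for v
  proof -
    from that obtain t i where v: "i \<in> I" "v = t *\<^sub>R m + i" by (auto simp: M_def)
    then have "br a v = (t * r) *\<^sub>R m + (t *\<^sub>R (br a m - r *\<^sub>R m) + br a i)"
      by (simp add: br_simps algebra_simps)
    moreover have "t *\<^sub>R (br a m - r *\<^sub>R m) + br a i \<in> I"
      using I m v by (intro subspace_add subspace_scale) auto
    ultimately show ?thesis unfolding M_def by blast
  qed
  have "m = 1 *\<^sub>R m + 0" by simp
  then have "m \<in> M" unfolding M_def using subspace_0[OF I(1)] by blast
  then have "\<exists>v\<in>M. v \<notin> I \<and> (\<forall>b\<in>{a}. br b v \<in> I)"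
    using Mstable m(1) subspace_0[OF I(1)] by (intro engel) auto
  then obtain v where v: "v \<in> M" "v \<notin> I" "br a v \<in> I" by blast
  then obtain t i where ti: "i \<in> I" "v = t *\<^sub>R m + i" by (auto simp: M_def)
  have "br a v - br a i - t *\<^sub>R (br a m - r *\<^sub>R m) \<in> I"
    by (rule subspace_diff[OF I(1) subspace_diff[OF I(1) v(3) I(2)[OF ti(1)]] subspace_scale[OF I(1) m(2)]])
  then have "(t * r) *\<^sub>R m \<in> I"
    using ti by (simp add: br_simps algebra_simps)
  then have "inverse (t * r) *\<^sub>R (t * r) *\<^sub>R m \<in> I"
    by (rule subspace_scale[OF I(1)])
  moreover have "inverse (t * r) *\<^sub>R (t * r) *\<^sub>R m = m" if "t \<noteq> 0"
    using that \<open>r \<noteq> 0\<close> by (simp only: scaleR_scaleR left_inverse mult_eq_0_iff simp_thms scaleR_one)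
  ultimately have "t = 0" using m(1) by metis
  then show False using ti v by simp
qed

text \<open>The functional is an eigenvector of the transposed operator.\<close>

lemma invariant_hyperplane:
  fixes \<xi> :: "'a \<Rightarrow> real"
  assumes \<xi>: "linear \<xi>" and inv: "\<And>z. \<xi> z = 0 \<Longrightarrow> \<xi> (br a z) = 0"
  shows "\<xi> (br a z) = 0"
proof (cases "\<xi> z = 0")
  case False
  have "subspace {v. \<xi> v = 0}"
    using \<xi> by (auto simp: subspace_def linear_add linear_scale linear_0)
  moreover have "\<xi> (br a z - (\<xi> (br a z) / \<xi> z) *\<^sub>R z) = 0"
    using \<xi> False by (simp add: linear_diff linear_scale)
  ultimately have "\<xi> (br a z) / \<xi> z = 0"
    using eigenvalue_zero[of "{v. \<xi> v = 0}" a z "\<xi> (br a z) / \<xi> z"] inv False by simp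
  then show ?thesis using False by simp
qed (rule inv)

end

section \<open>Pairs of complementary Lagrangian subalgebras\<close>

text \<open>The eigenspaces of a compatible para-complex structure are two complementary Lagrangian
  subalgebras. The structure is recovered from them, and they are interchangeable; every
  statement below may be applied with \<^term>\<open>U\<close> and \<^term>\<open>V\<close> swapped.\<close>

locale lagrangian_pair = nilpotent_lie_algebra br
  for br :: "'a::real_vector \<Rightarrow> 'a \<Rightarrow> 'a" +
  fixes \<omega> :: "'a \<Rightarrow> 'a \<Rightarrow> real" and U V :: "'a set"
  assumes symplectic: "symplectic_form br \<omega>"
    and subspace_U: "subspace U" and subspace_V: "subspace V"
    and dim_U: "dim U = 3" and dim_V: "dim V = 3"
    and iso_U: "\<And>x y. x \<in> U \<Longrightarrow> y \<in> U \<Longrightarrow> \<omega> x y = 0"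
    and iso_V: "\<And>x y. x \<in> V \<Longrightarrow> y \<in> V \<Longrightarrow> \<omega> x y = 0"
    and br_U: "\<And>x y. x \<in> U \<Longrightarrow> y \<in> U \<Longrightarrow> br x y \<in> U"
    and br_V: "\<And>x y. x \<in> V \<Longrightarrow> y \<in> V \<Longrightarrow> br x y \<in> V"
    and decompose: "\<And>z. \<exists>u\<in>U. \<exists>v\<in>V. z = u + v"

lemma (in lagrangian_pair) swap: "lagrangian_pair br \<omega> V U"
proof unfold_locales
  fix z
  obtain u v where "u \<in> U" "v \<in> V" "z = u + v" using decompose by blast
  then show "\<exists>u\<in>V. \<exists>v\<in>U. z = u + v" by (intro bexI[of _ v] bexI[of _ u]) (auto simp: add.commute)
qed (use symplectic subspace_U subspace_V dim_U dim_V iso_U iso_V br_U br_V in auto)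

lemma three_dim_not_spanned_by_two:
  assumes "dim W = 3"
  shows "\<exists>w\<in>W. w \<notin> span {a, b}"
proof (rule ccontr)
  assume "\<not> (\<exists>w\<in>W. w \<notin> span {a, b})"
  then have "W \<subseteq> span {a, b}" by blast
  then have "dim W \<le> card {a, b}" by (intro dim_le_card) auto
  also have "card {a, b} \<le> 2" by (simp add: card_insert_if)
  finally show False using assms by simp
qed

lemma three_independent_span:
  assumes W: "subspace W" "dim W = 3" and abc: "a \<in> W" "b \<in> W" "c \<in> W"
    and ind: "\<And>r s t. r *\<^sub>R a + s *\<^sub>R b + t *\<^sub>R c = 0 \<Longrightarrow> r = 0 \<and> s = 0 \<and> t = 0"
    and "w \<in> W"
  shows "\<exists>r s t. w = r *\<^sub>R a + s *\<^sub>R b + t *\<^sub>R c"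
proof -
  have "a \<notin> span {b, c}"
  proof
    assume "a \<in> span {b, c}"
    then obtain s t where "a - s *\<^sub>R b - t *\<^sub>R c = 0"
      by (auto simp: span_insert)
    then show False using ind[of 1 "- s" "- t"] by simp
  qed
  moreover have "b \<notin> span {c}"
  proof
    assume "b \<in> span {c}"
    then obtain t where "b = t *\<^sub>R c" by (auto simp: span_singleton)
    then show False using ind[of 0 1 "- t"] by simp
  qed
  moreover have "c \<noteq> 0" using ind[of 0 0 1] by auto
  moreover have "b \<noteq> c" "a \<noteq> b" "a \<noteq> c" using ind[of 0 1 "-1"] ind[of 1 "-1" 0] ind[of 1 0 "-1"] by auto
  ultimately have ind3: "independent {a, b, c}" and card3: "card {a, b, c} = 3"
    by (auto simp: independent_insert)
  obtain B where B: "B \<subseteq> W" "independent B" "W \<subseteq> span B" "card B = dim W"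
    by (rule basis_exists)
  then have "finite B" using W(2) by (simp add: card_ge_0_finite)
  have "w \<in> span {a, b, c}"
  proof (rule ccontr)
    assume w: "w \<notin> span {a, b, c}"
    then have "w \<notin> {a, b, c}" using span_base by metis
    then have "independent {w, a, b, c}" "card {w, a, b, c} = 4"
      using ind3 card3 w by (auto simp: independent_insert)
    moreover have "{w, a, b, c} \<subseteq> span B" using B(3) abc \<open>w \<in> W\<close> by auto
    ultimately show False
      using independent_span_bound[OF \<open>finite B\<close>, of "{w, a, b, c}"] B(4) W(2) by simp
  qed
  then obtain r s t where "w - r *\<^sub>R a - s *\<^sub>R b - t *\<^sub>R c = 0"
    by (auto simp: span_insert)
  then have "w = r *\<^sub>R a + s *\<^sub>R b + t *\<^sub>R c"
    by (simp add: algebra_simps)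
  then show ?thesis by blast
qed

context lagrangian_pair
begin

lemma bilinear_omega: "bilinear \<omega>"
  using symplectic by (simp add: symplectic_form_def)

lemmas omega_simps =
  bilinear_ladd[OF bilinear_omega] bilinear_radd[OF bilinear_omega]
  bilinear_lsub[OF bilinear_omega] bilinear_rsub[OF bilinear_omega]
  bilinear_lneg[OF bilinear_omega] bilinear_rneg[OF bilinear_omega]
  bilinear_lmul[OF bilinear_omega] bilinear_rmul[OF bilinear_omega]
  bilinear_lzero[OF bilinear_omega] bilinear_rzero[OF bilinear_omega]

lemma linear_omega: "linear (\<omega> z)" "linear (\<lambda>x. \<omega> x z)"
  using bilinear_omega by (auto simp: bilinear_def)

lemma omega_self [simp]: "\<omega> x x = 0"
  using symplectic by (simp add: symplectic_form_def)

lemma omega_flip: "\<omega> x y = - \<omega> y x"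
proof -
  have "\<omega> y x + \<omega> x y = \<omega> (x + y) (x + y)"
    by (simp only: omega_simps omega_self[of x] omega_self[of y] add_0_left add_0_right)
  also have "\<dots> = 0" by (rule omega_self)
  finally show ?thesis by (simp only: eq_neg_iff_add_eq_0 add.commute[of "\<omega> x y"])
qed

lemma omega_zero_flip: "\<omega> x y = 0 \<Longrightarrow> \<omega> y x = 0"
  using omega_flip[of y x] by simp

lemma nondegenerate: "(\<And>y. \<omega> x y = 0) \<Longrightarrow> x = 0"
  using symplectic by (simp add: symplectic_form_def)

lemma closed: "\<omega> (br x y) z = \<omega> (br x z) y - \<omega> (br y z) x"
proof -
  have "\<omega> (br x y) z - \<omega> (br x z) y + \<omega> (br y z) x = 0"
    using symplectic unfolding symplectic_form_def by blast
  then show ?thesis by simp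
qed

lemma omega_br_central: "(\<And>x. br z x = 0) \<Longrightarrow> \<omega> (br x y) z = 0"
  using closed[of x y z] br_zero_flip[of z] by (simp add: omega_simps)

lemma nondegenerate_U:
  assumes "u \<in> U" "\<And>v. v \<in> V \<Longrightarrow> \<omega> u v = 0" shows "u = 0"
proof (rule nondegenerate)
  fix z obtain u' v where "u' \<in> U" "v \<in> V" "z = u' + v" using decompose by blast
  then show "\<omega> u z = 0" using assms by (simp add: omega_simps iso_U)
qed

lemma nondegenerate_V:
  assumes "v \<in> V" "\<And>u. u \<in> U \<Longrightarrow> \<omega> u v = 0" shows "v = 0"
  using lagrangian_pair.nondegenerate_U[OF swap assms(1)] assms(2) omega_zero_flip by blast

lemma disjoint: "z \<in> U \<Longrightarrow> z \<in> V \<Longrightarrow> z = 0"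
  by (auto intro!: nondegenerate_U iso_V)

text \<open>The partners are \<^term>\<open>x\<close> and \<^term>\<open>d\<close>, \<^term>\<open>p\<close> and \<^term>\<open>q\<close>, \<^term>\<open>c\<close> and \<^term>\<open>y\<close>. In use,
  \<^term>\<open>c\<close> and \<^term>\<open>d\<close> are the distinguished vectors, and they are not each other's partners.\<close>

definition dual_basis :: "'a \<Rightarrow> 'a \<Rightarrow> 'a \<Rightarrow> 'a \<Rightarrow> 'a \<Rightarrow> 'a \<Rightarrow> bool" where
  "dual_basis x p c d q y \<longleftrightarrow>
     x \<in> U \<and> p \<in> U \<and> c \<in> U \<and> d \<in> V \<and> q \<in> V \<and> y \<in> V \<and>
     \<omega> x d = 1 \<and> \<omega> x q = 0 \<and> \<omega> x y = 0 \<and>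
     \<omega> p d = 0 \<and> \<omega> p q = 1 \<and> \<omega> p y = 0 \<and>
     \<omega> c d = 0 \<and> \<omega> c q = 0 \<and> \<omega> c y = 1"

lemma dual_partner:
  assumes "u \<in> U" "u \<noteq> 0" obtains v where "v \<in> V" "\<omega> u v = 1"
proof -
  obtain v where v: "v \<in> V" "\<omega> u v \<noteq> 0" using nondegenerate_U assms by blast
  show thesis
    using that[of "inverse (\<omega> u v) *\<^sub>R v"] v subspace_V by (simp add: omega_simps subspace_scale)
qed

lemma dual_basis_exists:
  assumes "c \<in> U" "c \<noteq> 0" "d \<in> V" "d \<noteq> 0" "\<omega> c d = 0"
  obtains x p q y where "dual_basis x p c d q y"
proof -
  obtain y where y: "y \<in> V" "\<omega> c y = 1" using dual_partner assms by blast
  obtain x0 where x0: "x0 \<in> U" "\<omega> d x0 = 1"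
    using lagrangian_pair.dual_partner[OF swap] assms by blast
  define x where "x = - x0 + \<omega> x0 y *\<^sub>R c"
  have x: "x \<in> U" "\<omega> x d = 1" "\<omega> x y = 0"
    using x0 y assms subspace_U omega_flip[of x0 d]
    by (auto simp: x_def omega_simps intro!: subspace_add subspace_diff subspace_scale subspace_neg)
  obtain p0 where p0: "p0 \<in> U" "p0 \<notin> span {x, c}"
    using three_dim_not_spanned_by_two[OF dim_U] by blast
  define p where "p = p0 - \<omega> p0 d *\<^sub>R x - \<omega> p0 y *\<^sub>R c"
  have p: "p \<in> U" "\<omega> p d = 0" "\<omega> p y = 0"
    using p0 x y assms subspace_U
    by (auto simp: p_def omega_simps intro!: subspace_diff subspace_scale)
  have "p \<noteq> 0"
  proof
    assume "p = 0"
    then have "p0 = \<omega> p0 d *\<^sub>R x + \<omega> p0 y *\<^sub>R c" by (simp add: p_def algebra_simps)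
    then have "p0 \<in> span {x, c}"
      by (metis insertI1 insert_commute span_add span_base span_scale)
    then show False using p0 by blast
  qed
  then obtain q0 where q0: "q0 \<in> V" "\<omega> p q0 = 1" using dual_partner p by blast
  define q where "q = q0 - \<omega> x q0 *\<^sub>R d - \<omega> c q0 *\<^sub>R y"
  have "q \<in> V" "\<omega> p q = 1" "\<omega> x q = 0" "\<omega> c q = 0"
    using q0 x y p assms subspace_V
    by (auto simp: q_def omega_simps intro!: subspace_diff subspace_scale)
  then have "dual_basis x p c d q y"
    using assms x y p by (simp add: dual_basis_def)
  then show thesis by (rule that)
qed

lemma dual_basis_U:
  assumes b: "dual_basis x p c d q y" and "u \<in> U"
  shows "u = \<omega> u d *\<^sub>R x + \<omega> u q *\<^sub>R p + \<omega> u y *\<^sub>R c"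
proof -
  have ind: "r = 0 \<and> s = 0 \<and> t = 0" if "r *\<^sub>R x + s *\<^sub>R p + t *\<^sub>R c = 0" for r s t
  proof -
    from that have "\<omega> (r *\<^sub>R x + s *\<^sub>R p + t *\<^sub>R c) v = 0" for v by (simp add: omega_simps)
    from this[of d] this[of q] this[of y] show ?thesis
      using b by (simp add: dual_basis_def omega_simps)
  qed
  obtain r s t where "u = r *\<^sub>R x + s *\<^sub>R p + t *\<^sub>R c"
    using three_independent_span[OF subspace_U dim_U _ _ _ ind \<open>u \<in> U\<close>] b
    unfolding dual_basis_def by blast
  then show ?thesis using b by (simp add: dual_basis_def omega_simps)
qed

lemma dual_basis_V:
  assumes b: "dual_basis x p c d q y" and "v \<in> V"
  shows "v = \<omega> x v *\<^sub>R d + \<omega> p v *\<^sub>R q + \<omega> c v *\<^sub>R y"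
proof -
  have ind: "r = 0 \<and> s = 0 \<and> t = 0" if "r *\<^sub>R d + s *\<^sub>R q + t *\<^sub>R y = 0" for r s t
  proof -
    from that have "\<omega> u (r *\<^sub>R d + s *\<^sub>R q + t *\<^sub>R y) = 0" for u by (simp add: omega_simps)
    from this[of x] this[of p] this[of c] show ?thesis
      using b by (simp add: dual_basis_def omega_simps)
  qed
  obtain r s t where "v = r *\<^sub>R d + s *\<^sub>R q + t *\<^sub>R y"
    using three_independent_span[OF subspace_V dim_V _ _ _ ind \<open>v \<in> V\<close>] b
    unfolding dual_basis_def by blast
  then show ?thesis using b by (simp add: dual_basis_def omega_simps)
qed

lemma dual_basis_expand:
  assumes b: "dual_basis x p c d q y"
  shows "z = \<omega> z d *\<^sub>R x + \<omega> z q *\<^sub>R p + \<omega> z y *\<^sub>R c + \<omega> x z *\<^sub>R d + \<omega> p z *\<^sub>R q + \<omega> c z *\<^sub>R y"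
proof -
  obtain u v where uv: "u \<in> U" "v \<in> V" "z = u + v" using decompose by blast
  have "\<omega> z d = \<omega> u d" "\<omega> z q = \<omega> u q" "\<omega> z y = \<omega> u y"
       "\<omega> x z = \<omega> x v" "\<omega> p z = \<omega> p v" "\<omega> c z = \<omega> c v"
    using b uv by (auto simp: dual_basis_def omega_simps iso_U iso_V)
  moreover have "z = (\<omega> u d *\<^sub>R x + \<omega> u q *\<^sub>R p + \<omega> u y *\<^sub>R c) + (\<omega> x v *\<^sub>R d + \<omega> p v *\<^sub>R q + \<omega> c v *\<^sub>R y)"
    using uv(3) arg_cong2[OF dual_basis_U[OF b uv(1)] dual_basis_V[OF b uv(2)], of "(+)"] by (rule trans)
  ultimately show ?thesis by (simp only: add.assoc)
qed

end

section \<open>A pair of central vectors\<close>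

lemma span_insert_subspace: "subspace W \<Longrightarrow> span (insert c W) = {z. \<exists>s. z - s *\<^sub>R c \<in> W}"
  by (simp add: span_insert span_eq_iff[THEN iffD2])

context lagrangian_pair
begin

lemma eigenvector_zero: "m \<noteq> 0 \<Longrightarrow> br a m = r *\<^sub>R m \<Longrightarrow> r = 0"
  using eigenvalue_zero[of "{0}" a m r] by (simp add: subspace_0 subspace_single_0 br_simps)

text \<open>One step of a flag of \<^term>\<open>V\<close> for the action of \<^term>\<open>U\<close> modulo \<^term>\<open>U\<close>.\<close>

lemma flag_step:
  assumes I: "subspace I" "U \<subseteq> I" and "v0 \<in> V" "v0 \<notin> I"
  shows "\<exists>e\<in>V. e \<notin> I \<and> (\<forall>u\<in>U. br u e \<in> I)"
proof -
  have "\<exists>m\<in>UNIV. m \<notin> I \<and> (\<forall>u\<in>U. br u m \<in> I)"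
    by (rule engel[where ?m0.0 = v0]) (use assms subspace_0 in auto)
  then obtain m where m: "m \<notin> I" "\<And>u. u \<in> U \<Longrightarrow> br u m \<in> I" by blast
  obtain u e where ue: "u \<in> U" "e \<in> V" "m = u + e" using decompose by blast
  show ?thesis
  proof (intro bexI conjI ballI)
    show "e \<in> V" by fact
    show "e \<notin> I" using m(1) ue(1,3) I subspace_add[of I u e] by auto
    fix u' assume u': "u' \<in> U"
    have "br u' m - br u' u \<in> I"
      using m(2)[OF u'] br_U[OF u' ue(1)] I by (intro subspace_diff) auto
    then show "br u' e \<in> I" by (simp add: ue br_simps)
  qed
qed

text \<open>A three-dimensional nilpotent Lie algebra is abelian or the Heisenberg algebra.\<close>

lemma heisenberg:
  assumes xy: "x \<in> U" "y \<in> U" "br x y \<noteq> 0"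
  shows heisenberg_central: "u \<in> U \<Longrightarrow> br (br x y) u = 0"
    and heisenberg_span: "u \<in> U \<Longrightarrow> \<exists>r s t. u = r *\<^sub>R x + s *\<^sub>R y + t *\<^sub>R br x y"
proof -
  have "x \<noteq> 0" using xy by (auto simp: br_simps)
  have "\<exists>z\<in>U. z \<notin> {0} \<and> (\<forall>u\<in>U. br u z \<in> {0})"
    by (rule engel[where ?m0.0 = x]) (use xy \<open>x \<noteq> 0\<close> br_U in auto)
  then obtain z where z: "z \<in> U" "z \<noteq> 0" "\<And>u. u \<in> U \<Longrightarrow> br u z = 0" by blast
  have z': "br z u = 0" if "u \<in> U" for u using br_zero_flip z that by blast
  have ind: "r = 0 \<and> s = 0 \<and> t = 0" if 0: "r *\<^sub>R x + s *\<^sub>R y + t *\<^sub>R z = 0" for r s t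
  proof -
    have "br (r *\<^sub>R x + s *\<^sub>R y + t *\<^sub>R z) y = 0" "br x (r *\<^sub>R x + s *\<^sub>R y + t *\<^sub>R z) = 0"
      unfolding 0 by (simp_all add: br_simps)
    then have "r *\<^sub>R br x y = 0" "s *\<^sub>R br x y = 0"
      using z'[OF xy(2)] z(3)[OF xy(1)] by (simp_all add: br_simps)
    then show ?thesis using xy 0 z by simp
  qed
  have span: "\<exists>r s t. u = r *\<^sub>R x + s *\<^sub>R y + t *\<^sub>R z" if "u \<in> U" for u
    using three_independent_span[OF subspace_U dim_U xy(1,2) z(1) ind that] .
  obtain r s t where w: "br x y = r *\<^sub>R x + s *\<^sub>R y + t *\<^sub>R z"
    using span br_U xy by blast
  have "br x (br x y) = s *\<^sub>R br x y"
    using arg_cong[OF w, of "br x"] by (simp add: br_simps z xy)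
  then have "s = 0" using eigenvector_zero xy by blast
  have "br y (br x y) = - r *\<^sub>R br x y"
    using arg_cong[OF w, of "br y"] br_flip[of y x] by (simp add: br_simps z xy)
  then have "r = 0" using eigenvector_zero[of "br x y" y "- r"] xy by simp
  have w: "br x y = t *\<^sub>R z" using w \<open>r = 0\<close> \<open>s = 0\<close> by simp
  show "br (br x y) u = 0" if "u \<in> U" using w z' that by (simp add: br_simps)
  have "t \<noteq> 0" using w xy by auto
  then have "z = inverse t *\<^sub>R br x y" using w by simp
  then show "\<exists>r s t. u = r *\<^sub>R x + s *\<^sub>R y + t *\<^sub>R br x y" if "u \<in> U"
    using span[OF that] by (metis scaleR_scaleR)
qed

lemma heisenberg_commutators:
  assumes xy: "x \<in> U" "y \<in> U" "br x y \<noteq> 0" and "u \<in> U" "v \<in> U"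
  shows "\<exists>t. br u v = t *\<^sub>R br x y"
proof -
  obtain r s t where u: "u = r *\<^sub>R x + s *\<^sub>R y + t *\<^sub>R br x y"
    using heisenberg_span[OF xy \<open>u \<in> U\<close>] by blast
  obtain r' s' t' where v: "v = r' *\<^sub>R x + s' *\<^sub>R y + t' *\<^sub>R br x y"
    using heisenberg_span[OF xy \<open>v \<in> U\<close>] by blast
  have 0: "br (br x y) x = 0" "br (br x y) y = 0" "br x (br x y) = 0" "br y (br x y) = 0"
    using heisenberg_central[OF xy] xy br_zero_flip by blast+
  have "br u v = (r * s' - s * r') *\<^sub>R br x y"
    unfolding u v using br_flip[of y x] by (simp add: br_simps 0 algebra_simps)
  then show ?thesis by blast
qed

text \<open>On \<^term>\<open>V\<close>, identified with the quotient of the whole algebra by \<^term>\<open>U\<close>, the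
  subalgebra \<^term>\<open>U\<close> acts by strictly triangular matrices. A commutator acts by a multiple of
  the corner matrix unit, and closedness of the form forces this multiple to be 0.\<close>

lemma heisenberg_commutator_action:
  assumes xy: "x \<in> U" "y \<in> U" "br x y \<noteq> 0" and "a \<in> V"
  shows "br (br x y) a \<in> U"
proof -
  define w where "w = br x y"
  have wU: "w \<in> U" using xy br_U by (simp add: w_def)
  have w0: "br u w = 0" if "u \<in> U" for u
    using heisenberg_central[OF xy] that br_zero_flip unfolding w_def by blast
  note U = subspace_add[OF subspace_U] subspace_diff[OF subspace_U] subspace_scale[OF subspace_U]
    subspace_0[OF subspace_U]
  obtain v1 where v1: "v1 \<in> V" "v1 \<notin> span {0, 0}"
    using three_dim_not_spanned_by_two[OF dim_V] by blast
  have "v1 \<notin> U" using v1 disjoint[of v1] span_0[of "{0,0}"] by metis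
  \<comment> \<open>the flag spanned modulo U by e1, e2, e3\<close>
  then obtain e1 where e1: "e1 \<in> V" "e1 \<notin> U" "\<And>u. u \<in> U \<Longrightarrow> br u e1 \<in> U"
    using flag_step[OF subspace_U order_refl v1(1)] by blast
  define I where "I = span (insert e1 U)"
  have I: "subspace I" "U \<subseteq> I"
    by (auto simp: I_def intro: span_base)
  have inI: "z \<in> I \<longleftrightarrow> (\<exists>s. z - s *\<^sub>R e1 \<in> U)" for z
    by (simp add: I_def span_insert_subspace subspace_U)
  obtain v2 where v2: "v2 \<in> V" "v2 \<notin> span {e1, e1}"
    using three_dim_not_spanned_by_two[OF dim_V] by blast
  have "v2 \<notin> I"
  proof
    assume "v2 \<in> I"
    then obtain s where "v2 - s *\<^sub>R e1 \<in> U" unfolding inI by blast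
    moreover have "v2 - s *\<^sub>R e1 \<in> V" using v2 e1 subspace_V by (intro subspace_diff subspace_scale)
    ultimately have "v2 = s *\<^sub>R e1" using disjoint by (metis eq_iff_diff_eq_0)
    then show False using v2(2) by (simp add: span_base span_scale)
  qed
  then obtain e2 where e2: "e2 \<in> V" "e2 \<notin> I" "\<And>u. u \<in> U \<Longrightarrow> br u e2 \<in> I"
    using flag_step[OF I v2(1)] by blast
  define K where "K = span (insert e2 I)"
  have K: "subspace K" "U \<subseteq> K"
    using I by (auto simp: K_def intro: span_base)
  have inK: "z \<in> K \<longleftrightarrow> (\<exists>t s. z - t *\<^sub>R e2 - s *\<^sub>R e1 \<in> U)" for z
    by (simp add: K_def span_insert_subspace I inI)
  obtain v3 where v3: "v3 \<in> V" "v3 \<notin> span {e1, e2}"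
    using three_dim_not_spanned_by_two[OF dim_V] by blast
  have "v3 \<notin> K"
  proof
    assume "v3 \<in> K"
    then obtain s t where "v3 - t *\<^sub>R e2 - s *\<^sub>R e1 \<in> U" unfolding inK by blast
    moreover have "v3 - t *\<^sub>R e2 - s *\<^sub>R e1 \<in> V"
      using v3 e1 e2 subspace_V by (intro subspace_diff subspace_scale)
    ultimately have "v3 - t *\<^sub>R e2 - s *\<^sub>R e1 = 0" using disjoint by blast
    then have "v3 = s *\<^sub>R e1 + t *\<^sub>R e2" by (simp add: algebra_simps)
    then show False using v3(2) by (simp add: span_base span_scale span_add)
  qed
  then obtain e3 where e3: "e3 \<in> V" "e3 \<notin> K" "\<And>u. u \<in> U \<Longrightarrow> br u e3 \<in> K"
    using flag_step[OF K v3(1)] by blast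
  have ind: "r = 0 \<and> s = 0 \<and> t = 0" if 0: "r *\<^sub>R e1 + s *\<^sub>R e2 + t *\<^sub>R e3 = 0" for r s t
  proof -
    have "t = 0"
    proof (rule ccontr)
      assume "t \<noteq> 0"
      then have "e3 - (- s / t) *\<^sub>R e2 - (- r / t) *\<^sub>R e1 = inverse t *\<^sub>R (r *\<^sub>R e1 + s *\<^sub>R e2 + t *\<^sub>R e3)"
        by (simp add: scaleR_add_right divide_inverse mult.commute)
      also have "\<dots> \<in> U" unfolding 0 using U(4) by simp
      finally show False using e3(2) inK by blast
    qed
    moreover have "s = 0"
    proof (rule ccontr)
      assume "s \<noteq> 0"
      then have "e2 - (- r / s) *\<^sub>R e1 = inverse s *\<^sub>R (r *\<^sub>R e1 + s *\<^sub>R e2 + t *\<^sub>R e3)"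
        using \<open>t = 0\<close> by (simp add: scaleR_add_right divide_inverse mult.commute)
      also have "\<dots> \<in> U" unfolding 0 using U(4) by simp
      finally show False using e2(2) inI by blast
    qed
    moreover have "e1 \<noteq> 0" using e1(2) U(4) by auto
    ultimately show ?thesis using 0 by simp
  qed
  obtain Ax Ay where A: "br x e2 - Ax *\<^sub>R e1 \<in> U" "br y e2 - Ay *\<^sub>R e1 \<in> U"
    using e2(3)[OF xy(1)] e2(3)[OF xy(2)] unfolding inI by blast
  obtain Cx Dx where Cx: "br x e3 - Cx *\<^sub>R e2 - Dx *\<^sub>R e1 \<in> U"
    using e3(3)[OF xy(1)] unfolding inK by blast
  obtain Cy Dy where Cy: "br y e3 - Cy *\<^sub>R e2 - Dy *\<^sub>R e1 \<in> U"
    using e3(3)[OF xy(2)] unfolding inK by blast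
  define \<beta> where "\<beta> = Ax * Cy - Ay * Cx"
  have jac: "br w z = br x (br y z) - br y (br x z)" for z
    using jacobi[of x y z] by (simp add: w_def)
  have e1x: "br x e1 \<in> U" and e1y: "br y e1 \<in> U" using e1 xy by auto
  have we1: "br w e1 \<in> U"
    unfolding jac by (rule U(2)[OF br_U[OF xy(1) e1y] br_U[OF xy(2) e1x]])
  have we2: "br w e2 \<in> U"
  proof -
    have "br w e2 = (br x (br y e2 - Ay *\<^sub>R e1) + Ay *\<^sub>R br x e1)
                  - (br y (br x e2 - Ax *\<^sub>R e1) + Ax *\<^sub>R br y e1)"
      unfolding jac by (simp add: br_simps)
    also have "\<dots> \<in> U"
      by (rule U(2)[OF U(1)[OF br_U[OF xy(1) A(2)] U(3)[OF e1x]] U(1)[OF br_U[OF xy(2) A(1)] U(3)[OF e1y]]])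
    finally show ?thesis .
  qed
  have we3: "br w e3 - \<beta> *\<^sub>R e1 \<in> U"
  proof -
    have "br w e3 - \<beta> *\<^sub>R e1 =
       (br x (br y e3 - Cy *\<^sub>R e2 - Dy *\<^sub>R e1) + Dy *\<^sub>R br x e1 + Cy *\<^sub>R (br x e2 - Ax *\<^sub>R e1))
       - (br y (br x e3 - Cx *\<^sub>R e2 - Dx *\<^sub>R e1) + Dx *\<^sub>R br y e1 + Cx *\<^sub>R (br y e2 - Ay *\<^sub>R e1))"
      unfolding jac \<beta>_def by (simp add: br_simps algebra_simps)
    also have "\<dots> \<in> U"
      by (rule U(2)[OF U(1)[OF U(1)[OF br_U[OF xy(1) Cy] U(3)[OF e1x]] U(3)[OF A(1)]]
                      U(1)[OF U(1)[OF br_U[OF xy(2) Cx] U(3)[OF e1y]] U(3)[OF A(2)]]])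
    finally show ?thesis .
  qed
  have \<omega>U: "\<omega> z u = \<omega> z' u" if "z - z' \<in> U" "u \<in> U" for z z' u
    using iso_U[OF that] by (simp add: omega_simps)
  have "\<beta> = 0"
  proof (rule ccontr)
    assume "\<beta> \<noteq> 0"
    have act: "\<omega> (br u b) w = \<omega> (br w b) u" if "u \<in> U" for u b
      using closed[of u w b] w0[OF that] by (simp add: omega_simps)
    have "Ax * \<omega> e1 w = 0" "Ay * \<omega> e1 w = 0"
      using act[of x e2] act[of y e2] xy wU \<omega>U[OF A(1) wU] \<omega>U[OF A(2) wU] iso_U[OF we2]
      by (simp_all add: omega_simps)
    with \<open>\<beta> \<noteq> 0\<close> have e1w: "\<omega> e1 w = 0" by (auto simp: \<beta>_def)
    have bx: "\<beta> * \<omega> e1 x = Cx * \<omega> e2 w"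
      using act[of x e3] xy \<omega>U[OF we3 xy(1)] \<omega>U[of "br x e3" "Cx *\<^sub>R e2 + Dx *\<^sub>R e1" w] Cx wU e1w
      by (simp add: omega_simps diff_diff_eq)
    have byy: "\<beta> * \<omega> e1 y = Cy * \<omega> e2 w"
      using act[of y e3] xy \<omega>U[OF we3 xy(2)] \<omega>U[of "br y e3" "Cy *\<^sub>R e2 + Dy *\<^sub>R e1" w] Cy wU e1w
      by (simp add: omega_simps diff_diff_eq)
    have "\<omega> w e2 = Ax * \<omega> e1 y - Ay * \<omega> e1 x"
      using closed[of x y e2] \<omega>U[OF A(1) xy(2)] \<omega>U[OF A(2) xy(1)]
      by (simp add: omega_simps w_def)
    then have "\<beta> * \<omega> w e2 = Ax * (\<beta> * \<omega> e1 y) - Ay * (\<beta> * \<omega> e1 x)"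
      by (simp only: right_diff_distrib mult.left_commute)
    also have "\<dots> = Ax * (Cy * \<omega> e2 w) - Ay * (Cx * \<omega> e2 w)" by (simp only: bx byy)
    also have "\<dots> = \<beta> * \<omega> e2 w" by (simp add: \<beta>_def algebra_simps)
    finally have "\<omega> w e2 = \<omega> e2 w" using \<open>\<beta> \<noteq> 0\<close> by simp
    then have "\<omega> e2 w = 0" using omega_flip[of w e2] by simp
    then have "\<omega> e1 x = 0" "\<omega> e1 y = 0" using bx byy \<open>\<beta> \<noteq> 0\<close> by auto
    have "\<omega> u e1 = 0" if u: "u \<in> U" for u
    proof -
      obtain r s t where "u = r *\<^sub>R x + s *\<^sub>R y + t *\<^sub>R w"
        using heisenberg_span[OF xy u] unfolding w_def by blast
      then have "\<omega> e1 u = 0"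
        using \<open>\<omega> e1 x = 0\<close> \<open>\<omega> e1 y = 0\<close> e1w by (simp add: omega_simps)
      then show ?thesis by (rule omega_zero_flip)
    qed
    then have "e1 = 0" by (rule nondegenerate_V[OF e1(1)])
    then show False using e1(2) U(4) by simp
  qed
  obtain r s t where "a = r *\<^sub>R e1 + s *\<^sub>R e2 + t *\<^sub>R e3"
    using three_independent_span[OF subspace_V dim_V e1(1) e2(1) e3(1) ind \<open>a \<in> V\<close>] by blast
  then have "br w a = r *\<^sub>R br w e1 + s *\<^sub>R br w e2 + t *\<^sub>R br w e3" by (simp add: br_simps)
  also have "\<dots> \<in> U" using we1 we2 we3 \<open>\<beta> = 0\<close> by (intro U) auto
  finally show ?thesis by (simp add: w_def)
qed

text \<open>Let \<^term>\<open>w\<close> be the commutator and \<^term>\<open>a\<close> in \<^term>\<open>V\<close>. By Jacobi's identity, bracketing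
  \<^term>\<open>br w a\<close> with an element of \<^term>\<open>U\<close> gives \<^term>\<open>t *\<^sub>R w\<close>, where \<^term>\<open>- t\<close> is an eigenvalue
  of an adjoint operator and so 0. Hence \<^term>\<open>br w a\<close> is in the centre of \<^term>\<open>U\<close>, which
  \<^term>\<open>w\<close> spans, and it vanishes by the same argument.\<close>

lemma heisenberg_commutator_central:
  assumes xy: "x \<in> U" "y \<in> U" "br x y \<noteq> 0"
  shows "br (br x y) z = 0"
proof -
  define w where "w = br x y"
  have wU: "w \<in> U" using xy br_U by (simp add: w_def)
  have w0: "br w u = 0" "br u w = 0" if "u \<in> U" for u
    using heisenberg_central[OF xy] that br_zero_flip unfolding w_def by blast+
  have a0: "br w a = 0" if "a \<in> V" for a
  proof -
    have waU: "br w a \<in> U"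
      using heisenberg_commutator_action[OF xy that] by (simp add: w_def)
    have commute: "br u (br w a) = 0" if u: "u \<in> U" for u
    proof -
      obtain u1 v1 where uv: "u1 \<in> U" "v1 \<in> V" "br u a = u1 + v1" using decompose by blast
      obtain t where t: "br u (br w a) = t *\<^sub>R w"
        using heisenberg_commutators[OF xy u waU] by (auto simp: w_def)
      have "br u (br w a) = br w v1"
        using jacobi[of u w a] w0 u uv by (simp add: br_simps)
      then have "br v1 w = - t *\<^sub>R w" using t br_flip[of v1 w] by simp
      then have "t = 0" using eigenvector_zero[of w v1 "- t"] xy by (simp add: w_def)
      then show ?thesis using t by simp
    qed
    obtain r s t where wa: "br w a = r *\<^sub>R x + s *\<^sub>R y + t *\<^sub>R w"
      using heisenberg_span[OF xy waU] by (auto simp: w_def)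
    have "s *\<^sub>R w = 0" "- r *\<^sub>R w = 0"
      using commute[OF xy(1)] commute[OF xy(2)] w0 xy br_flip[of y x]
      unfolding wa by (simp_all add: br_simps w_def)
    then have "br a w = - t *\<^sub>R w" using wa xy(3) br_flip[of a w] by (simp add: w_def)
    then have "t = 0" using eigenvector_zero[of w a "- t"] xy by (simp add: w_def)
    then show ?thesis using wa \<open>s *\<^sub>R w = 0\<close> \<open>- r *\<^sub>R w = 0\<close> xy(3) by (simp add: w_def)
  qed
  obtain u a where "u \<in> U" "a \<in> V" "z = u + a" using decompose by blast
  then show ?thesis using w0 a0 by (simp add: br_simps flip: w_def)
qed

lemma common_orthogonal:
  assumes "a \<in> U" "b \<in> U"
  shows "\<exists>d\<in>V. d \<noteq> 0 \<and> \<omega> a d = 0 \<and> \<omega> b d = 0"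
proof -
  note V = subspace_diff[OF subspace_V] subspace_scale[OF subspace_V]
  have kernel: "\<exists>v\<in>V. v \<noteq> 0 \<and> \<omega> a v = 0 \<and> v \<notin> span {w}" if "w \<in> V" "\<omega> a w = 0" for w
  proof (cases "a = 0")
    case True
    obtain v where "v \<in> V" "v \<notin> span {w, w}" using three_dim_not_spanned_by_two[OF dim_V] by blast
    moreover from this have "v \<noteq> 0" using span_0[of "{w, w}"] by metis
    ultimately show ?thesis using True by (intro bexI[of _ v]) (auto simp: omega_simps)
  next
    case False
    obtain v1 where v1: "v1 \<in> V" "\<omega> a v1 = 1" using dual_partner[OF assms(1) False] by blast
    obtain v2 where v2: "v2 \<in> V" "v2 \<notin> span {v1, w}"
      using three_dim_not_spanned_by_two[OF dim_V] by blast
    define v where "v = v2 - \<omega> a v2 *\<^sub>R v1"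
    have "v \<notin> span {w}"
    proof
      assume "v \<in> span {w}"
      then have "v \<in> span {v1, w}" by (meson span_mono subset_insertI subsetD)
      then have "v + \<omega> a v2 *\<^sub>R v1 \<in> span {v1, w}" by (rule span_add) (simp add: span_base span_scale)
      then show False using v2 by (simp add: v_def)
    qed
    moreover from this have "v \<noteq> 0" using span_0[of "{w}"] by metis
    moreover have "v \<in> V" unfolding v_def using v1 v2 by (intro V)
    moreover have "\<omega> a v = 0" using v1 by (simp add: v_def omega_simps)
    ultimately show ?thesis by blast
  qed
  obtain w where w: "w \<in> V" "w \<noteq> 0" "\<omega> a w = 0"
    using kernel[of 0] subspace_0[OF subspace_V] by (auto simp: omega_simps)
  obtain v where v: "v \<in> V" "\<omega> a v = 0" "v \<notin> span {w}" using kernel w by blast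
  define d where "d = \<omega> b v *\<^sub>R w - \<omega> b w *\<^sub>R v"
  show ?thesis
  proof (cases "\<omega> b w = 0")
    case True
    then show ?thesis using w by blast
  next
    case False
    have "d \<noteq> 0"
    proof
      assume "d = 0"
      then have e: "\<omega> b w *\<^sub>R v = \<omega> b v *\<^sub>R w" by (simp add: d_def)
      have "v = inverse (\<omega> b w) *\<^sub>R (\<omega> b v *\<^sub>R w)" using False by (simp flip: e)
      also have "\<dots> \<in> span {w}" by (intro span_scale span_base) simp
      finally show False using v(3) by blast
    qed
    moreover have "d \<in> V" unfolding d_def using w v by (intro V)
    moreover have "\<omega> a d = 0" "\<omega> b d = 0" using w v by (simp_all add: d_def omega_simps)
    ultimately show ?thesis by blast
  qed
qed

text \<open>The hyperplane orthogonal to \<^term>\<open>d\<close> is the sum of \<^term>\<open>V\<close> and the span of \<^term>\<open>p\<close> and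
  \<^term>\<open>c\<close>, so its invariance under \<^term>\<open>b\<close> has to be tested on \<^term>\<open>p\<close> only.\<close>

lemma hyperplane_stable:
  assumes abelian_V: "\<And>a b. a \<in> V \<Longrightarrow> b \<in> V \<Longrightarrow> br a b = 0"
    and c: "\<And>z. br c z = 0"
    and U: "\<And>u. u \<in> U \<Longrightarrow> \<omega> u d = 0 \<Longrightarrow> \<exists>s t. u = s *\<^sub>R p + t *\<^sub>R c"
    and "d \<in> V" "b \<in> V" "\<omega> (br b p) d = 0"
  shows "\<omega> (br b z) d = 0"
proof (rule invariant_hyperplane[where \<xi> = "\<lambda>z. \<omega> z d"])
  show "linear (\<lambda>z. \<omega> z d)" by (rule linear_omega)
  fix z assume z: "\<omega> z d = 0"
  obtain u v where uv: "u \<in> U" "v \<in> V" "z = u + v" using decompose by blast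
  then have "\<omega> u d = 0" using z iso_V \<open>d \<in> V\<close> by (simp add: omega_simps)
  then obtain s t where "u = s *\<^sub>R p + t *\<^sub>R c" using U uv by blast
  then show "\<omega> (br b z) d = 0"
    using uv abelian_V \<open>b \<in> V\<close> \<open>\<omega> (br b p) d = 0\<close> br_zero_flip[OF c]
    by (simp add: br_simps omega_simps)
qed

text \<open>If \<^term>\<open>U\<close> brackets the hyperplane \<^term>\<open>{v \<in> V. \<omega> c v = 0}\<close> into \<^term>\<open>U\<close>, take \<^term>\<open>d\<close> in it
  orthogonal to a vector \<^term>\<open>p\<close> that \<^term>\<open>V\<close> moves, modulo \<^term>\<open>V\<close>, only along \<^term>\<open>c\<close>. By
  closedness, \<^term>\<open>\<omega> (br u d) b\<close> equals the pairing of \<^term>\<open>br u b\<close> with \<^term>\<open>d\<close>, which vanishes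
  by nilpotency.\<close>

lemma central_partner_trivial_action:
  assumes c: "c \<in> U" "c \<noteq> 0" "\<And>z. br c z = 0"
    and abelian_V: "\<And>a b. a \<in> V \<Longrightarrow> b \<in> V \<Longrightarrow> br a b = 0"
    and trivial: "\<And>u v. u \<in> U \<Longrightarrow> v \<in> V \<Longrightarrow> \<omega> c v = 0 \<Longrightarrow> br u v \<in> U"
  shows "\<exists>d\<in>V. d \<noteq> 0 \<and> \<omega> c d = 0 \<and> (\<forall>z. br d z = 0)"
proof -
  note V = subspace_add[OF subspace_V] subspace_diff[OF subspace_V] subspace_scale[OF subspace_V]
    subspace_0[OF subspace_V]
  define I where "I = span (insert c V)"
  have I: "subspace I" "V \<subseteq> I"
    by (auto simp: I_def intro: span_base)
  have inI: "z \<in> I \<longleftrightarrow> (\<exists>s. z - s *\<^sub>R c \<in> V)" for z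
    by (simp add: I_def span_insert_subspace subspace_V)
  obtain u0 where u0: "u0 \<in> U" "u0 \<notin> span {c, c}"
    using three_dim_not_spanned_by_two[OF dim_U] by blast
  have notI: "u \<notin> I" if u: "u \<in> U" "u \<notin> span {c}" for u
  proof
    assume "u \<in> I"
    then obtain t where "u - t *\<^sub>R c \<in> V" unfolding inI by blast
    moreover have "u - t *\<^sub>R c \<in> U" using u c subspace_U by (intro subspace_diff subspace_scale)
    ultimately have "u = t *\<^sub>R c" using disjoint by (metis eq_iff_diff_eq_0)
    then show False using u by (simp add: span_base span_scale)
  qed
  then obtain p where p: "p \<in> U" "p \<notin> I" "\<And>a. a \<in> V \<Longrightarrow> br a p \<in> I"
    using lagrangian_pair.flag_step[OF swap I u0(1) notI] u0 by auto
  obtain d where d: "d \<in> V" "d \<noteq> 0" "\<omega> c d = 0" "\<omega> p d = 0"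
    using common_orthogonal[OF c(1) p(1)] by blast
  obtain x where x: "x \<in> U" "\<omega> x d = 1"
  proof -
    obtain x0 where "x0 \<in> U" "\<omega> d x0 = 1"
      using lagrangian_pair.dual_partner[OF swap d(1,2)] by blast
    then show thesis
      using that[of "- x0"] omega_flip[of x0 d] subspace_U by (simp add: omega_simps subspace_neg)
  qed
  have ind: "r = 0 \<and> s = 0 \<and> t = 0" if 0: "r *\<^sub>R x + s *\<^sub>R p + t *\<^sub>R c = 0" for r s t
  proof -
    have "\<omega> (r *\<^sub>R x + s *\<^sub>R p + t *\<^sub>R c) d = 0" unfolding 0 by (simp add: omega_simps)
    then have "r = 0" using x d by (simp add: omega_simps)
    moreover have "s = 0"
    proof (rule ccontr)
      assume "s \<noteq> 0"
      then have "p - (- t / s) *\<^sub>R c = inverse s *\<^sub>R (r *\<^sub>R x + s *\<^sub>R p + t *\<^sub>R c)"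
        using \<open>r = 0\<close> by (simp add: scaleR_add_right divide_inverse mult.commute)
      also have "\<dots> \<in> V" unfolding 0 using V(4) by simp
      finally show False using p(2) inI by blast
    qed
    ultimately show ?thesis using 0 c by simp
  qed
  have hyperplane: "\<exists>s t. u = s *\<^sub>R p + t *\<^sub>R c" if ud: "u \<in> U" "\<omega> u d = 0" for u
  proof -
    obtain r s t where u: "u = r *\<^sub>R x + s *\<^sub>R p + t *\<^sub>R c"
      using three_independent_span[OF subspace_U dim_U x(1) p(1) c(1) ind ud(1)] by blast
    then have "r = 0" using ud(2) x d by (simp add: omega_simps)
    then show ?thesis using u by auto
  qed
  have bp: "\<omega> (br b p) d = 0" if b: "b \<in> V" for b
  proof -
    obtain t where "br b p - t *\<^sub>R c \<in> V" using p(3) b unfolding inI by blast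
    then have "\<omega> (br b p - t *\<^sub>R c) d = 0" using d(1) by (rule iso_V)
    then show ?thesis using d by (simp add: omega_simps)
  qed
  have ud: "br u d = 0" if "u \<in> U" for u
  proof (rule nondegenerate_U)
    show "br u d \<in> U" using trivial that d by blast
    fix b assume "b \<in> V"
    then have "\<omega> (br b u) d = 0"
      using hyperplane_stable[OF abelian_V c(3) hyperplane d(1)] bp by blast
    then show "\<omega> (br u d) b = 0"
      using closed[of u d b] abelian_V[OF d(1) \<open>b \<in> V\<close>] br_flip[of u b] by (simp add: omega_simps)
  qed
  have "br d z = 0" for z
  proof -
    obtain u v where "u \<in> U" "v \<in> V" "z = u + v" using decompose by blast
    then show ?thesis using br_zero_flip[OF ud] abelian_V d(1) by (simp add: br_simps)
  qed
  then show ?thesis using d by blast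
qed

text \<open>In the other case, Engel's theorem provides a \<^term>\<open>d\<close> in \<^term>\<open>V\<close> whose brackets with \<^term>\<open>U\<close> lie in \<^term>\<open>U\<close>.
  Jacobi's identity for \<^term>\<open>x\<close>, \<^term>\<open>p\<close>, \<^term>\<open>q\<close> and the symmetry of the forms
  \<^term>\<open>\<lambda>a b. \<omega> (br a u) b\<close> on the abelian algebra \<^term>\<open>V\<close> show that it is central.\<close>

lemma central_partner_nontrivial_action:
  assumes c: "c \<in> U" "c \<noteq> 0" "\<And>z. br c z = 0"
    and abelian_V: "\<And>a b. a \<in> V \<Longrightarrow> b \<in> V \<Longrightarrow> br a b = 0"
    and comm_U: "\<And>u v. u \<in> U \<Longrightarrow> v \<in> U \<Longrightarrow> \<exists>t. br u v = t *\<^sub>R c"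
    and u0: "u0 \<in> U" "v0 \<in> V" "\<omega> c v0 = 0" "br u0 v0 \<notin> U"
  shows "\<exists>d\<in>V. d \<noteq> 0 \<and> \<omega> c d = 0 \<and> (\<forall>z. br d z = 0)"
proof -
  have c': "br z c = 0" for z using br_zero_flip[OF c(3)] .
  have \<omega>c: "\<omega> c (br u v) = 0" for u v
    using omega_br_central[OF c(3)] omega_zero_flip by blast
  have "v0 \<notin> U" using u0 br_U by blast
  then have "\<exists>m\<in>{z. \<omega> c z = 0}. m \<notin> U \<and> (\<forall>u\<in>U. br u m \<in> U)"
    by (intro engel[where ?m0.0 = v0]) (use u0 \<omega>c subspace_0[OF subspace_U] in auto)
  then obtain m where m: "\<omega> c m = 0" "m \<notin> U" "\<And>u. u \<in> U \<Longrightarrow> br u m \<in> U" by blast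
  obtain u1 d where d: "u1 \<in> U" "d \<in> V" "m = u1 + d" using decompose by blast
  have "d \<noteq> 0" using d m by auto
  have "\<omega> c d = 0" using m(1) d iso_U[OF c(1) d(1)] by (simp add: omega_simps)
  have Ud: "br u d \<in> U" if "u \<in> U" for u
  proof -
    have "br u d = br u m - br u u1" using d by (simp add: br_simps)
    then show ?thesis using m(3)[OF that] br_U[OF that d(1)] subspace_diff[OF subspace_U] by metis
  qed
  obtain x p q y where b: "dual_basis x p c d q y"
    using dual_basis_exists[OF c(1,2) d(2) \<open>d \<noteq> 0\<close> \<open>\<omega> c d = 0\<close>] by blast
  note bas = b[unfolded dual_basis_def]
  have U: "x \<in> U" "p \<in> U" and V: "d \<in> V" "q \<in> V" "y \<in> V" using bas by auto
  have V_part: "z \<in> U" if "\<omega> x z = 0" "\<omega> p z = 0" "\<omega> c z = 0" for z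
  proof -
    have "z = \<omega> z d *\<^sub>R x + \<omega> z q *\<^sub>R p + \<omega> z y *\<^sub>R c"
      using dual_basis_expand[OF b, of z] that by simp
    also have "\<dots> \<in> U" using U c subspace_U by (intro subspace_add subspace_scale)
    finally show ?thesis .
  qed
  have \<omega>pq: "\<omega> p (br u q) = 0" if u: "u \<in> U" for u
  proof (rule eigenvalue_zero[of "span (insert d U)"])
    show "subspace (span (insert d U))" by simp
    have mem: "z \<in> span (insert d U) \<longleftrightarrow> (\<exists>s. z - s *\<^sub>R d \<in> U)" for z
      by (simp add: span_insert_subspace subspace_U)
    show "br u i \<in> span (insert d U)" if i: "i \<in> span (insert d U)" for i
    proof -
      obtain s where s: "i - s *\<^sub>R d \<in> U" using i mem by blast
      have "br u i - 0 *\<^sub>R d = br u (i - s *\<^sub>R d) + s *\<^sub>R br u d" by (simp add: br_simps)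
      also have "\<dots> \<in> U" using br_U[OF u s] Ud[OF u] subspace_U by (intro subspace_add subspace_scale)
      finally show ?thesis using mem by blast
    qed
    show "q \<notin> span (insert d U)"
    proof
      assume "q \<in> span (insert d U)"
      then obtain s where "q - s *\<^sub>R d \<in> U" using mem by blast
      then have "\<omega> p (q - s *\<^sub>R d) = 0" using U iso_U by blast
      then show False using bas by (simp add: omega_simps)
    qed
    have "br u q - \<omega> p (br u q) *\<^sub>R q - \<omega> x (br u q) *\<^sub>R d \<in> U"
      by (rule V_part) (use bas \<omega>c in \<open>simp_all add: omega_simps\<close>)
    then show "br u q - \<omega> p (br u q) *\<^sub>R q \<in> span (insert d U)" using mem by blast
  qed
  have "br p q \<in> U"
  proof (rule V_part)
    obtain t where t: "br x p = t *\<^sub>R c" using comm_U U by blast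
    have "\<omega> (br x p) q = 0" using t bas by (simp add: omega_simps)
    moreover have "\<omega> (br x q) p = 0" using \<omega>pq[OF U(1)] by (rule omega_zero_flip)
    ultimately have "\<omega> (br p q) x = 0" using closed[of x p q] by simp
    then show "\<omega> x (br p q) = 0" by (rule omega_zero_flip)
  qed (use \<omega>pq U \<omega>c in auto)
  define A where "A = \<omega> x (br x q)"
  define r where "r = br x q - A *\<^sub>R d"
  have rU: "r \<in> U"
    unfolding r_def by (rule V_part) (use bas \<omega>pq[OF U(1)] \<omega>c in \<open>simp_all add: omega_simps A_def\<close>)
  have "A \<noteq> 0"
  proof
    assume "A = 0"
    then have "br x q \<in> U" using rU by (simp add: r_def)
    have u0q: "br u0 q = \<omega> u0 d *\<^sub>R br x q + \<omega> u0 q *\<^sub>R br p q"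
      by (subst (1) dual_basis_U[OF b u0(1)]) (simp add: br_simps c)
    have "br u0 q \<in> U"
      unfolding u0q using \<open>br x q \<in> U\<close> \<open>br p q \<in> U\<close> subspace_U by (intro subspace_add subspace_scale)
    have u0v0: "br u0 v0 = \<omega> x v0 *\<^sub>R br u0 d + \<omega> p v0 *\<^sub>R br u0 q"
      by (subst (1) dual_basis_V[OF b u0(2)]) (simp add: br_simps u0)
    have "br u0 v0 \<in> U"
      unfolding u0v0 using \<open>br u0 q \<in> U\<close> Ud[OF u0(1)] subspace_U by (intro subspace_add subspace_scale)
    then show False using u0 by blast
  qed
  have sym: "\<omega> (br v u) w = \<omega> (br w u) v" if "v \<in> V" "w \<in> V" for u v w
    using closed[of v u w] abelian_V[OF that] br_flip[of u w] by (simp add: omega_simps)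
  have stable: "\<omega> (br v z) d = 0" if "v \<in> V" "\<omega> (br v p) d = 0" for v z
  proof (rule hyperplane_stable[OF abelian_V c(3) _ d(2) that])
    fix u assume "u \<in> U" "\<omega> u d = 0"
    then have "u = \<omega> u q *\<^sub>R p + \<omega> u y *\<^sub>R c" using dual_basis_U[OF b, of u] by simp
    then show "\<exists>s t. u = s *\<^sub>R p + t *\<^sub>R c" by blast
  qed
  have jac: "br x (br p q) = A *\<^sub>R br p d + br p r"
  proof -
    obtain t where t: "br x p = t *\<^sub>R c" using comm_U U by blast
    have "br x (br p q) = br (br x p) q + br p (br x q)" by (rule jacobi)
    also have "br (br x p) q = 0" using t c by (simp add: br_simps)
    also have "br x q = A *\<^sub>R d + r" by (simp add: r_def)
    finally show ?thesis by (simp add: br_simps)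
  qed
  obtain \<tau> where \<tau>: "br p d = \<tau> *\<^sub>R c"
  proof -
    obtain s t where "br x (br p q) = s *\<^sub>R c" "br p r = t *\<^sub>R c"
      using comm_U U rU \<open>br p q \<in> U\<close> by metis
    then have "A *\<^sub>R br p d = (s - t) *\<^sub>R c" using jac by (simp add: algebra_simps)
    then have "inverse A *\<^sub>R (A *\<^sub>R br p d) = inverse A *\<^sub>R ((s - t) *\<^sub>R c)" by (rule arg_cong)
    then have "br p d = (inverse A * (s - t)) *\<^sub>R c" using \<open>A \<noteq> 0\<close> by simp
    then show thesis by (rule that)
  qed
  have dp: "br d p = - \<tau> *\<^sub>R c" using \<tau> br_flip[of d p] by simp
  have qp_d: "\<omega> (br q p) d = 0"
    using sym[OF V(2,1), of p] dp bas by (simp add: omega_simps)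
  have dx_d: "\<omega> (br d x) d = 0"
    by (rule stable[OF d(2)]) (use dp bas in \<open>simp add: omega_simps\<close>)
  have qx_d: "\<omega> (br q x) d = 0"
    by (rule stable[OF V(2) qp_d])
  have qpU: "br q p \<in> U"
    using \<open>br p q \<in> U\<close> br_flip[of q p] subspace_neg[OF subspace_U] by simp
  have qp_q: "\<omega> (br q p) q = 0"
  proof (rule eigenvalue_zero[of "span (insert c V)"])
    show "subspace (span (insert c V))" by simp
    have mem: "z \<in> span (insert c V) \<longleftrightarrow> (\<exists>s. z - s *\<^sub>R c \<in> V)" for z
      by (simp add: span_insert_subspace subspace_V)
    show "br q i \<in> span (insert c V)" if i: "i \<in> span (insert c V)" for i
    proof -
      obtain s where s: "i - s *\<^sub>R c \<in> V" using i mem by blast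
      have "br q i - 0 *\<^sub>R c = br q (i - s *\<^sub>R c)" by (simp add: br_simps c')
      then show ?thesis using br_V[OF V(2) s] mem by metis
    qed
    show "p \<notin> span (insert c V)"
    proof
      assume "p \<in> span (insert c V)"
      then obtain s where "p - s *\<^sub>R c \<in> V" using mem by blast
      then have "\<omega> (p - s *\<^sub>R c) q = 0" using V iso_V by blast
      then show False using bas by (simp add: omega_simps)
    qed
    have "br q p - \<omega> (br q p) q *\<^sub>R p = \<omega> (br q p) y *\<^sub>R c"
      using dual_basis_U[OF b qpU] qp_d by (simp add: algebra_simps)
    then show "br q p - \<omega> (br q p) q *\<^sub>R p \<in> span (insert c V)"
      by (simp add: span_base span_scale)
  qed
  have "br p q = - \<omega> (br q p) y *\<^sub>R c"
    using dual_basis_U[OF b qpU] qp_d qp_q br_flip[of p q] by simp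
  then have "br x (br p q) = 0" by (simp add: br_simps c')
  moreover have "br p r = 0"
  proof -
    have "\<omega> r d = 0"
      using qx_d br_flip[of x q] bas by (simp add: r_def omega_simps)
    then have "r = \<omega> r q *\<^sub>R p + \<omega> r y *\<^sub>R c" using dual_basis_U[OF b rU] by simp
    then have "br p r = br p (\<omega> r q *\<^sub>R p + \<omega> r y *\<^sub>R c)" by (rule arg_cong)
    then show ?thesis by (simp add: br_simps c')
  qed
  ultimately have pd: "br p d = 0" using jac \<open>A \<noteq> 0\<close> by simp
  have yp_d: "\<omega> (br y p) d = 0"
    using sym[OF V(3,1), of p] br_zero_flip[OF pd] by (simp add: omega_simps)
  have yx_d: "\<omega> (br y x) d = 0"
    by (rule stable[OF V(3) yp_d])
  have "br x d = 0"
  proof (rule nondegenerate_U)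
    show "br x d \<in> U" by (rule Ud[OF U(1)])
    fix v assume "v \<in> V"
    have "\<omega> (br d x) q = 0" "\<omega> (br d x) y = 0"
      using sym[OF V(1,2), of x] sym[OF V(1,3), of x] qx_d yx_d by simp_all
    then have "\<omega> (br d x) (\<omega> x v *\<^sub>R d + \<omega> p v *\<^sub>R q + \<omega> c v *\<^sub>R y) = 0"
      using dx_d by (simp add: omega_simps)
    then have "\<omega> (br d x) v = 0" using dual_basis_V[OF b \<open>v \<in> V\<close>] by simp
    then show "\<omega> (br x d) v = 0" using br_flip[of x d] by (simp add: omega_simps)
  qed
  have "br d z = 0" for z
  proof -
    obtain u v where uv: "u \<in> U" "v \<in> V" "z = u + v" using decompose by blast
    have "br u d = \<omega> u d *\<^sub>R br x d + \<omega> u q *\<^sub>R br p d"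
      by (subst (1) dual_basis_U[OF b uv(1)]) (simp add: br_simps c)
    then have "br u d = 0" using \<open>br x d = 0\<close> pd by simp
    then have "br d u = 0" by (rule br_zero_flip)
    then show ?thesis using uv abelian_V[OF d(2) uv(2)] by (simp add: br_simps)
  qed
  then show ?thesis using d(2) \<open>d \<noteq> 0\<close> \<open>\<omega> c d = 0\<close> by blast
qed

lemma central_partner:
  assumes c: "c \<in> U" "c \<noteq> 0" "\<And>z. br c z = 0"
    and abelian_V: "\<And>a b. a \<in> V \<Longrightarrow> b \<in> V \<Longrightarrow> br a b = 0"
    and comm_U: "\<And>u v. u \<in> U \<Longrightarrow> v \<in> U \<Longrightarrow> \<exists>t. br u v = t *\<^sub>R c"
  shows "\<exists>d\<in>V. d \<noteq> 0 \<and> \<omega> c d = 0 \<and> (\<forall>z. br d z = 0)"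
proof (cases "\<forall>u\<in>U. \<forall>v\<in>V. \<omega> c v = 0 \<longrightarrow> br u v \<in> U")
  case True
  then show ?thesis by (intro central_partner_trivial_action[OF c abelian_V]) auto
next
  case False
  then obtain u v where "u \<in> U" "v \<in> V" "\<omega> c v = 0" "br u v \<notin> U" by blast
  then show ?thesis
    using abelian_V comm_U by (intro central_partner_nontrivial_action[OF c]) auto
qed

definition central_pair :: "'a \<Rightarrow> 'a \<Rightarrow> bool" where
  "central_pair c d \<longleftrightarrow> c \<in> U \<and> d \<in> V \<and> c \<noteq> 0 \<and> d \<noteq> 0 \<and> \<omega> c d = 0 \<and> (\<forall>z. br c z = 0) \<and> (\<forall>z. br d z = 0)"

lemma central_pair_abelian_V:
  assumes abelian_V: "\<And>a b. a \<in> V \<Longrightarrow> b \<in> V \<Longrightarrow> br a b = 0"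
    and "x \<in> U" "y \<in> U" "br x y \<noteq> 0"
  shows "\<exists>c d. central_pair c d"
proof -
  have "\<exists>d\<in>V. d \<noteq> 0 \<and> \<omega> (br x y) d = 0 \<and> (\<forall>z. br d z = 0)"
    using assms(2-4) br_U heisenberg_commutator_central[OF assms(2-4)] heisenberg_commutators[OF assms(2-4)]
    by (intro central_partner) (auto simp: abelian_V)
  then show ?thesis
    using assms(2-4) br_U[OF assms(2,3)] heisenberg_commutator_central[OF assms(2-4)]
    unfolding central_pair_def by blast
qed

lemma central_pair_abelian:
  assumes abelian_U: "\<And>a b. a \<in> U \<Longrightarrow> b \<in> U \<Longrightarrow> br a b = 0"
    and abelian_V: "\<And>a b. a \<in> V \<Longrightarrow> b \<in> V \<Longrightarrow> br a b = 0"
    and c: "c \<in> U" "c \<noteq> 0" "\<And>z. br c z = 0"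
  shows "\<exists>c d. central_pair c d"
proof -
  have "\<exists>t. br u v = t *\<^sub>R c" if "u \<in> U" "v \<in> U" for u v
    using abelian_U[OF that] by (intro exI[of _ 0]) simp
  then have "\<exists>d\<in>V. d \<noteq> 0 \<and> \<omega> c d = 0 \<and> (\<forall>z. br d z = 0)"
    using abelian_V by (intro central_partner[OF c]) auto
  then show ?thesis using c unfolding central_pair_def by blast
qed

lemma central_pair_swap:
  assumes "\<exists>c d. lagrangian_pair.central_pair br \<omega> V U c d"
  shows "\<exists>c d. central_pair c d"
  using assms omega_zero_flip unfolding lagrangian_pair.central_pair_def[OF swap] central_pair_def by blast

text \<open>If one of the two subalgebras is not abelian, its commutators are central in the whole
  algebra. If both are abelian, the two components of a central vector are central.\<close>

theorem central_pair_exists: "\<exists>c d. central_pair c d"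
proof (cases "\<forall>a\<in>U. \<forall>b\<in>U. br a b = 0"; cases "\<forall>a\<in>V. \<forall>b\<in>V. br a b = 0")
  assume ab: "\<forall>a\<in>U. \<forall>b\<in>U. br a b = 0" "\<forall>a\<in>V. \<forall>b\<in>V. br a b = 0"
  obtain u0 where "u0 \<in> U" "u0 \<notin> span {0, 0}"
    using three_dim_not_spanned_by_two[OF dim_U] by blast
  then have "u0 \<noteq> 0" using span_0[of "{0, 0}"] by metis
  then have "\<exists>m\<in>UNIV. m \<notin> {0} \<and> (\<forall>a\<in>UNIV. br a m \<in> {0})"
    by (intro engel[where ?m0.0 = u0]) auto
  then obtain z where z: "z \<noteq> 0" "\<And>a. br a z = 0" by blast
  obtain u v where uv: "u \<in> U" "v \<in> V" "z = u + v" using decompose by blast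
  have u: "br u a = 0" and v: "br v a = 0" for a
  proof -
    obtain u' v' where uv': "u' \<in> U" "v' \<in> V" "a = u' + v'" using decompose by blast
    have 0: "br u u' = 0" "br v v' = 0" using ab uv uv' by blast+
    have "br z u' = 0" "br z v' = 0" using br_zero_flip z by blast+
    then have "br v u' = 0" "br u v' = 0" using 0 uv by (simp_all add: br_simps)
    then show "br u a = 0" "br v a = 0" using 0 uv' by (simp_all add: br_simps)
  qed
  show ?thesis
  proof (cases "u = 0")
    case False
    then show ?thesis using central_pair_abelian[of u] ab uv u by blast
  next
    case True
    then have "v \<noteq> 0" using z uv by simp
    then show ?thesis
      using lagrangian_pair.central_pair_abelian[OF swap, of v] ab uv v
      by (intro central_pair_swap) blast
  qed
next
  assume "\<forall>a\<in>U. \<forall>b\<in>U. br a b = 0" "\<not> (\<forall>a\<in>V. \<forall>b\<in>V. br a b = 0)"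
  then show ?thesis
    using lagrangian_pair.central_pair_abelian_V[OF swap] by (intro central_pair_swap) blast
next
  assume "\<not> (\<forall>a\<in>U. \<forall>b\<in>U. br a b = 0)" "\<forall>a\<in>V. \<forall>b\<in>V. br a b = 0"
  then show ?thesis using central_pair_abelian_V by blast
next
  assume "\<not> (\<forall>a\<in>U. \<forall>b\<in>U. br a b = 0)" "\<not> (\<forall>a\<in>V. \<forall>b\<in>V. br a b = 0)"
  then obtain x y x' y' where xy: "x \<in> U" "y \<in> U" "br x y \<noteq> 0" "x' \<in> V" "y' \<in> V" "br x' y' \<noteq> 0"
    by blast
  note central = heisenberg_commutator_central[OF xy(1-3)]
    lagrangian_pair.heisenberg_commutator_central[OF swap xy(4-6)]
  show ?thesis
    unfolding central_pair_def
    using xy br_U br_V central omega_br_central[of "br x' y'" x y] by blast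
qed

end

section \<open>The structure equations\<close>

text \<open>Bracket relations with ten parameters, subject to the vanishing of five products that Jacobi's
  identity enforces. They hold in every dual basis that contains a central pair.\<close>

definition (in nilpotent_lie_algebra) normal_form ::
  "'a \<Rightarrow> 'a \<Rightarrow> 'a \<Rightarrow> 'a \<Rightarrow> 'a \<Rightarrow> 'a \<Rightarrow> real \<Rightarrow> real \<Rightarrow> real \<Rightarrow> real \<Rightarrow> real \<Rightarrow> real \<Rightarrow> real \<Rightarrow> real \<Rightarrow> real \<Rightarrow> real \<Rightarrow> bool"
where
  "normal_form x p c d q y k l m n e f g e' f' g' \<longleftrightarrow>
     (\<forall>z. br c z = 0) \<and> (\<forall>z. br d z = 0) \<and> br p q = 0 \<and>
     br x y = k *\<^sub>R p + l *\<^sub>R q + m *\<^sub>R c + n *\<^sub>R d \<and>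
     br x p = - (l + f') *\<^sub>R c \<and>
     br x q = e *\<^sub>R p + f *\<^sub>R c + g *\<^sub>R d \<and>
     br y p = e' *\<^sub>R q + f' *\<^sub>R d + g' *\<^sub>R c \<and>
     br y q = (k - f) *\<^sub>R d \<and>
     e' * e = 0 \<and> e' * f = 0 \<and> e' * g = 0 \<and> e * f' = 0 \<and> e * g' = 0"

context nilpotent_lie_algebra
begin

text \<open>The two subalgebras play symmetric roles; this halves the case distinctions below.\<close>

lemma normal_form_swap:
  assumes "normal_form x p c d q y k l m n e f g e' f' g'"
  shows "normal_form y q d c p x (- l) (- k) (- n) (- m) e' f' g' e f g"
proof -
  note nf = assms[unfolded normal_form_def]
  have "br x y = k *\<^sub>R p + l *\<^sub>R q + m *\<^sub>R c + n *\<^sub>R d" using nf by blast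
  then have 1: "br y x = (- l) *\<^sub>R q + (- k) *\<^sub>R p + (- n) *\<^sub>R d + (- m) *\<^sub>R c"
    using br_flip[of y x] by simp
  have yq: "br y q = (k - f) *\<^sub>R d" using nf by blast
  have "k - f = - (- k + f)" by simp
  then have 2: "br y q = - (- k + f) *\<^sub>R d" by (subst yq) (rule arg_cong)
  have xp: "br x p = - (l + f') *\<^sub>R c" using nf by blast
  have "- (l + f') = - l - f'" by simp
  then have 3: "br x p = (- l - f') *\<^sub>R c" by (subst xp) (rule arg_cong)
  have 4: "e * e' = 0" "e * f' = 0" "e * g' = 0" "e' * f = 0" "e' * g = 0"
    using nf by (auto simp: mult.commute)
  show ?thesis
    unfolding normal_form_def using nf br_zero_flip[of p q] 1 2 3 4 by blast
qed

text \<open>Nilpotency enters the structure constants in this form: the coefficient of \<^term>\<open>m\<close> in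
  \<^term>\<open>br a m\<close>, modulo a subspace stable under \<^term>\<open>a\<close>, is an eigenvalue.\<close>

lemma coefficient_zero:
  assumes \<xi>: "linear \<xi>" "\<And>s. s \<in> S \<Longrightarrow> \<xi> s = (0::real)"
    and S: "\<And>s. s \<in> S \<Longrightarrow> br a s \<in> span S"
    and m: "\<xi> m \<noteq> 0" "br a m - r *\<^sub>R m \<in> span S"
  shows "r = 0"
proof (rule eigenvalue_zero[of "span S"])
  show "br a i \<in> span S" if "i \<in> span S" for i
    using that
  proof (rule span_induct)
    show "subspace {i. br a i \<in> span S}"
      by (auto simp: subspace_def br_simps span_add span_scale span_0)
  qed (simp add: S)
  have "\<xi> i = 0" if "i \<in> span S" for i
    using that
  proof (rule span_induct)
    show "subspace {i. \<xi> i = 0}"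
      using \<xi>(1) by (auto simp: subspace_def linear_add linear_scale linear_0)
  qed (simp add: \<xi>)
  then show "m \<notin> span S" using m by auto
qed (use m in auto)

end

context lagrangian_pair
begin

text \<open>Brackets are orthogonal to the central vectors \<^term>\<open>c\<close> and \<^term>\<open>d\<close>, so only the coefficients of
  \<^term>\<open>p\<close>, \<^term>\<open>q\<close>, \<^term>\<open>c\<close>, \<^term>\<open>d\<close> occur. Nilpotency removes the diagonal ones, closedness expresses
  the brackets of \<^term>\<open>x\<close>, \<^term>\<open>p\<close> and of \<^term>\<open>y\<close>, \<^term>\<open>q\<close> by the others, and Jacobi's identity gives
  the products.\<close>

lemma normal_form_exists:
  assumes cd: "central_pair c d" and b: "dual_basis x p c d q y"
  shows "\<exists>k l m n e f g e' f' g'. normal_form x p c d q y k l m n e f g e' f' g'"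
proof -
  note bas = b[unfolded dual_basis_def]
  have c: "br c z = 0" "br z c = 0" and d: "br d z = 0" "br z d = 0" for z
    using cd br_zero_flip unfolding central_pair_def by blast+
  have U: "x \<in> U" "p \<in> U" "c \<in> U" and V: "d \<in> V" "q \<in> V" "y \<in> V" using bas by auto
  have E: "br u v = \<omega> (br u v) q *\<^sub>R p + \<omega> (br u v) y *\<^sub>R c + \<omega> x (br u v) *\<^sub>R d + \<omega> p (br u v) *\<^sub>R q" for u v
    using dual_basis_expand[OF b, of "br u v"] omega_br_central[OF d(1), of u v]
      omega_zero_flip[OF omega_br_central[OF c(1), of u v]] by simp
  have flip: "\<omega> d x = -1" "\<omega> q p = -1" "\<omega> y c = -1" "\<omega> d p = 0" "\<omega> d c = 0" "\<omega> q x = 0" "\<omega> q c = 0"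
      "\<omega> y x = 0" "\<omega> y p = 0" "\<omega> x p = 0" "\<omega> x c = 0" "\<omega> p x = 0" "\<omega> p c = 0" "\<omega> c x = 0" "\<omega> c p = 0"
      "\<omega> d q = 0" "\<omega> d y = 0" "\<omega> q d = 0" "\<omega> q y = 0" "\<omega> y d = 0" "\<omega> y q = 0"
    using bas omega_flip[of d x] omega_flip[of q p] omega_flip[of y c] omega_flip[of d p] omega_flip[of d c]
      omega_flip[of q x] omega_flip[of q c] omega_flip[of y x] omega_flip[of y p]
    by (auto simp: iso_U iso_V)
  have xpU: "\<omega> x (br x p) = 0" "\<omega> p (br x p) = 0"
    using br_U[OF U(1,2)] U iso_U by auto
  have yqV: "\<omega> (br y q) q = 0" "\<omega> (br y q) y = 0"
    using br_V[OF V(3,2)] V iso_V by auto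
  have xp: "br x p = \<omega> (br x p) y *\<^sub>R c"
  proof -
    have "\<omega> (br x p) q = 0"
    proof (rule coefficient_zero[of "\<lambda>z. \<omega> z q" "{c}" x p])
      have "br x p - \<omega> (br x p) q *\<^sub>R p = \<omega> (br x p) y *\<^sub>R c"
        using E[of x p] xpU by (simp add: algebra_simps)
      then show "br x p - \<omega> (br x p) q *\<^sub>R p \<in> span {c}" by (simp add: span_base span_scale)
    qed (use bas c flip in \<open>auto simp: linear_omega span_0\<close>)
    then show ?thesis using E[of x p] xpU by simp
  qed
  have yq: "br y q = \<omega> x (br y q) *\<^sub>R d"
  proof -
    have "\<omega> p (br y q) = 0"
    proof (rule coefficient_zero[of "\<omega> p" "{d}" y q])
      have "br y q - \<omega> p (br y q) *\<^sub>R q = \<omega> x (br y q) *\<^sub>R d"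
        using E[of y q] yqV by (simp add: algebra_simps)
      then show "br y q - \<omega> p (br y q) *\<^sub>R q \<in> span {d}" by (simp add: span_base span_scale)
    qed (use bas d flip in \<open>auto simp: linear_omega span_0\<close>)
    then show ?thesis using E[of y q] yqV by simp
  qed
  have xq0: "\<omega> p (br x q) = 0"
  proof (rule coefficient_zero[of "\<omega> p" "{p, c, d}" x q])
    have "br x p \<in> span {p, c, d}" by (subst xp) (simp add: span_base span_scale)
    then show "br x s \<in> span {p, c, d}" if "s \<in> {p, c, d}" for s
      using that c d by (auto simp: span_0)
    have "br x q - \<omega> p (br x q) *\<^sub>R q = \<omega> (br x q) q *\<^sub>R p + \<omega> (br x q) y *\<^sub>R c + \<omega> x (br x q) *\<^sub>R d"
      using E[of x q] by (simp add: algebra_simps)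
    also have "\<dots> \<in> span {p, c, d}" by (intro span_add span_scale span_base) auto
    finally show "br x q - \<omega> p (br x q) *\<^sub>R q \<in> span {p, c, d}" .
  qed (use bas flip in \<open>auto simp: linear_omega\<close>)
  have yp0: "\<omega> (br y p) q = 0"
  proof (rule coefficient_zero[of "\<lambda>z. \<omega> z q" "{q, c, d}" y p])
    have "br y q \<in> span {q, c, d}" by (subst yq) (simp add: span_base span_scale)
    then show "br y s \<in> span {q, c, d}" if "s \<in> {q, c, d}" for s
      using that c d by (auto simp: span_0)
    have "br y p - \<omega> (br y p) q *\<^sub>R p = \<omega> (br y p) y *\<^sub>R c + \<omega> x (br y p) *\<^sub>R d + \<omega> p (br y p) *\<^sub>R q"
      using E[of y p] by (simp add: algebra_simps)
    also have "\<dots> \<in> span {q, c, d}" by (intro span_add span_scale span_base) auto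
    finally show "br y p - \<omega> (br y p) q *\<^sub>R p \<in> span {q, c, d}" .
  qed (use bas flip in \<open>auto simp: linear_omega\<close>)
  have pq: "br p q = 0"
  proof -
    have "\<omega> (br q p) q = 0"
    proof (rule coefficient_zero[of "\<lambda>z. \<omega> z q" "{q, c, d}" q p])
      show "br q s \<in> span {q, c, d}" if "s \<in> {q, c, d}" for s
        using that c d by (auto simp: span_0)
      have "br q p - \<omega> (br q p) q *\<^sub>R p = \<omega> (br q p) y *\<^sub>R c + \<omega> x (br q p) *\<^sub>R d + \<omega> p (br q p) *\<^sub>R q"
        using E[of q p] by (simp add: algebra_simps)
      also have "\<dots> \<in> span {q, c, d}" by (intro span_add span_scale span_base) auto
      finally show "br q p - \<omega> (br q p) q *\<^sub>R p \<in> span {q, c, d}" .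
    qed (use bas flip in \<open>auto simp: linear_omega\<close>)
    then have 1: "\<omega> (br p q) q = 0" using br_flip[of p q] by (simp add: omega_simps)
    have 2: "\<omega> p (br p q) = 0"
    proof (rule coefficient_zero[of "\<omega> p" "{p, c, d}" p q])
      show "br p s \<in> span {p, c, d}" if "s \<in> {p, c, d}" for s
        using that c d by (auto simp: span_0)
      have "br p q - \<omega> p (br p q) *\<^sub>R q = \<omega> (br p q) q *\<^sub>R p + \<omega> (br p q) y *\<^sub>R c + \<omega> x (br p q) *\<^sub>R d"
        using E[of p q] by (simp add: algebra_simps)
      also have "\<dots> \<in> span {p, c, d}" by (intro span_add span_scale span_base) auto
      finally show "br p q - \<omega> p (br p q) *\<^sub>R q \<in> span {p, c, d}" .
    qed (use bas flip in \<open>auto simp: linear_omega\<close>)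
    have "\<omega> (br y q) p = 0" by (subst yq) (simp add: omega_simps flip)
    then have 3: "\<omega> (br p q) y = 0"
      using closed[of p q y] yp0 br_flip[of p y] br_flip[of q y] by (simp add: omega_simps)
    have "\<omega> (br x p) q = 0" by (subst xp) (simp add: omega_simps bas)
    then have "\<omega> (br p q) x = 0"
      using closed[of p q x] omega_zero_flip[OF xq0] br_flip[of p x] br_flip[of q x] by (simp add: omega_simps)
    then have 4: "\<omega> x (br p q) = 0" by (rule omega_zero_flip)
    show ?thesis using E[of p q] 1 2 3 4 by simp
  qed
  define k l m n where "k = \<omega> (br x y) q" and "l = \<omega> p (br x y)"
    and "m = \<omega> (br x y) y" and "n = \<omega> x (br x y)"
  define e f g where "e = \<omega> (br x q) q" and "f = \<omega> (br x q) y" and "g = \<omega> x (br x q)"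
  define e' f' g' where "e' = \<omega> p (br y p)" and "f' = \<omega> x (br y p)" and "g' = \<omega> (br y p) y"
  have XY: "br x y = k *\<^sub>R p + l *\<^sub>R q + m *\<^sub>R c + n *\<^sub>R d"
    using E[of x y] by (simp add: k_def l_def m_def n_def ac_simps)
  have XQ: "br x q = e *\<^sub>R p + f *\<^sub>R c + g *\<^sub>R d"
    using E[of x q] xq0 by (simp add: e_def f_def g_def ac_simps)
  have YP: "br y p = e' *\<^sub>R q + f' *\<^sub>R d + g' *\<^sub>R c"
    using E[of y p] yp0 by (simp add: e'_def f'_def g'_def ac_simps)
  have "\<omega> (br x p) y = - (l + f')"
    using closed[of x y p] omega_flip[of p "br x y"] omega_flip[of x "br y p"]
    by (simp add: l_def f'_def)
  then have XP: "br x p = - (l + f') *\<^sub>R c" using xp by simp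
  have "\<omega> x (br y q) = k - f"
    using closed[of x y q] omega_flip[of x "br y q"] by (simp add: k_def f_def)
  then have YQ: "br y q = (k - f) *\<^sub>R d" using yq by simp
  have z1: "e' *\<^sub>R br x q = 0"
    using jacobi[of x y p] br_zero_flip[OF pq] unfolding XY YP XP by (simp add: br_simps c d)
  have "\<omega> (e' *\<^sub>R br x q) z = 0" "\<omega> z (e' *\<^sub>R br x q) = 0" for z
    by (simp_all only: z1 omega_simps)
  from this(1)[of q] this(1)[of y] this(2)[of x] have J1: "e' * e = 0" "e' * f = 0" "e' * g = 0"
    by (simp_all add: omega_simps e_def f_def g_def)
  have "br (br y x) q = 0"
    using br_flip[of y x] pq unfolding XY by (simp add: br_simps c d)
  then have z2: "e *\<^sub>R br y p = 0"
    using jacobi[of y x q] unfolding XQ YQ by (simp add: br_simps c d)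
  have "\<omega> (e *\<^sub>R br y p) z = 0" "\<omega> z (e *\<^sub>R br y p) = 0" for z
    by (simp_all only: z2 omega_simps)
  from this(1)[of y] this(2)[of x] have J2: "e * g' = 0" "e * f' = 0"
    by (simp_all add: omega_simps f'_def g'_def)
  have "normal_form x p c d q y k l m n e f g e' f' g'"
    unfolding normal_form_def using c d pq XY XQ YP XP YQ J1 J2 by blast
  then show ?thesis by blast
qed

end

section \<open>Self-dual flags: nilpotency and Ricci-flatness\<close>

locale para_kaehler_pair = lagrangian_pair br \<omega> U V
  for br :: "'a::real_vector \<Rightarrow> 'a \<Rightarrow> 'a" and \<omega> U V +
  fixes J :: "'a \<Rightarrow> 'a"
  assumes linear_J: "linear J"
    and J_U: "\<And>u. u \<in> U \<Longrightarrow> J u = u" and J_V: "\<And>v. v \<in> V \<Longrightarrow> J v = - v"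
begin

lemmas J_simps = linear_add[OF linear_J] linear_diff[OF linear_J] linear_scale[OF linear_J]
  linear_neg[OF linear_J] linear_0[OF linear_J]

lemma J_J [simp]: "J (J z) = z"
proof -
  obtain u v where "u \<in> U" "v \<in> V" "z = u + v" using decompose by blast
  then show ?thesis by (simp add: J_simps J_U J_V)
qed

text \<open>A chain of ideals, invariant under \<^term>\<open>J\<close>, which is lowered by the bracket and which the
  symplectic form maps to itself. The first two properties make \<^term>\<open>J\<close> nilpotent; together with
  the duality they make the Levi-Civita connection strictly triangular.\<close>

definition self_dual_flag :: "(nat \<Rightarrow> 'a set) \<Rightarrow> nat \<Rightarrow> bool" where
  "self_dual_flag F N \<longleftrightarrow> F 0 = {0} \<and> F N = UNIV \<and>
     (\<forall>i<N. \<forall>z\<in>F (Suc i). \<forall>w. br z w \<in> F i) \<and>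
     (\<forall>i\<le>N. \<forall>z\<in>F i. J z \<in> F i) \<and>
     (\<forall>i\<le>N. \<forall>z. z \<in> F i \<longleftrightarrow> (\<forall>w\<in>F (N - i). \<omega> z w = 0)) \<and>
     (\<forall>i<N. F i \<subseteq> F (Suc i))"

lemma
  assumes "self_dual_flag F N"
  shows flag_0: "F 0 = {0}" and flag_top: "F N = UNIV"
    and flag_lower: "i < N \<Longrightarrow> z \<in> F (Suc i) \<Longrightarrow> br z w \<in> F i"
    and flag_J: "i \<le> N \<Longrightarrow> z \<in> F i \<Longrightarrow> J z \<in> F i"
    and flag_orthogonal: "i \<le> N \<Longrightarrow> z \<in> F i \<Longrightarrow> w \<in> F (N - i) \<Longrightarrow> \<omega> z w = 0"
    and flag_dualI: "i \<le> N \<Longrightarrow> (\<And>w. w \<in> F (N - i) \<Longrightarrow> \<omega> z w = 0) \<Longrightarrow> z \<in> F i"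
    and flag_mono: "i < N \<Longrightarrow> z \<in> F i \<Longrightarrow> z \<in> F (Suc i)"
proof -
  note F = assms[unfolded self_dual_flag_def]
  note * = F[THEN conjunct1] F[THEN conjunct2, THEN conjunct1]
    F[THEN conjunct2, THEN conjunct2, THEN conjunct1]
    F[THEN conjunct2, THEN conjunct2, THEN conjunct2, THEN conjunct1]
    F[THEN conjunct2, THEN conjunct2, THEN conjunct2, THEN conjunct2, THEN conjunct1]
    F[THEN conjunct2, THEN conjunct2, THEN conjunct2, THEN conjunct2, THEN conjunct2]
  show "F 0 = {0}" "F N = UNIV" by (rule *)+
  show "i < N \<Longrightarrow> z \<in> F (Suc i) \<Longrightarrow> br z w \<in> F i" using *(3) by blast
  show "i \<le> N \<Longrightarrow> z \<in> F i \<Longrightarrow> J z \<in> F i" using *(4) by blast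
  show "i \<le> N \<Longrightarrow> z \<in> F i \<Longrightarrow> w \<in> F (N - i) \<Longrightarrow> \<omega> z w = 0" using *(5) by blast
  show "i \<le> N \<Longrightarrow> (\<And>w. w \<in> F (N - i) \<Longrightarrow> \<omega> z w = 0) \<Longrightarrow> z \<in> F i" using *(5) by blast
  show "i < N \<Longrightarrow> z \<in> F i \<Longrightarrow> z \<in> F (Suc i)" using *(6) by blast
qed

lemma self_dual_flag_nilpotent:
  assumes F: "self_dual_flag F N" shows "nilpotent_structure br J"
proof -
  have "F i \<subseteq> asc_series br J i" if "i \<le> N" for i
    using that
  proof (induction i)
    case 0
    then show ?case using flag_0[OF F] by simp
  next
    case (Suc i)
    show ?case
    proof
      fix z assume z: "z \<in> F (Suc i)"
      then have "J z \<in> F (Suc i)" using flag_J[OF F] Suc.prems by blast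
      with z have "br z w \<in> F i" "br (J z) w \<in> F i" for w
        using flag_lower[OF F] Suc.prems by (auto simp: Suc_le_eq)
      then show "z \<in> asc_series br J (Suc i)" using Suc by auto
    qed
  qed
  then have "F N \<subseteq> asc_series br J N" by simp
  then have "asc_series br J N = UNIV" using flag_top[OF F] by auto
  then show ?thesis unfolding nilpotent_structure_def by blast
qed

lemma span_orthogonal:
  assumes "\<And>a b. a \<in> A \<Longrightarrow> b \<in> B \<Longrightarrow> \<omega> a b = 0" and "z \<in> span A" "w \<in> span B"
  shows "\<omega> z w = 0"
proof -
  have zB: "\<omega> z b = 0" if "b \<in> B" for b
    using assms(2)
  proof (rule span_induct)
    show "subspace {z. \<omega> z b = 0}" by (auto simp: subspace_def omega_simps)
  qed (use assms(1) that in auto)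
  show ?thesis
    using assms(3)
  proof (rule span_induct)
    show "subspace {w. \<omega> z w = 0}" by (auto simp: subspace_def omega_simps)
  qed (use zB in auto)
qed

text \<open>For partners \<^term>\<open>u\<close>, \<^term>\<open>v\<close> of a dual basis, \<^term>\<open>\<omega> (h u) v\<close> is a diagonal coefficient of a
  linear map \<^term>\<open>h\<close>. If the partners are complementary, it vanishes for every map that lowers the
  flag.\<close>

definition complementary :: "(nat \<Rightarrow> 'a set) \<Rightarrow> nat \<Rightarrow> 'a \<Rightarrow> 'a \<Rightarrow> bool" where
  "complementary F N u v \<longleftrightarrow> (\<exists>i<N. u \<in> F (Suc i) \<and> v \<in> F (N - i))"

lemma complementary_sym:
  assumes "complementary F N u v" shows "complementary F N v u"
proof -
  obtain i where i: "i < N" "u \<in> F (Suc i)" "v \<in> F (N - i)"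
    using assms unfolding complementary_def by blast
  have "N - (N - Suc i) = Suc i" "Suc (N - Suc i) = N - i" using i(1) by auto
  then show ?thesis
    unfolding complementary_def using i by (intro exI[of _ "N - Suc i"]) simp
qed

lemma self_dual_flag_exists:
  "\<exists>F x p c d q y. self_dual_flag F 4 \<and> dual_basis x p c d q y \<and>
     complementary F 4 x d \<and> complementary F 4 p q \<and> complementary F 4 c y"
proof -
  obtain c d where cd: "central_pair c d" using central_pair_exists by blast
  then obtain x p q y where b: "dual_basis x p c d q y"
    using dual_basis_exists unfolding central_pair_def by blast
  obtain k l m n e f g e' f' g' where nf: "normal_form x p c d q y k l m n e f g e' f' g'"
    using normal_form_exists[OF cd b] by blast
  note bas = b[unfolded dual_basis_def] and nf = nf[unfolded normal_form_def]
  have bas': "x \<in> U" "p \<in> U" "c \<in> U" "d \<in> V" "q \<in> V" "y \<in> V" using bas by auto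
  have \<omega>0: "\<omega> x d = 1" "\<omega> x q = 0" "\<omega> x y = 0" "\<omega> p d = 0" "\<omega> p q = 1" "\<omega> p y = 0"
     "\<omega> c d = 0" "\<omega> c q = 0" "\<omega> c y = 1" using bas by auto
  have \<omega>1: "\<omega> x p = 0" "\<omega> x c = 0" "\<omega> p x = 0" "\<omega> p c = 0" "\<omega> c x = 0" "\<omega> c p = 0"
     "\<omega> d q = 0" "\<omega> d y = 0" "\<omega> q d = 0" "\<omega> q y = 0" "\<omega> y d = 0" "\<omega> y q = 0"
    using bas' by (simp_all add: iso_U iso_V)
  have \<omega>2: "\<omega> d c = 0" "\<omega> d p = 0" "\<omega> q c = 0"
    using \<omega>0 omega_zero_flip by blast+
  \<comment> \<open>the third step contains whichever of the two is central modulo the second step\<close>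
  obtain r where r: "r = p \<and> e' = 0 \<or> r = q \<and> e = 0" using nf by fastforce
  define G where "G i = (if i = 0 then {} else if i = 1 then {c, d} else if i = 2 then {c, d, r}
     else if i = 3 then {c, d, p, q} else {c, d, p, q, x, y})" for i :: nat
  have G: "G 0 = {}" "G 1 = {c, d}" "G (Suc 0) = {c, d}" "G 2 = {c, d, r}" "G 3 = {c, d, p, q}"
     "G 4 = {c, d, p, q, x, y}"
    by (simp_all add: G_def)
  have le4: "i = 0 \<or> i = 1 \<or> i = 2 \<or> i = 3 \<or> i = 4" if "i \<le> 4" for i :: nat
    using that by arith
  define F where "F i = span (G i)" for i
  have "F 0 = {0}" by (simp add: F_def G)
  have expand: "z = \<omega> z d *\<^sub>R x + \<omega> z q *\<^sub>R p + \<omega> z y *\<^sub>R c + \<omega> x z *\<^sub>R d + \<omega> p z *\<^sub>R q + \<omega> c z *\<^sub>R y" for z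
    by (rule dual_basis_expand[OF b])
  have F4: "F 4 = UNIV"
  proof -
    have "z \<in> F 4" for z
      by (subst expand) (simp add: F_def G span_add span_scale span_base)
    then show ?thesis by blast
  qed
  have lower: "br z w \<in> F i" if "i < 4" "z \<in> F (Suc i)" for i z w
  proof -
    have gen: "br s a \<in> span (G i)" if s: "s \<in> G (Suc i)" and a: "a \<in> {x, p, c, d, q, y}" for s a
    proof -
      have br0: "br c a = 0" "br d a = 0" "br a c = 0" "br a d = 0" for a
        using nf br_zero_flip by blast+
      have xy: "br x y = k *\<^sub>R p + l *\<^sub>R q + m *\<^sub>R c + n *\<^sub>R d" "br y x = - (k *\<^sub>R p + l *\<^sub>R q + m *\<^sub>R c + n *\<^sub>R d)"
        and xp: "br x p = - (l + f') *\<^sub>R c" "br p x = - (- (l + f') *\<^sub>R c)"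
        and xq: "br x q = e *\<^sub>R p + f *\<^sub>R c + g *\<^sub>R d" "br q x = - (e *\<^sub>R p + f *\<^sub>R c + g *\<^sub>R d)"
        and yp: "br y p = e' *\<^sub>R q + f' *\<^sub>R d + g' *\<^sub>R c" "br p y = - (e' *\<^sub>R q + f' *\<^sub>R d + g' *\<^sub>R c)"
        and yq: "br y q = (k - f) *\<^sub>R d" "br q y = - ((k - f) *\<^sub>R d)"
        and pq: "br p q = 0" "br q p = 0"
        using nf br_flip[of y x] br_flip[of p x] br_flip[of q x] br_flip[of p y] br_flip[of q y]
          br_flip[of q p] by (simp_all only: minus_zero)
      note br = br0 xy xp xq yp yq pq br_self
      have "i = 0 \<or> i = 1 \<or> i = 2 \<or> i = 3" using \<open>i < 4\<close> by arith
      define S where "S = span (G i)"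
      have S: "0 \<in> S" "\<And>u v. u \<in> S \<Longrightarrow> v \<in> S \<Longrightarrow> u + v \<in> S" "\<And>u v. u \<in> S \<Longrightarrow> v \<in> S \<Longrightarrow> u - v \<in> S"
          "\<And>u. u \<in> S \<Longrightarrow> - u \<in> S" "\<And>u t. u \<in> S \<Longrightarrow> t *\<^sub>R u \<in> S"
        unfolding S_def by (fact span_0 span_add span_diff span_neg span_scale)+
      from \<open>i = 0 \<or> i = 1 \<or> i = 2 \<or> i = 3\<close> show ?thesis
      proof (elim disjE)
        assume "i = 0"
        then have "s \<in> {c, d}" using s by (simp add: G_def)
        then show ?thesis by (auto simp: br span_0)
      next
        assume i: "i = 1"
        then have s': "s \<in> {c, d, r}" using s by (simp add: G_def)
        have m: "c \<in> S" "d \<in> S" unfolding S_def by (simp_all add: G_def i span_base)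
        show ?thesis
          unfolding S_def[symmetric] using s' a r by (auto simp: br m S)
      next
        assume i: "i = 2"
        then have s': "s \<in> {c, d, p, q}" using s by (simp add: G_def)
        have m: "c \<in> S" "d \<in> S" "r \<in> S" unfolding S_def by (simp_all add: G_def i span_base)
        show ?thesis
          unfolding S_def[symmetric] using s' a r m(3) by (auto simp: br m(1,2) S)
      next
        assume i: "i = 3"
        then have s': "s \<in> {c, d, p, q, x, y}" using s by (simp add: G_def)
        have m: "c \<in> S" "d \<in> S" "p \<in> S" "q \<in> S" unfolding S_def by (simp_all add: G_def i span_base)
        show ?thesis
          unfolding S_def[symmetric] using s' a by (auto simp: br m S)
      qed
    qed
    have gen': "br s w \<in> span (G i)" if s: "s \<in> G (Suc i)" for s
    proof -
      have "br s w = \<omega> w d *\<^sub>R br s x + \<omega> w q *\<^sub>R br s p + \<omega> w y *\<^sub>R br s c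
          + \<omega> x w *\<^sub>R br s d + \<omega> p w *\<^sub>R br s q + \<omega> c w *\<^sub>R br s y"
        by (subst (1) expand[of w]) (simp add: br_simps)
      also have "\<dots> \<in> span (G i)" by (intro span_add span_scale gen s) auto
      finally show ?thesis .
    qed
    have "z \<in> span (G (Suc i))" using that by (simp add: F_def)
    then have "br z w \<in> span (G i)"
    proof (rule span_induct)
      show "subspace {z. br z w \<in> span (G i)}"
        by (auto simp: subspace_def br_simps span_add span_scale span_0)
    qed (simp add: gen')
    then show ?thesis by (simp add: F_def)
  qed
  have invariant: "J z \<in> F i" if "z \<in> F i" for i z
  proof -
    have "z \<in> span (G i)" using that by (simp add: F_def)
    then have "J z \<in> span (G i)"
    proof (rule span_induct)
      show "subspace {z. J z \<in> span (G i)}"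
        by (auto simp: subspace_def J_simps span_add span_scale span_0)
      fix s assume s: "s \<in> G i"
      then have "s \<in> U \<or> s \<in> V" using bas' r by (auto simp: G_def split: if_splits)
      then show "J s \<in> span (G i)"
        using s J_U J_V by (auto simp: span_base span_neg)
    qed
    then show ?thesis by (simp add: F_def)
  qed
  have orth: "\<omega> a w = 0" if "i \<le> 4" "a \<in> G i" "w \<in> G (4 - i)" for i a w
    using le4[OF that(1)] that(2,3) \<omega>0 \<omega>1 \<omega>2 r by (auto simp: G)
  have dual: "z \<in> F i \<longleftrightarrow> (\<forall>w\<in>F (4 - i). \<omega> z w = 0)" if "i \<le> 4" for i z
  proof
    assume "z \<in> F i"
    then show "\<forall>w\<in>F (4 - i). \<omega> z w = 0"
      using span_orthogonal[of "G i" "G (4 - i)"] orth[OF that] by (auto simp: F_def)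
  next
    assume "\<forall>w\<in>F (4 - i). \<omega> z w = 0"
    then have "\<omega> z w = 0" if "w \<in> G (4 - i)" for w using that by (auto simp: F_def intro: span_base)
    then have z: "\<omega> z w = 0 \<and> \<omega> w z = 0" if "w \<in> G (4 - i)" for w using that omega_zero_flip by blast
    have "\<omega> z d = 0 \<or> x \<in> G i" "\<omega> z q = 0 \<or> p \<in> G i" "\<omega> z y = 0 \<or> c \<in> G i"
      "\<omega> x z = 0 \<or> d \<in> G i" "\<omega> p z = 0 \<or> q \<in> G i" "\<omega> c z = 0 \<or> y \<in> G i"
      using le4[OF \<open>i \<le> 4\<close>] z r by (auto simp: G)
    then have "\<omega> z d *\<^sub>R x \<in> F i" "\<omega> z q *\<^sub>R p \<in> F i" "\<omega> z y *\<^sub>R c \<in> F i"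
      "\<omega> x z *\<^sub>R d \<in> F i" "\<omega> p z *\<^sub>R q \<in> F i" "\<omega> c z *\<^sub>R y \<in> F i"
      unfolding F_def by (auto simp: span_0 intro: span_scale span_base)
    then show "z \<in> F i"
      by (subst expand[of z]) (simp add: F_def span_add)
  qed
  have mono: "F i \<subseteq> F (Suc i)" if "i < 4" for i
  proof -
    have "i = 0 \<or> i = 1 \<or> i = 2 \<or> i = 3" using that by arith
    then have "G i \<subseteq> G (Suc i)" using r by (auto simp: G_def)
    then show ?thesis unfolding F_def by (rule span_mono)
  qed
  have "self_dual_flag F 4"
    unfolding self_dual_flag_def
  proof (intro conjI)
    show "\<forall>i<4. \<forall>z\<in>F (Suc i). \<forall>w. br z w \<in> F i" using lower by blast
    show "\<forall>i\<le>4. \<forall>z\<in>F i. J z \<in> F i" using invariant by blast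
    show "\<forall>i\<le>4. \<forall>z. z \<in> F i \<longleftrightarrow> (\<forall>w\<in>F (4 - i). \<omega> z w = 0)" using dual by blast
    show "\<forall>i<4. F i \<subseteq> F (Suc i)" using mono by blast
  qed fact+
  moreover have "complementary F 4 x d" "complementary F 4 c y"
    unfolding complementary_def F_def
    by (rule exI[of _ 3], simp add: G_def span_base) (rule exI[of _ 0], simp add: G_def span_base)
  moreover have "complementary F 4 p q"
  proof (cases "r = p")
    case True
    then show ?thesis
      unfolding complementary_def F_def by (intro exI[of _ 1]) (simp add: G_def span_base)
  next
    case False
    then have "r = q" using r by blast
    then show ?thesis
      unfolding complementary_def F_def by (intro exI[of _ 2]) (simp add: G_def span_base)
  qed
  ultimately show ?thesis using b by blast
qed

abbreviation metric :: "'a \<Rightarrow> 'a \<Rightarrow> real" where "metric \<equiv> assoc_metric J \<omega>"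

abbreviation nabla :: "'a \<Rightarrow> 'a \<Rightarrow> 'a" where "nabla \<equiv> levi_civita br metric"

lemma riesz:
  assumes \<eta>: "linear \<eta>"
  shows "\<exists>v. \<forall>w. \<omega> v w = (\<eta> w :: real)"
proof -
  obtain c d where cd: "central_pair c d" using central_pair_exists by blast
  then obtain x p q y where b: "dual_basis x p c d q y"
    using dual_basis_exists unfolding central_pair_def by blast
  note bas = b[unfolded dual_basis_def]
  define v where "v = \<eta> d *\<^sub>R x + \<eta> q *\<^sub>R p + \<eta> y *\<^sub>R c - \<eta> x *\<^sub>R d - \<eta> p *\<^sub>R q - \<eta> c *\<^sub>R y"
  have flip: "\<omega> d w = - \<omega> w d" "\<omega> q w = - \<omega> w q" "\<omega> y w = - \<omega> w y" for w
    by (rule omega_flip)+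
  have "\<omega> v w = \<eta> w" for w
  proof -
    have "\<omega> v w = \<eta> d * \<omega> x w + \<eta> q * \<omega> p w + \<eta> y * \<omega> c w + \<eta> x * \<omega> w d + \<eta> p * \<omega> w q + \<eta> c * \<omega> w y"
      unfolding v_def by (simp add: omega_simps flip)
    also have "\<dots> = \<eta> (\<omega> w d *\<^sub>R x + \<omega> w q *\<^sub>R p + \<omega> w y *\<^sub>R c + \<omega> x w *\<^sub>R d + \<omega> p w *\<^sub>R q + \<omega> c w *\<^sub>R y)"
      using \<eta> by (simp add: linear_add linear_scale)
    also have "\<dots> = \<eta> w" using dual_basis_expand[OF b, of w] by simp
    finally show ?thesis .
  qed
  then show ?thesis by blast
qed

lemma metric_eqI:
  assumes "\<And>z. metric v z = metric w z" shows "v = w"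
proof -
  have "\<omega> (v - w) z = 0" for z
    using assms[of "J z"] by (simp add: assoc_metric_def omega_simps)
  then have "v - w = 0" by (rule nondegenerate)
  then show ?thesis by simp
qed

lemma koszul:
  "2 * metric (nabla x y) z = metric (br x y) z + metric (br z x) y + metric (br z y) x"
proof -
  define \<eta> where "\<eta> z = (metric (br x y) (J z) + metric (br (J z) x) y + metric (br (J z) y) x) / 2" for z
  have "linear \<eta>"
    unfolding \<eta>_def assoc_metric_def
    by (rule linearI) (simp_all add: J_simps br_simps omega_simps field_simps)
  then obtain v where v: "\<And>w. \<omega> v w = \<eta> w" using riesz by blast
  have ex: "\<forall>z. 2 * metric v z = metric (br x y) z + metric (br z x) y + metric (br z y) x"
  proof
    fix z
    have "\<omega> v (J z) = \<eta> (J z)" by (rule v)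
    then show "2 * metric v z = metric (br x y) z + metric (br z x) y + metric (br z y) x"
      by (simp add: \<eta>_def assoc_metric_def)
  qed
  have "nabla x y = v"
    unfolding levi_civita_def
  proof (rule the_equality)
    show "\<forall>z. 2 * metric v z = metric (br x y) z + metric (br z x) y + metric (br z y) x" by (rule ex)
    fix v' assume v': "\<forall>z. 2 * metric v' z = metric (br x y) z + metric (br z x) y + metric (br z y) x"
    have "metric v' z = metric v z" for z
      using ex[THEN spec, of z] v'[THEN spec, of z] by simp
    then show "v' = v" by (rule metric_eqI)
  qed
  then show ?thesis using ex by simp
qed

lemma bilinear_nabla: "bilinear nabla"
proof -
  have *: "2 * metric v z = 2 * metric w z \<Longrightarrow> metric v z = metric w z" for v w z by simp
  note simps = assoc_metric_def omega_simps br_simps J_simps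
  have "linear (nabla x)" for x
  proof (rule linearI)
    show "nabla x (y + z) = nabla x y + nabla x z" for y z
    proof (rule metric_eqI, rule *)
      fix w
      have "2 * metric (nabla x y + nabla x z) w = 2 * metric (nabla x y) w + 2 * metric (nabla x z) w"
        by (simp add: simps)
      then show "2 * metric (nabla x (y + z)) w = 2 * metric (nabla x y + nabla x z) w"
        unfolding koszul by (simp add: simps)
    qed
    show "nabla x (r *\<^sub>R y) = r *\<^sub>R nabla x y" for r y
    proof (rule metric_eqI, rule *)
      fix w
      have "2 * metric (r *\<^sub>R nabla x y) w = r * (2 * metric (nabla x y) w)"
        by (simp add: simps)
      then show "2 * metric (nabla x (r *\<^sub>R y)) w = 2 * metric (r *\<^sub>R nabla x y) w"
        unfolding koszul by (simp add: simps distrib_left)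
    qed
  qed
  moreover have "linear (\<lambda>x. nabla x y)" for y
  proof (rule linearI)
    show "nabla (x + z) y = nabla x y + nabla z y" for x z
    proof (rule metric_eqI, rule *)
      fix w
      have "2 * metric (nabla x y + nabla z y) w = 2 * metric (nabla x y) w + 2 * metric (nabla z y) w"
        by (simp add: simps)
      then show "2 * metric (nabla (x + z) y) w = 2 * metric (nabla x y + nabla z y) w"
        unfolding koszul by (simp add: simps)
    qed
    show "nabla (r *\<^sub>R x) y = r *\<^sub>R nabla x y" for r x
    proof (rule metric_eqI, rule *)
      fix w
      have "2 * metric (r *\<^sub>R nabla x y) w = r * (2 * metric (nabla x y) w)"
        by (simp add: simps)
      then show "2 * metric (nabla (r *\<^sub>R x) y) w = 2 * metric (r *\<^sub>R nabla x y) w"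
        unfolding koszul by (simp add: simps distrib_left)
    qed
  qed
  ultimately show ?thesis by (simp add: bilinear_def)
qed

text \<open>By Koszul's formula, \<^term>\<open>metric (nabla x z) w\<close> is a sum of three values of \<^term>\<open>\<omega>\<close>, and
  closedness turns each into values on elements of complementary steps of the flag.\<close>

lemma nabla_lowers:
  assumes F: "self_dual_flag F N" and "i < N" and xz: "x \<in> F (Suc i) \<or> z \<in> F (Suc i)"
  shows "nabla x z \<in> F i"
proof -
  have lower: "br v w \<in> F j" "br w v \<in> F j" if "j < N" "v \<in> F (Suc j)" for j v w
  proof -
    show 1: "br v w \<in> F j" using flag_lower[OF F] that by blast
    have "- br v w \<in> F j"
      by (rule flag_dualI[OF F])
         (use that 1 flag_orthogonal[OF F, of j "br v w"] in \<open>simp_all add: omega_simps\<close>)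
    then show "br w v \<in> F j" using br_flip[of w v] by simp
  qed
  have inv: "J v \<in> F j" if "j \<le> N" "v \<in> F j" for j v
    using flag_J[OF F that] .
  have orth: "\<omega> v w = 0" "\<omega> w v = 0" if "j \<le> N" "v \<in> F j" "w \<in> F (N - j)" for j v w
    using flag_orthogonal[OF F that] omega_zero_flip by blast+
  have "\<omega> (nabla x z) w = 0" if w: "w \<in> F (N - i)" for w
  proof -
    define j where "j = N - Suc i"
    have j: "N - i = Suc j" "j < N" "N - j = Suc i"
      using \<open>i < N\<close> by (auto simp: j_def)
    have Jw: "J w \<in> F (Suc j)" using inv[of "N - i" w] w j by simp
    have *: "\<omega> v v' = 0" "\<omega> v' v = 0" if "v \<in> F i" "v' \<in> F (Suc j)" for v v'
      using orth[of i v v'] that j \<open>i < N\<close> by simp_all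
    have **: "\<omega> v v' = 0" "\<omega> v' v = 0" if "v \<in> F j" "v' \<in> F (Suc i)" for v v'
      using orth[of j v v'] that j by simp_all
    have 1: "\<omega> (br x z) w = 0"
      using xz lower[OF \<open>i < N\<close>] w *(1) unfolding j(1) by blast
    have 2: "\<omega> (br (J w) x) (J z) = 0"
      using xz
    proof
      assume "x \<in> F (Suc i)"
      then show ?thesis
        using closed[of "J w" x "J z"] lower[OF \<open>i < N\<close>, of x] lower[OF \<open>j < N\<close> Jw] * ** Jw by simp
    next
      assume "z \<in> F (Suc i)"
      then have "J z \<in> F (Suc i)" using inv \<open>i < N\<close> by simp
      then show ?thesis using lower[OF \<open>j < N\<close> Jw] ** by blast
    qed
    have 3: "\<omega> (br (J w) z) (J x) = 0"
      using xz
    proof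
      assume "z \<in> F (Suc i)"
      then show ?thesis
        using closed[of "J w" z "J x"] lower[OF \<open>i < N\<close>, of z] lower[OF \<open>j < N\<close> Jw] * ** Jw by simp
    next
      assume "x \<in> F (Suc i)"
      then have "J x \<in> F (Suc i)" using inv \<open>i < N\<close> by simp
      then show ?thesis using lower[OF \<open>j < N\<close> Jw] ** by blast
    qed
    show ?thesis
      using koszul[of x z "J w"] 1 2 3 by (simp add: assoc_metric_def)
  qed
  then show ?thesis using flag_dualI[OF F, of i "nabla x z"] \<open>i < N\<close> by simp
qed

lemma curvature_lowers:
  assumes F: "self_dual_flag F N" and "i < N" and b: "b \<in> F (Suc i)"
  shows "curvature br metric b y z \<in> F i"
proof -
  note lowers = nabla_lowers[OF F \<open>i < N\<close>]
  have sub: "u - v \<in> F i" if "u \<in> F i" "v \<in> F i" for u v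
    by (rule flag_dualI[OF F])
       (use that \<open>i < N\<close> flag_orthogonal[OF F, of i] in \<open>simp_all add: omega_simps\<close>)
  have "nabla b z \<in> F i" "br b y \<in> F i" using lowers b flag_lower[OF F \<open>i < N\<close> b] by blast+
  then have "nabla b z \<in> F (Suc i)" "br b y \<in> F (Suc i)" using flag_mono[OF F \<open>i < N\<close>] by blast+
  then show ?thesis unfolding curvature_def using lowers b sub by blast
qed

lemma linear_curvature: "linear (\<lambda>b. curvature br metric b y z)"
  unfolding curvature_def
  by (rule linearI)
     (simp_all add: br_simps bilinear_ladd[OF bilinear_nabla] bilinear_radd[OF bilinear_nabla]
        bilinear_lmul[OF bilinear_nabla] bilinear_rmul[OF bilinear_nabla] algebra_simps)

text \<open>Ricci curvature is a trace in an arbitrary basis \<^term>\<open>B\<close>; this is the same trace in the dual basis.\<close>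

lemma trace_dual_basis:
  assumes b: "dual_basis x p c d q y" and f: "linear f"
    and B: "independent B" "span B = UNIV"
  shows "(\<Sum>v\<in>B. representation B (f v) v) =
    \<omega> (f x) d + \<omega> (f p) q + \<omega> (f c) y + \<omega> x (f d) + \<omega> p (f q) + \<omega> c (f y)"
proof -
  have expand: "z = \<omega> z d *\<^sub>R x + \<omega> z q *\<^sub>R p + \<omega> z y *\<^sub>R c + \<omega> x z *\<^sub>R d + \<omega> p z *\<^sub>R q + \<omega> c z *\<^sub>R y" for z
    by (rule dual_basis_expand[OF b])
  have "z \<in> span {x, p, c, d, q, y}" for z
    by (subst expand) (simp add: span_add span_scale span_base)
  then have "B \<subseteq> span {x, p, c, d, q, y}" by blast
  then have "finite B" using independent_span_bound[of "{x, p, c, d, q, y}" B] B by simp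
  have functional: "(\<Sum>v\<in>B. \<alpha> (f v) * representation B w v) = \<alpha> (f w)" if \<alpha>: "linear \<alpha>" for w and \<alpha> :: "'a \<Rightarrow> real"
  proof -
    have "w = (\<Sum>v\<in>B. representation B w v *\<^sub>R v)"
      using sum_representation_eq[OF B(1) _ \<open>finite B\<close> order_refl, of w] B by simp
    then have "\<alpha> (f w) = \<alpha> (f (\<Sum>v\<in>B. representation B w v *\<^sub>R v))" by (rule arg_cong)
    also have "\<dots> = (\<Sum>v\<in>B. representation B w v * \<alpha> (f v))"
      by (simp add: linear_sum[OF f] linear_sum[OF \<alpha>] linear_scale[OF f] linear_scale[OF \<alpha>])
    finally show ?thesis by (simp add: mult.commute)
  qed
  have "representation B (f v) v =
      \<omega> (f v) d * representation B x v + \<omega> (f v) q * representation B p v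
    + \<omega> (f v) y * representation B c v + \<omega> x (f v) * representation B d v
    + \<omega> p (f v) * representation B q v + \<omega> c (f v) * representation B y v" for v
    by (subst expand[of "f v"])
       (simp add: representation_add[OF B(1)] representation_scale[OF B(1)] B(2))
  then have "(\<Sum>v\<in>B. representation B (f v) v) =
      (\<Sum>v\<in>B. \<omega> (f v) d * representation B x v) + (\<Sum>v\<in>B. \<omega> (f v) q * representation B p v)
    + (\<Sum>v\<in>B. \<omega> (f v) y * representation B c v) + (\<Sum>v\<in>B. \<omega> x (f v) * representation B d v)
    + (\<Sum>v\<in>B. \<omega> p (f v) * representation B q v) + (\<Sum>v\<in>B. \<omega> c (f v) * representation B y v)"
    by (simp add: sum.distrib)
  then show ?thesis
    using functional[OF linear_omega(2)] functional[OF linear_omega(1)] by simp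
qed

theorem nilpotent_J: "nilpotent_structure br J"
  using self_dual_flag_exists self_dual_flag_nilpotent by blast

theorem ricci_flat_metric: "ricci_flat br metric"
  unfolding ricci_flat_def
proof (intro allI impI ballI)
  fix B :: "'a set" and y' z assume B: "independent B \<and> span B = UNIV" and "y' \<in> B" "z \<in> B"
  obtain F x p c d q y where F: "self_dual_flag F 4" and b: "dual_basis x p c d q y"
    and compl: "complementary F 4 x d" "complementary F 4 p q" "complementary F 4 c y"
    using self_dual_flag_exists by blast
  have zero: "\<omega> (curvature br metric u y' z) v = 0" if uv: "complementary F 4 u v" for u v
  proof -
    obtain i where i: "i < 4" "u \<in> F (Suc i)" "v \<in> F (4 - i)"
      using uv unfolding complementary_def by blast
    show ?thesis
      by (rule flag_orthogonal[OF F _ curvature_lowers[OF F i(1,2)] i(3)]) (use i(1) in simp)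
  qed
  have zero': "\<omega> u (curvature br metric v y' z) = 0" if "complementary F 4 u v" for u v
    using zero[OF complementary_sym[OF that]] by (rule omega_zero_flip)
  show "ricci br metric B y' z = 0"
    unfolding ricci_def
    using trace_dual_basis[OF b linear_curvature, of B y' z] B zero zero' compl by simp
qed

end

section \<open>From para-Kaehler structures to Lagrangian pairs\<close>

text \<open>Compatibility makes the eigenspaces isotropic, and integrability makes them subalgebras.\<close>

lemma para_kaehler_imp_pair:
  fixes br :: "'a::real_vector \<Rightarrow> 'a \<Rightarrow> 'a"
  assumes lie: "lie_algebra br" and nil: "nilpotent_lie br" and dim6: "dim (UNIV :: 'a set) = 6"
    and pk: "para_kaehler br J \<omega>"
  shows "para_kaehler_pair br \<omega> {x. x - J x = 0} {x. x + J x = 0} J"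
proof -
  define U V where "U = {x. x - J x = 0}" and "V = {x. x + J x = 0}"
  have symp: "symplectic_form br \<omega>" and J: "linear J" "\<And>x. J (J x) = x" and dim: "dim U = dim V"
    and N: "\<And>x y. br x y + br (J x) (J y) - J (br (J x) y) - J (br x (J y)) = 0"
    and comp: "\<And>x y. \<omega> (J x) (J y) = - \<omega> x y"
    using pk by (simp_all add: para_kaehler_def para_complex_def almost_para_complex_def compatible_def
        nijenhuis_def U_def V_def)
  have bil: "bilinear br" "bilinear \<omega>"
    using lie symp by (simp_all add: lie_algebra_def symplectic_form_def)
  have inU: "x \<in> U \<longleftrightarrow> J x = x" for x by (auto simp: U_def)
  have inV: "x \<in> V \<longleftrightarrow> J x = - x" for x by (simp add: V_def eq_neg_iff_add_eq_0 add.commute)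
  have sub: "subspace U" "subspace V"
    unfolding subspace_def
    by (auto simp: inU inV linear_add[OF J(1)] linear_scale[OF J(1)] linear_0[OF J(1)])
  have decompose: "\<exists>u\<in>U. \<exists>v\<in>V. z = u + v" for z
  proof (intro bexI)
    have "(1/2) *\<^sub>R (z + J z) + (1/2) *\<^sub>R (z - J z) = (1/2) *\<^sub>R (2 *\<^sub>R z)"
      unfolding scaleR_add_right[symmetric] by (simp add: scaleR_2)
    then show "z = (1/2) *\<^sub>R (z + J z) + (1/2) *\<^sub>R (z - J z)" by simp
    show "(1/2) *\<^sub>R (z + J z) \<in> U" "(1/2) *\<^sub>R (z - J z) \<in> V"
      unfolding inU inV using J by (simp_all add: linear_add linear_diff linear_scale add.commute minus_diff_eq
          flip: scaleR_minus_right)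
  qed
  have disjoint: "x = 0" if "x \<in> U" "x \<in> V" for x
    using that by (simp add: inU inV eq_neg_iff_add_eq_0 flip: scaleR_2)
  obtain A where A: "A \<subseteq> U" "independent A" "U \<subseteq> span A" "card A = dim U" by (rule basis_exists)
  obtain B where B: "B \<subseteq> V" "independent B" "V \<subseteq> span B" "card B = dim V" by (rule basis_exists)
  have spanA: "span A = U"
    by (rule antisym[OF span_minimal[OF A(1) sub(1)] A(3)])
  have spanB: "span B = V"
    by (rule antisym[OF span_minimal[OF B(1) sub(2)] B(3)])
  have AB: "A \<inter> B = {}"
    using A(1,2) B(1) disjoint dependent_zero by blast
  have "independent (A \<union> B)"
    unfolding dependent_def
  proof (clarify)
    fix a assume a: "a \<in> A \<union> B" and sp: "a \<in> span (A \<union> B - {a})"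
    show False
    proof (cases "a \<in> A")
      case True
      then have "A \<union> B - {a} = (A - {a}) \<union> B" using AB by blast
      then obtain u v where uv: "u \<in> span (A - {a})" "v \<in> V" "a = u + v"
        using sp spanB by (auto simp: span_Un)
      have "u \<in> U" using uv(1) span_mono[of "A - {a}" A] spanA by blast
      then have "a - u \<in> U" using True A(1) sub by (intro subspace_diff) auto
      then have "v = 0" using uv disjoint by simp
      then show False using uv True A(2) unfolding dependent_def by auto
    next
      case False
      then have "a \<in> B" "A \<union> B - {a} = A \<union> (B - {a})" using a by blast+
      then obtain u v where uv: "u \<in> U" "v \<in> span (B - {a})" "a = u + v"
        using sp spanA by (auto simp: span_Un)
      have "v \<in> V" using uv(2) span_mono[of "B - {a}" B] spanB by blast
      then have "a - v \<in> V" using \<open>a \<in> B\<close> B(1) sub by (intro subspace_diff) auto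
      then have "u = 0" using uv disjoint by simp
      then show False using uv \<open>a \<in> B\<close> B(2) unfolding dependent_def by auto
    qed
  qed
  moreover have "UNIV \<subseteq> span (A \<union> B)"
  proof
    fix z
    obtain u v where "u \<in> U" "v \<in> V" "z = u + v" using decompose by blast
    then show "z \<in> span (A \<union> B)" using spanA spanB by (auto simp: span_Un)
  qed
  ultimately have card: "card (A \<union> B) = 6"
    using basis_card_eq_dim[of "A \<union> B" UNIV] dim6 by simp
  then have "finite (A \<union> B)" by (intro card_ge_0_finite) simp
  then have "card A + card B = 6" using card AB by (simp add: card_Un_disjoint)
  then have dims: "dim U = 3" "dim V = 3" using A(4) B(4) dim by simp_all
  have \<omega>_neg: "\<omega> (- x) (- y) = \<omega> x y" for x y
    by (simp add: bilinear_lneg[OF bil(2)] bilinear_rneg[OF bil(2)])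
  have "para_kaehler_pair br \<omega> U V J"
  proof unfold_locales
    show "\<omega> x y = 0" if "x \<in> U" "y \<in> U" for x y
      using comp[of x y] that by (simp add: inU)
    show "\<omega> x y = 0" if "x \<in> V" "y \<in> V" for x y
      using comp[of x y] that \<omega>_neg by (simp add: inV)
    show "br x y \<in> U" if "x \<in> U" "y \<in> U" for x y
    proof -
      have "2 *\<^sub>R (br x y - J (br x y)) = 0"
        using N[of x y] that by (simp add: inU scaleR_2 algebra_simps)
      then show ?thesis by (simp add: inU)
    qed
    show "br x y \<in> V" if "x \<in> V" "y \<in> V" for x y
    proof -
      have "2 *\<^sub>R (br x y + J (br x y)) = 0"
        using N[of x y] that
        by (simp add: inV scaleR_2 algebra_simps bilinear_lneg[OF bil(1)] bilinear_rneg[OF bil(1)]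
            linear_neg[OF J(1)])
      then show ?thesis by (simp add: inV eq_neg_iff_add_eq_0 add.commute)
    qed
  qed (use lie nil symp sub dims decompose J(1) inU inV linear_add[OF J(1)] linear_scale[OF J(1)] in auto)
  then show ?thesis by (simp add: U_def V_def)
qed

section \<open>The model algebras\<close>

lemma exhaust_6: "x = 1 \<or> x = 2 \<or> x = 3 \<or> x = 4 \<or> x = 5 \<or> x = 6" for x :: 6
proof (induct x)
  case (of_int z)
  then have "0 \<le> z" "z < 6" by simp_all
  then have "z = 0 \<or> z = 1 \<or> z = 2 \<or> z = 3 \<or> z = 4 \<or> z = 5" by arith
  then show ?case by auto
qed

lemma forall_6: "(\<forall>i::6. P i) \<longleftrightarrow> P 1 \<and> P 2 \<and> P 3 \<and> P 4 \<and> P 5 \<and> P 6"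
  by (metis exhaust_6)

lemma UNIV_6: "(UNIV :: 6 set) = {1, 2, 3, 4, 5, 6}"
  using exhaust_6 by auto

lemma bracket_of_Nil: "bracket_of [] x y = 0"
  by (simp add: bracket_of_def)

lemma bracket_of_Cons:
  "bracket_of ((i, j, c, k) # L) x y = ((x $ i * y $ j - x $ j * y $ i) * c) *\<^sub>R axis k 1 + bracket_of L x y"
  by (simp add: bracket_of_def)

lemma form_of_Nil: "form_of [] x y = 0"
  by (simp add: form_of_def)

lemma form_of_Cons:
  "form_of ((c, i, j) # L) x y = c * (x $ i * y $ j - x $ j * y $ i) + form_of L x y"
  by (simp add: form_of_def)

lemma axis_nth: "axis k (1::real) $ i = (if i = k then 1 else 0)"
  by (simp add: axis_def)

lemmas coordinates = bracket_of_Nil bracket_of_Cons form_of_Nil form_of_Cons axis_nth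

lemma bilinear_bracket_of: "bilinear (bracket_of L)"
proof -
  have "bracket_of L (x + x') y = bracket_of L x y + bracket_of L x' y \<and>
        bracket_of L x (y + y') = bracket_of L x y + bracket_of L x y' \<and>
        bracket_of L (r *\<^sub>R x) y = r *\<^sub>R bracket_of L x y \<and>
        bracket_of L x (r *\<^sub>R y) = r *\<^sub>R bracket_of L x y" for x x' y y' r
    by (induction L) (auto simp: coordinates algebra_simps)
  then show ?thesis by (auto simp: bilinear_def intro!: linearI)
qed

lemma bracket_of_self: "bracket_of L x x = 0"
  by (induction L) (auto simp: coordinates)

lemma bilinear_form_of: "bilinear (form_of L)"
proof -
  have "form_of L (x + x') y = form_of L x y + form_of L x' y \<and>
        form_of L x (y + y') = form_of L x y + form_of L x y' \<and>
        form_of L (r *\<^sub>R x) y = r *\<^sub>R form_of L x y \<and>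
        form_of L x (r *\<^sub>R y) = r *\<^sub>R form_of L x y" for x x' y y' r
    by (induction L) (auto simp: coordinates algebra_simps)
  then show ?thesis by (auto simp: bilinear_def intro!: linearI)
qed

lemma form_of_self: "form_of L x x = 0"
  by (induction L) (auto simp: coordinates)

text \<open>The numerals 1, ..., 6 in their usual order, which is not an order of the type \<^typ>\<open>6\<close>, where 6
  is 0.\<close>

definition level :: "6 \<Rightarrow> nat" where
  "level i = (if i = 1 then 1 else if i = 2 then 2 else if i = 3 then 3 else if i = 4 then 4
     else if i = 5 then 5 else 6)"

lemma nilpotent_bracket_of:
  assumes L: "\<forall>(i, j, c, k)\<in>set L. level i < level k \<and> level j < level k"
  shows "nilpotent_lie (bracket_of L)"
proof -
  define Z where "Z k = {x :: real^6. \<forall>i. level i \<le> k \<longrightarrow> x $ i = 0}" for k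
  have sub: "subspace (Z k)" for k by (auto simp: Z_def subspace_def)
  have step: "bracket_of L x y \<in> Z (Suc k)" if "y \<in> Z k" for x y k
    using L
  proof (induction L)
    case Nil
    then show ?case by (simp add: bracket_of_Nil Z_def)
  next
    case (Cons a L)
    obtain i j c m where a: "a = (i, j, c, m)" by (cases a) auto
    have "((x $ i * y $ j - x $ j * y $ i) * c) *\<^sub>R axis m 1 \<in> Z (Suc k)"
      using that Cons.prems a by (auto simp: Z_def axis_nth)
    moreover have "bracket_of L x y \<in> Z (Suc k)" using Cons by auto
    ultimately show ?case
      unfolding a bracket_of_Cons by (rule subspace_add[OF sub])
  qed
  have "lower_central (bracket_of L) k \<subseteq> Z k" for k
  proof (induction k)
    case 0
    have "level i \<noteq> 0" for i by (simp add: level_def)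
    then show ?case unfolding Z_def le_zero_eq by blast
  next
    case (Suc k)
    have "{bracket_of L x y | x y. y \<in> lower_central (bracket_of L) k} \<subseteq> Z (Suc k)"
      using Suc step by blast
    then show ?case unfolding lower_central.simps by (rule span_minimal[OF _ sub])
  qed
  moreover have "Z 6 = {0}"
  proof -
    have "level i \<le> 6" for i by (simp add: level_def)
    then show ?thesis by (auto simp: Z_def vec_eq_iff)
  qed
  moreover have "0 \<in> lower_central (bracket_of L) 6"
    by (simp add: numeral_eq_Suc span_0)
  ultimately have "lower_central (bracket_of L) 6 = {0}" by blast
  then show ?thesis unfolding nilpotent_lie_def by blast
qed

lemma lie_algebra_bracket_ofI:
  assumes "\<And>x y z. bracket_of L x (bracket_of L y z) + bracket_of L y (bracket_of L z x)
     + bracket_of L z (bracket_of L x y) = 0"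
  shows "lie_algebra (bracket_of L)"
  using assms by (simp add: lie_algebra_def bilinear_bracket_of bracket_of_self)

abbreviation "G6_br \<equiv> bracket_of [(1,2,1,3), (1,3,1,4), (1,4,1,5), (2,3,1,6)]"
abbreviation "G10_br \<equiv> bracket_of [(1,2,1,4), (1,4,1,5), (1,3,1,6), (2,4,1,6)]"
abbreviation "G11_br \<equiv> bracket_of [(1,2,1,4), (1,4,1,5), (2,3,1,6), (2,4,1,6)]"
abbreviation "G12_br \<equiv> bracket_of [(1,2,1,4), (1,4,1,5), (2,3,-1,5), (1,3,1,6), (2,4,1,6)]"
abbreviation "G13_br \<equiv> bracket_of [(1,2,1,4), (1,3,1,5), (1,4,1,6), (2,3,1,6)]"
abbreviation "G14_br \<equiv> bracket_of [(1,2,1,4), (1,3,1,5), (1,4,1,6)]"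
abbreviation "G15_br \<equiv> bracket_of [(1,2,1,4), (2,3,1,5), (1,4,1,6)]"
abbreviation "G16_br \<equiv> bracket_of [(1,2,1,5), (3,4,-1,5), (1,3,1,6), (2,4,1,6)]"
abbreviation "G17_br \<equiv> bracket_of [(1,3,1,5), (1,4,1,6), (2,3,1,6)]"
abbreviation "G18_br \<equiv> bracket_of [(1,2,1,4), (1,3,1,5), (2,3,1,6)]"
abbreviation "G19_br \<equiv> bracket_of [(1,2,1,4), (1,4,1,5), (1,5,1,6)]"
abbreviation "G21_br \<equiv> bracket_of [(1,2,1,4), (1,4,1,6), (2,3,1,6)]"
abbreviation "G23_br \<equiv> bracket_of [(1,2,1,5), (1,3,1,6)]"
abbreviation "G24_br \<equiv> bracket_of [(2,3,1,5), (1,4,1,6)]"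
abbreviation "G25_br \<equiv> bracket_of [(1,2,1,6)]"

text \<open>All brackets \<^term>\<open>br (axis i 1) (axis j 1)\<close> of the models lie in the span of
  \<^term>\<open>axis k 1\<close> with \<^term>\<open>k\<close> larger than \<^term>\<open>i\<close> and \<^term>\<open>j\<close>.\<close>

lemma model_nilpotent:
  assumes "listed br \<omega>"
  shows "nilpotent_lie br"
  using assms by cases (simp only:, rule nilpotent_bracket_of, simp add: level_def)+


lemma model_lie_algebras:
  "lie_algebra G6_br"
  "lie_algebra G10_br"
  "lie_algebra G11_br"
  "lie_algebra G12_br"
  "lie_algebra G13_br"
  "lie_algebra G14_br"
  "lie_algebra G15_br"
  "lie_algebra G16_br"
  "lie_algebra G17_br"
  "lie_algebra G18_br"
  "lie_algebra G19_br"
  "lie_algebra G21_br"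
  "lie_algebra G23_br"
  "lie_algebra G24_br"
  "lie_algebra G25_br"
  by (intro lie_algebra_bracket_ofI; simp add: vec_eq_iff forall_6 coordinates; (intro conjI)?; algebra)+

lemma model_lie_algebra:
  assumes "listed br \<omega>"
  shows "lie_algebra br"
  using assms by cases (simp_all add: model_lie_algebras)

text \<open>Closedness is linear in each argument and in the coefficients of the form, hence a
  polynomial identity; nondegeneracy is tested on the basis vectors.\<close>

lemma model_closed:
  assumes "listed br \<omega>"
  shows "\<omega> (br x y) z - \<omega> (br x z) y + \<omega> (br y z) x = 0"
  using assms by (induction rule: listed.induct; simp add: coordinates algebra_simps)

lemma model_nondegenerate:
  assumes "listed br \<omega>" and "\<And>y. \<omega> x y = 0"
  shows "x = 0"
proof -
  have *: "\<omega> x (axis 1 1) = 0" "\<omega> x (axis 2 1) = 0" "\<omega> x (axis 3 1) = 0"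
     "\<omega> x (axis 4 1) = 0" "\<omega> x (axis 5 1) = 0" "\<omega> x (axis 6 1) = 0"
    using assms(2) by blast+
  have "x $ 1 = 0 \<and> x $ 2 = 0 \<and> x $ 3 = 0 \<and> x $ 4 = 0 \<and> x $ 5 = 0 \<and> x $ 6 = 0"
    using assms(1)
  proof cases
    case (G18_2 t)
    note F = G18_2(2) coordinates
    have "x $ 5 + t * x $ 6 = 0" using *(1) by (simp add: F)
    moreover have "t * x $ 5 - x $ 6 = 0" using *(2) by (simp add: F)
    moreover have "x $ 1 - t * x $ 2 = 0" using *(5) by (simp add: F)
    moreover have "t * x $ 1 + x $ 2 = 0" using *(6) by (simp add: F)
    ultimately have eqs: "x $ 5 + t * x $ 6 = 0" "t * x $ 5 - x $ 6 = 0" "x $ 1 - t * x $ 2 = 0"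
      "t * x $ 1 + x $ 2 = 0" by blast+
    have 34: "x $ 3 = 0" "x $ 4 = 0"
      using *(3,4) G18_2(3) by (simp_all add: F)
    have "1 + t * t \<noteq> 0" using zero_le_square[of t] by linarith
    moreover have "(1 + t * t) * x $ 5 = 0" "(1 + t * t) * x $ 1 = 0"
      using eqs by algebra+
    ultimately have "x $ 5 = 0" "x $ 1 = 0" by simp_all
    then show ?thesis using eqs 34 by simp
  qed (use * in \<open>simp_all add: coordinates\<close>)
  then show ?thesis by (simp add: vec_eq_iff forall_6)
qed

lemma model_symplectic:
  assumes "listed br \<omega>"
  shows "symplectic_form br \<omega>"
proof -
  have "bilinear \<omega> \<and> (\<forall>x. \<omega> x x = 0)"
    using assms by cases (simp_all add: bilinear_form_of form_of_self)
  then show ?thesis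
    using model_closed[OF assms] model_nondegenerate[OF assms] by (simp add: symplectic_form_def)
qed

section \<open>Para-Kaehler structures on the models\<close>

text \<open>An entry \<^term>\<open>(j, c, i)\<close> contributes the summand \<^term>\<open>c *\<^sub>R axis i 1\<close> to the image of
  \<^term>\<open>axis j 1\<close>.\<close>

definition endo_of :: "(6 \<times> real \<times> 6) list \<Rightarrow> real^6 \<Rightarrow> real^6" where
  "endo_of K x = (\<Sum>(j, c, i)\<leftarrow>K. (c * x $ j) *\<^sub>R axis i 1)"

lemma endo_of_Nil: "endo_of [] x = 0"
  by (simp add: endo_of_def)

lemma endo_of_Cons: "endo_of ((j, c, i) # K) x = (c * x $ j) *\<^sub>R axis i 1 + endo_of K x"
  by (simp add: endo_of_def)

lemma linear_endo_of: "linear (endo_of K)"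
proof -
  have "endo_of K (x + y) = endo_of K x + endo_of K y \<and> endo_of K (r *\<^sub>R x) = r *\<^sub>R endo_of K x" for x y r
    by (induction K) (auto simp: endo_of_Nil endo_of_Cons algebra_simps)
  then show ?thesis by (auto intro!: linearI)
qed

text \<open>Pairing with the elements of a basis of \<^term>\<open>B\<close> maps \<^term>\<open>A\<close> injectively into \<^term>\<open>B\<close>.\<close>

lemma dim_le_of_pairing:
  fixes \<omega> :: "real^6 \<Rightarrow> real^6 \<Rightarrow> real" and A B :: "(real^6) set"
  assumes "bilinear \<omega>" "subspace A" "subspace B"
    and nondeg: "\<And>a. a \<in> A \<Longrightarrow> (\<And>b. b \<in> B \<Longrightarrow> \<omega> a b = 0) \<Longrightarrow> a = 0"
  shows "dim A \<le> dim B"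
proof -
  obtain S where S: "S \<subseteq> B" "independent S" "B \<subseteq> span S" "card S = dim B" by (rule basis_exists)
  have "finite S" using S(2) by (rule independent_imp_finite)
  define f where "f a = (\<Sum>s\<in>S. \<omega> a s *\<^sub>R s)" for a
  have lin: "linear f"
    unfolding f_def
    by (rule linearI) (simp_all add: bilinear_ladd[OF assms(1)] bilinear_lmul[OF assms(1)]
        scaleR_add_left sum.distrib scaleR_sum_right)
  have "inj_on f A"
  proof (rule inj_onI)
    fix a a' assume a: "a \<in> A" "a' \<in> A" "f a = f a'"
    have "(\<Sum>s\<in>S. \<omega> (a - a') s *\<^sub>R s) = 0"
      using a(3) linear_diff[OF lin, of a a'] by (simp add: f_def)
    then have S0: "\<omega> (a - a') s = 0" if "s \<in> S" for s
      using S(2) \<open>finite S\<close> that independentD by blast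
    have "\<omega> (a - a') b = 0" if "b \<in> B" for b
    proof -
      have "b \<in> span S" using S(3) that by blast
      then show ?thesis
      proof (rule span_induct)
        show "subspace {b. \<omega> (a - a') b = 0}"
          by (auto simp: subspace_def bilinear_radd[OF assms(1)] bilinear_rmul[OF assms(1)]
              bilinear_rzero[OF assms(1)])
      qed (use S0 in auto)
    qed
    moreover have "a - a' \<in> A" using a assms(2) by (intro subspace_diff)
    ultimately have "a - a' = 0" using nondeg by blast
    then show "a = a'" by simp
  qed
  then have "dim A = dim (f ` A)"
    using lin assms(2) by (metis dim_image_eq span_eq_iff)
  also have "f ` A \<subseteq> B"
    using S(1) assms(3) by (auto simp: f_def intro!: subspace_sum subspace_scale)
  then have "dim (f ` A) \<le> dim B" by (rule dim_subset)
  finally show ?thesis .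
qed

text \<open>The eigenspaces of a compatible involution are isotropic, so each is paired nondegenerately with the
  other, and their dimensions agree.\<close>

lemma compatible_eigenspaces:
  fixes J :: "real^6 \<Rightarrow> real^6"
  assumes symp: "symplectic_form br \<omega>" and J: "linear J" "\<And>x. J (J x) = x" and comp: "compatible J \<omega>"
  shows "almost_para_complex J"
proof -
  define U V where "U = {x. x - J x = 0}" and "V = {x. x + J x = 0}"
  have bil: "bilinear \<omega>" and nondeg: "\<And>x. (\<And>y. \<omega> x y = 0) \<Longrightarrow> x = 0"
    using symp by (auto simp: symplectic_form_def)
  have inU: "x \<in> U \<longleftrightarrow> J x = x" for x by (auto simp: U_def)
  have inV: "x \<in> V \<longleftrightarrow> J x = - x" for x by (simp add: V_def eq_neg_iff_add_eq_0 add.commute)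
  have sub: "subspace U" "subspace V"
    unfolding subspace_def
    by (auto simp: inU inV linear_add[OF J(1)] linear_scale[OF J(1)] linear_0[OF J(1)])
  have isoU: "\<omega> x y = 0" if "x \<in> U" "y \<in> U" for x y
    using comp[unfolded compatible_def, rule_format, of x y] that by (simp add: inU)
  have isoV: "\<omega> x y = 0" if "x \<in> V" "y \<in> V" for x y
    using comp[unfolded compatible_def, rule_format, of x y] that
    by (simp add: inV bilinear_lneg[OF bil] bilinear_rneg[OF bil])
  have split: "\<exists>u\<in>U. \<exists>v\<in>V. y = u + v" for y
  proof (intro bexI)
    have "(1/2) *\<^sub>R (y + J y) + (1/2) *\<^sub>R (y - J y) = (1/2) *\<^sub>R (2 *\<^sub>R y)"
      unfolding scaleR_add_right[symmetric] by (simp add: scaleR_2)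
    then show "y = (1/2) *\<^sub>R (y + J y) + (1/2) *\<^sub>R (y - J y)" by simp
    show "(1/2) *\<^sub>R (y + J y) \<in> U" "(1/2) *\<^sub>R (y - J y) \<in> V"
      unfolding inU inV using J by (simp_all add: linear_add linear_diff linear_scale add.commute minus_diff_eq
          flip: scaleR_minus_right)
  qed
  have "dim U \<le> dim V"
  proof (rule dim_le_of_pairing[OF bil sub])
    fix a assume a: "a \<in> U" "\<And>b. b \<in> V \<Longrightarrow> \<omega> a b = 0"
    show "a = 0"
    proof (rule nondeg)
      fix y obtain u v where "u \<in> U" "v \<in> V" "y = u + v" using split by blast
      then show "\<omega> a y = 0" using a isoU by (simp add: bilinear_radd[OF bil])
    qed
  qed
  moreover have "dim V \<le> dim U"
  proof (rule dim_le_of_pairing[OF bil sub(2,1)])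
    fix a assume a: "a \<in> V" "\<And>b. b \<in> U \<Longrightarrow> \<omega> a b = 0"
    show "a = 0"
    proof (rule nondeg)
      fix y obtain u v where "u \<in> U" "v \<in> V" "y = u + v" using split by blast
      then show "\<omega> a y = 0" using a isoV by (simp add: bilinear_radd[OF bil])
    qed
  qed
  ultimately show ?thesis using J unfolding almost_para_complex_def U_def V_def by simp
qed

lemma para_kaehler_modelI:
  assumes "symplectic_form (bracket_of L) (form_of F)"
    and "\<And>x. endo_of K (endo_of K x) = x"
    and "\<And>x y. form_of F (endo_of K x) (endo_of K y) = - form_of F x y"
    and "\<And>x y. nijenhuis (bracket_of L) (endo_of K) x y = 0"
  shows "\<exists>J \<omega>. para_kaehler (bracket_of L) J \<omega>"
proof -
  have "compatible (endo_of K) (form_of F)" using assms(3) by (simp add: compatible_def)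
  moreover from this have "almost_para_complex (endo_of K)"
    using compatible_eigenspaces assms(1,2) linear_endo_of by blast
  ultimately show ?thesis using assms(1,4) unfolding para_kaehler_def para_complex_def by blast
qed

lemma symplectic_form_ofI:
  assumes "\<And>x. \<lbrakk>form_of F x (axis 1 1) = 0; form_of F x (axis 2 1) = 0; form_of F x (axis 3 1) = 0;
     form_of F x (axis 4 1) = 0; form_of F x (axis 5 1) = 0; form_of F x (axis 6 1) = 0\<rbrakk>
     \<Longrightarrow> x $ 1 = 0 \<and> x $ 2 = 0 \<and> x $ 3 = 0 \<and> x $ 4 = 0 \<and> x $ 5 = 0 \<and> x $ 6 = 0"
    and "\<And>x y z. form_of F (bracket_of L x y) z - form_of F (bracket_of L x z) y
        + form_of F (bracket_of L y z) x = 0"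
  shows "symplectic_form (bracket_of L) (form_of F)"
proof -
  have "x = 0" if "\<forall>y. form_of F x y = 0" for x
    using assms(1)[of x] that by (simp add: vec_eq_iff forall_6)
  then show ?thesis using assms(2) by (simp add: symplectic_form_def bilinear_form_of form_of_self)
qed

lemmas J_coordinates = vec_eq_iff forall_6 nijenhuis_def coordinates endo_of_Nil endo_of_Cons algebra_simps

text \<open>For the next two algebras no splitting of the basis \<^term>\<open>axis i 1\<close> into two halves works. The
  structures come from the structure equations with \<^term>\<open>k = 1\<close>, \<^term>\<open>l = 1\<close>, \<^term>\<open>g = 1\<close>,
  \<^term>\<open>f' = 1\<close>, \<^term>\<open>f = 2\<close> and \<^term>\<open>g' = 8\<close> for the first, \<^term>\<open>g' = 4\<close> for the second, the other
  parameters being 0; this makes the discriminant of the pencil zero and negative, respectively.\<close>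

lemma para_kaehler_G10: "\<exists>J \<omega>. para_kaehler G10_br J \<omega>"
  by (rule para_kaehler_modelI[where F = "[(1,1,5), (2,1,6), (2,2,5), (-4,2,6), (-4,3,4)]" and
        K = "[(1,1,1), (2,4,1), (2,-1,2), (3,-2,4), (4,-1/2,3), (5,-1,5), (6,1,6), (6,-4,5)]"],
      rule symplectic_form_ofI) (simp_all add: J_coordinates)

lemma para_kaehler_G12: "\<exists>J \<omega>. para_kaehler G12_br J \<omega>"
  by (rule para_kaehler_modelI[where F = "[(1,1,5), (1,1,6), (1,2,5), (-3,2,6), (-2,3,4)]" and
        K = "[(1,1,1), (2,2,1), (2,-1,2), (3,-1,4), (4,-1,3), (5,-1,5), (6,1,6), (6,-2,5)]"],
      rule symplectic_form_ofI) (simp_all add: J_coordinates)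

lemma para_kaehler_G15: "\<exists>J \<omega>. para_kaehler G15_br J \<omega>"
  by (rule para_kaehler_modelI[where K = "[(2,1,2), (4,1,4), (6,1,6), (3,-1,3), (5,-1,5), (1,-1,1), (1,-2,2)]",
        OF model_symplectic[OF listed.G15]]) (simp_all add: J_coordinates)

lemma para_kaehler_G16: "\<exists>J \<omega>. para_kaehler G16_br J \<omega>"
  by (rule para_kaehler_modelI[where K = "[(1,1,1), (2,1,2), (5,1,5), (3,-1,3), (4,-1,4), (4,-2,1), (6,-1,6), (6,-2,5)]",
        OF model_symplectic[OF listed.G16]]) (simp_all add: J_coordinates)

lemma para_kaehler_G6: "\<exists>J \<omega>. para_kaehler G6_br J \<omega>"
  by (rule para_kaehler_modelI[OF model_symplectic[OF listed.G6],
        where K = "[(1,1,1), (2,-1,2), (3,-1,3), (4,1,4), (5,1,5), (6,-1,6)]"]) (simp_all add: J_coordinates)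

lemma para_kaehler_G11: "\<exists>J \<omega>. para_kaehler G11_br J \<omega>"
  by (rule para_kaehler_modelI[OF model_symplectic[OF listed.G11[of 0]],
        where K = "[(1,1,1), (2,-1,2), (3,-1,3), (4,1,4), (5,1,5), (6,-1,6)]"]) (simp_all add: J_coordinates)

lemma para_kaehler_G13: "\<exists>J \<omega>. para_kaehler G13_br J \<omega>"
  by (rule para_kaehler_modelI[OF model_symplectic[OF listed.G13_1[of 3]],
        where K = "[(1,1,1), (2,-1,2), (3,1,3), (4,-1,4), (5,1,5), (6,-1,6)]"]) (simp_all add: J_coordinates)

lemma para_kaehler_G14: "\<exists>J \<omega>. para_kaehler G14_br J \<omega>"
  by (rule para_kaehler_modelI[OF model_symplectic[OF listed.G14],
        where K = "[(1,1,1), (2,-1,2), (3,1,3), (4,-1,4), (5,1,5), (6,-1,6)]"]) (simp_all add: J_coordinates)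

lemma para_kaehler_G17: "\<exists>J \<omega>. para_kaehler G17_br J \<omega>"
  by (rule para_kaehler_modelI[OF model_symplectic[OF listed.G17],
        where K = "[(1,1,1), (2,-1,2), (3,1,3), (4,-1,4), (5,1,5), (6,-1,6)]"]) (simp_all add: J_coordinates)

lemma para_kaehler_G18: "\<exists>J \<omega>. para_kaehler G18_br J \<omega>"
  by (rule para_kaehler_modelI[OF model_symplectic[OF listed.G18_1[of 3]],
        where K = "[(1,1,1), (2,-1,2), (3,1,3), (4,-1,4), (5,1,5), (6,-1,6)]"]) (simp_all add: J_coordinates)

lemma para_kaehler_G19: "\<exists>J \<omega>. para_kaehler G19_br J \<omega>"
  by (rule para_kaehler_modelI[OF model_symplectic[OF listed.G19],
        where K = "[(1,1,1), (2,-1,2), (3,-1,3), (4,-1,4), (5,1,5), (6,1,6)]"]) (simp_all add: J_coordinates)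

lemma para_kaehler_G21: "\<exists>J \<omega>. para_kaehler G21_br J \<omega>"
  by (rule para_kaehler_modelI[OF model_symplectic[OF listed.G21],
        where K = "[(1,1,1), (2,-1,2), (3,1,3), (4,-1,4), (5,1,5), (6,-1,6)]"]) (simp_all add: J_coordinates)

lemma para_kaehler_G23: "\<exists>J \<omega>. para_kaehler G23_br J \<omega>"
  by (rule para_kaehler_modelI[OF model_symplectic[OF listed.G23_1],
        where K = "[(1,1,1), (2,-1,2), (3,-1,3), (4,1,4), (5,1,5), (6,-1,6)]"]) (simp_all add: J_coordinates)

lemma para_kaehler_G24: "\<exists>J \<omega>. para_kaehler G24_br J \<omega>"
  by (rule para_kaehler_modelI[OF model_symplectic[OF listed.G24],
        where K = "[(1,1,1), (2,-1,2), (3,1,3), (4,-1,4), (5,1,5), (6,-1,6)]"]) (simp_all add: J_coordinates)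

lemma para_kaehler_G25: "\<exists>J \<omega>. para_kaehler G25_br J \<omega>"
  by (rule para_kaehler_modelI[OF model_symplectic[OF listed.G25],
        where K = "[(1,1,1), (2,-1,2), (3,1,3), (4,-1,4), (5,1,5), (6,-1,6)]"]) (simp_all add: J_coordinates)


section \<open>Recognising the models\<close>

definition lie_isomorphic ::
  "('a::real_vector \<Rightarrow> 'a \<Rightarrow> 'a) \<Rightarrow> ('b::real_vector \<Rightarrow> 'b \<Rightarrow> 'b) \<Rightarrow> bool" where
  "lie_isomorphic br br' \<longleftrightarrow> (\<exists>\<phi>. linear \<phi> \<and> bij \<phi> \<and> (\<forall>x y. \<phi> (br x y) = br' (\<phi> x) (\<phi> y)))"

definition comb6 :: "'a::real_vector \<Rightarrow> 'a \<Rightarrow> 'a \<Rightarrow> 'a \<Rightarrow> 'a \<Rightarrow> 'a \<Rightarrow> real^6 \<Rightarrow> 'a" where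
  "comb6 e1 e2 e3 e4 e5 e6 v =
     v $ 1 *\<^sub>R e1 + v $ 2 *\<^sub>R e2 + v $ 3 *\<^sub>R e3 + v $ 4 *\<^sub>R e4 + v $ 5 *\<^sub>R e5 + v $ 6 *\<^sub>R e6"

lemma linear_comb6: "linear (comb6 e1 e2 e3 e4 e5 e6)"
  by (rule linearI) (simp_all add: comb6_def algebra_simps)

lemma spanning_set_independent:
  assumes S: "finite S" "span S = UNIV" "card S \<le> dim (UNIV :: 'a::real_vector set)"
  shows "independent (S :: 'a set)" "card S = dim (UNIV :: 'a set)"
proof -
  obtain B where B: "B \<subseteq> S" "independent B" "S \<subseteq> span B"
    using maximal_independent_subset[of S] by blast
  then have "UNIV \<subseteq> span B" using S(2) span_minimal[OF B(3) subspace_span] by simp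
  then have card: "card B = dim (UNIV :: 'a set)" using basis_card_eq_dim[of B UNIV] B by simp
  then have "B = S" using card_seteq[OF S(1) B(1)] S(3) by simp
  then show "independent S" "card S = dim (UNIV :: 'a set)" using B card by simp_all
qed

lemma bij_comb6:
  fixes e1 :: "'a::real_vector"
  assumes dim6: "dim (UNIV :: 'a set) = 6" and span: "span {e1, e2, e3, e4, e5, e6} = UNIV"
  shows "bij (comb6 e1 e2 e3 e4 e5 e6)"
proof (rule bijI)
  let ?S = "{e1, e2, e3, e4, e5, e6}" and ?\<psi> = "comb6 e1 e2 e3 e4 e5 e6"
  have "card ?S \<le> 6" by (simp add: card_insert_if)
  then have ind: "independent ?S" and "card ?S = 6"
    using spanning_set_independent[of ?S] span dim6 by simp_all
  then have dist: "distinct [e1, e2, e3, e4, e5, e6]"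
    using card_distinct[of "[e1, e2, e3, e4, e5, e6]"] by simp
  have kernel: "v = 0" if "?\<psi> v = 0" for v
  proof -
    define u where "u a = (if a = e1 then v $ 1 else if a = e2 then v $ 2 else if a = e3 then v $ 3
      else if a = e4 then v $ 4 else if a = e5 then v $ 5 else v $ 6)" for a
    have u: "u e1 = v $ 1" "u e2 = v $ 2" "u e3 = v $ 3" "u e4 = v $ 4" "u e5 = v $ 5" "u e6 = v $ 6"
      using dist by (auto simp: u_def)
    have "(\<Sum>a\<in>?S. u a *\<^sub>R a) = ?\<psi> v"
      using dist by (simp add: comb6_def u)
    then have "(\<Sum>a\<in>?S. u a *\<^sub>R a) = 0" using that by simp
    then have "\<forall>a\<in>?S. u a = 0" using independentD[OF ind, of ?S u] by blast
    then show "v = 0" using u by (simp add: vec_eq_iff forall_6)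
  qed
  show "inj ?\<psi>"
  proof (rule injI)
    fix v w assume "?\<psi> v = ?\<psi> w"
    then have "?\<psi> (v - w) = 0" by (simp add: linear_diff[OF linear_comb6])
    then show "v = w" using kernel by fastforce
  qed
  have "subspace (range ?\<psi>)" by (rule linear_subspace_image[OF linear_comb6 subspace_UNIV])
  moreover have "?S \<subseteq> range ?\<psi>"
  proof -
    have "?\<psi> (axis 1 1) = e1" "?\<psi> (axis 2 1) = e2" "?\<psi> (axis 3 1) = e3"
      "?\<psi> (axis 4 1) = e4" "?\<psi> (axis 5 1) = e5" "?\<psi> (axis 6 1) = e6"
      by (simp_all add: comb6_def axis_nth)
    then show ?thesis by (metis (no_types, lifting) empty_subsetI insert_subset rangeI)
  qed
  ultimately have "span ?S \<subseteq> range ?\<psi>" by (intro span_minimal)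
  then show "surj ?\<psi>" using span by auto
qed

locale nilpotent_lie_algebra_6 = nilpotent_lie_algebra br
  for br :: "'a::real_vector \<Rightarrow> 'a \<Rightarrow> 'a" +
  assumes dim6: "dim (UNIV :: 'a set) = 6"
begin

text \<open>A basis whose brackets are those of a model is an isomorphism onto it.\<close>

lemma model_isomorphismI:
  fixes L :: "(6 \<times> 6 \<times> real \<times> 6) list"
  assumes span: "span {e1, e2, e3, e4, e5, e6} = UNIV"
    and "br e1 e2 = comb6 e1 e2 e3 e4 e5 e6 (bracket_of L (axis 1 1) (axis 2 1))"
        "br e1 e3 = comb6 e1 e2 e3 e4 e5 e6 (bracket_of L (axis 1 1) (axis 3 1))"
        "br e1 e4 = comb6 e1 e2 e3 e4 e5 e6 (bracket_of L (axis 1 1) (axis 4 1))"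
        "br e1 e5 = comb6 e1 e2 e3 e4 e5 e6 (bracket_of L (axis 1 1) (axis 5 1))"
        "br e1 e6 = comb6 e1 e2 e3 e4 e5 e6 (bracket_of L (axis 1 1) (axis 6 1))"
        "br e2 e3 = comb6 e1 e2 e3 e4 e5 e6 (bracket_of L (axis 2 1) (axis 3 1))"
        "br e2 e4 = comb6 e1 e2 e3 e4 e5 e6 (bracket_of L (axis 2 1) (axis 4 1))"
        "br e2 e5 = comb6 e1 e2 e3 e4 e5 e6 (bracket_of L (axis 2 1) (axis 5 1))"
        "br e2 e6 = comb6 e1 e2 e3 e4 e5 e6 (bracket_of L (axis 2 1) (axis 6 1))"
        "br e3 e4 = comb6 e1 e2 e3 e4 e5 e6 (bracket_of L (axis 3 1) (axis 4 1))"
        "br e3 e5 = comb6 e1 e2 e3 e4 e5 e6 (bracket_of L (axis 3 1) (axis 5 1))"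
        "br e3 e6 = comb6 e1 e2 e3 e4 e5 e6 (bracket_of L (axis 3 1) (axis 6 1))"
        "br e4 e5 = comb6 e1 e2 e3 e4 e5 e6 (bracket_of L (axis 4 1) (axis 5 1))"
        "br e4 e6 = comb6 e1 e2 e3 e4 e5 e6 (bracket_of L (axis 4 1) (axis 6 1))"
        "br e5 e6 = comb6 e1 e2 e3 e4 e5 e6 (bracket_of L (axis 5 1) (axis 6 1))"
  shows "lie_isomorphic br (bracket_of L)"
proof -
  let ?\<psi> = "comb6 e1 e2 e3 e4 e5 e6"
  have bij: "bij ?\<psi>" by (rule bij_comb6[OF dim6 span])
  have ax: "?\<psi> (axis 1 1) = e1" "?\<psi> (axis 2 1) = e2" "?\<psi> (axis 3 1) = e3"
      "?\<psi> (axis 4 1) = e4" "?\<psi> (axis 5 1) = e5" "?\<psi> (axis 6 1) = e6"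
    by (simp_all add: comb6_def axis_nth)
  define P where "P i j \<longleftrightarrow> br (?\<psi> (axis i 1)) (?\<psi> (axis j 1)) = ?\<psi> (bracket_of L (axis i 1) (axis j 1))" for i j
  have flip: "bracket_of L v w = - bracket_of L w v" for v w
    by (induction L) (auto simp: coordinates algebra_simps)
  have P_sym: "P j i" if "P i j" for i j
    using that br_flip[of "?\<psi> (axis j 1)" "?\<psi> (axis i 1)"] flip[of "axis j 1" "axis i 1"]
    by (simp add: P_def linear_neg[OF linear_comb6])
  have P_refl: "P i i" for i
    by (simp add: P_def bracket_of_self linear_0[OF linear_comb6])
  have "P 1 2" "P 1 3" "P 1 4" "P 1 5" "P 1 6" "P 2 3" "P 2 4" "P 2 5" "P 2 6"
    "P 3 4" "P 3 5" "P 3 6" "P 4 5" "P 4 6" "P 5 6"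
    unfolding P_def ax by fact+
  then have "\<forall>i j. P i j" unfolding forall_6 using P_sym P_refl by blast
  then have on_basis: "br (?\<psi> (axis i 1)) (?\<psi> (axis j 1)) = ?\<psi> (bracket_of L (axis i 1) (axis j 1))" for i j
    by (simp add: P_def)
  have "(\<lambda>v w. br (?\<psi> v) (?\<psi> w)) = (\<lambda>v w. ?\<psi> (bracket_of L v w))"
  proof (rule bilinear_eq_stdbasis)
    show "bilinear (\<lambda>v w. br (?\<psi> v) (?\<psi> w))"
      by (auto simp: bilinear_def br_simps linear_add[OF linear_comb6] linear_scale[OF linear_comb6]
          intro!: linearI)
    show "bilinear (\<lambda>v w. ?\<psi> (bracket_of L v w))"
      by (auto simp: bilinear_def linear_add[OF linear_comb6] linear_scale[OF linear_comb6]
          bilinear_ladd[OF bilinear_bracket_of] bilinear_radd[OF bilinear_bracket_of]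
          bilinear_lmul[OF bilinear_bracket_of] bilinear_rmul[OF bilinear_bracket_of] intro!: linearI)
    show "br (?\<psi> i) (?\<psi> j) = ?\<psi> (bracket_of L i j)" if "i \<in> Basis" "j \<in> Basis" for i j
      using that on_basis by (auto simp: Basis_vec_def)
  qed
  then have hom: "br (?\<psi> v) (?\<psi> w) = ?\<psi> (bracket_of L v w)" for v w by metis
  have "linear (inv ?\<psi>)"
  proof (rule linearI)
    have inv: "inv ?\<psi> z = v" if "?\<psi> v = z" for z v using bij that by (metis bij_is_inj inv_f_f)
    have surj: "?\<psi> (inv ?\<psi> z) = z" for z using bij by (simp add: bij_is_surj surj_f_inv_f)
    show "inv ?\<psi> (x + y) = inv ?\<psi> x + inv ?\<psi> y" for x y
      by (rule inv) (simp add: linear_add[OF linear_comb6] surj)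
    show "inv ?\<psi> (r *\<^sub>R x) = r *\<^sub>R inv ?\<psi> x" for r x
      by (rule inv) (simp add: linear_scale[OF linear_comb6] surj)
  qed
  moreover have "bij (inv ?\<psi>)" using bij by (rule bij_imp_bij_inv)
  moreover have "inv ?\<psi> (br x y) = bracket_of L (inv ?\<psi> x) (inv ?\<psi> y)" for x y
  proof -
    have "br x y = ?\<psi> (bracket_of L (inv ?\<psi> x) (inv ?\<psi> y))"
      using hom[of "inv ?\<psi> x" "inv ?\<psi> y"] bij by (simp add: bij_is_surj surj_f_inv_f)
    then show ?thesis using bij by (simp add: bij_is_inj)
  qed
  ultimately show ?thesis unfolding lie_isomorphic_def by blast
qed

end

section \<open>Classification\<close>

lemma span_UNIV_trans: "span S = UNIV \<Longrightarrow> S \<subseteq> span S' \<Longrightarrow> span S' = UNIV"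
  using span_minimal[OF _ subspace_span, of S S'] by auto

lemma span_solve:
  assumes "u \<in> span S" "w \<in> span S" "u = r *\<^sub>R v + w" "r \<noteq> 0"
  shows "v \<in> span S"
proof -
  have "v = inverse r *\<^sub>R (u - w)" using assms(3,4) by simp
  then show ?thesis using assms(1,2) by (simp add: span_scale span_diff)
qed

lemma square_sign_cases:
  fixes \<delta> :: real
  obtains "\<delta> = 0" | s where "s > 0" "\<delta> = s * s" | s where "s > 0" "\<delta> = - (s * s)"
proof -
  have "\<delta> = 0 \<or> (\<exists>s>0. \<delta> = s * s) \<or> (\<exists>s>0. \<delta> = - (s * s))"
  proof (cases "\<delta> > 0")
    case True
    then show ?thesis by (intro disjI2 disjI1 exI[of _ "sqrt \<delta>"]) simp
  next
    case False
    then show ?thesis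
      by (cases "\<delta> = 0") (auto intro!: exI[of _ "sqrt (- \<delta>)"])
  qed
  then show thesis using that by blast
qed

lemmas span_rules = span_add span_diff span_neg span_scale span_base span_0

context nilpotent_lie_algebra_6
begin

definition central :: "'a \<Rightarrow> bool" where "central z \<longleftrightarrow> (\<forall>w. br z w = 0)"

lemma centralD: "central z \<Longrightarrow> br z w = 0" "central z \<Longrightarrow> br w z = 0"
  by (auto simp: central_def intro: br_zero_flip)

lemma central_combination:
  "central u \<Longrightarrow> central v \<Longrightarrow> central (u + v)" "central u \<Longrightarrow> central v \<Longrightarrow> central (u - v)"
  "central u \<Longrightarrow> central (r *\<^sub>R u)" "central u \<Longrightarrow> central (- u)"
  by (simp_all add: central_def br_simps)

definition has_model :: bool where
  "has_model \<longleftrightarrow> (\<exists>br' \<omega>'. listed br' \<omega>' \<and> lie_isomorphic br br')"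

lemma has_modelI: "listed (bracket_of L) \<omega>' \<Longrightarrow> lie_isomorphic br (bracket_of L) \<Longrightarrow> has_model"
  unfolding has_model_def by blast

lemmas table_simps = comb6_def coordinates br_simps

subsection \<open>Two-step algebras with three generators\<close>

lemma has_model_free_two_step:
  assumes "br a b = u" "br a r = v" "br b r = w" and "central u" "central v" "central w"
    and "span {a, b, r, u, v, w} = UNIV"
  shows has_model
  by (rule has_modelI[OF listed.G18_3], rule model_isomorphismI[OF assms(7)])
     (simp_all add: table_simps assms(1-3) centralD assms(4-6))

text \<open>The bracket of \<^term>\<open>b\<close> and \<^term>\<open>r\<close> is absorbed by adding multiples of \<^term>\<open>a\<close> to them.\<close>

lemma has_model_two_brackets:
  assumes "br a b = u" "br a r = v" "br b r = \<mu> *\<^sub>R u + \<nu> *\<^sub>R v" and "central u" "central v" "central s"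
    and span: "span {a, b, r, s, u, v} = UNIV"
  shows has_model
proof -
  define b' r' where "b' = b - \<nu> *\<^sub>R a" and "r' = r + \<mu> *\<^sub>R a"
  have "br b a = - u" using br_flip[of b a] assms(1) by simp
  then have br: "br b' r' = 0" "br a b' = u" "br a r' = v"
    using assms(1-3) by (simp_all add: b'_def r'_def br_simps)
  have span': "span {a, b', r', s, u, v} = UNIV"
  proof (rule span_UNIV_trans[OF span])
    let ?S = "{a, b', r', s, u, v}"
    have "b = b' + \<nu> *\<^sub>R a" "r = r' - \<mu> *\<^sub>R a" by (simp_all add: b'_def r'_def)
    then have "b \<in> span ?S" "r \<in> span ?S" by (simp_all only: span_rules insert_iff simp_thms)
    then show "{a, b, r, s, u, v} \<subseteq> span ?S" by (simp add: span_base)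
  qed
  show ?thesis
    by (rule has_modelI[OF listed.G23_1], rule model_isomorphismI[OF span'])
       (simp_all add: table_simps br centralD assms(4-6))
qed

lemma has_model_one_bracket:
  assumes "br a b = u" and "central r" "central s" "central t" "central u"
    and "span {a, b, r, s, t, u} = UNIV"
  shows has_model
  by (rule has_modelI[OF listed.G25], rule model_isomorphismI[OF assms(6)])
     (simp_all add: table_simps assms(1) centralD assms(2-5))

subsection \<open>Two-step algebras with four generators\<close>

text \<open>The brackets of \<^term>\<open>x\<close>, \<^term>\<open>y\<close> with \<^term>\<open>p\<close>, \<^term>\<open>q\<close> form a pencil of 2 by 2 matrices
  containing the identity. The other one is not scalar, and can be put into trace-free companion
  form; the model depends on the sign of its determinant \<^term>\<open>- \<delta>\<close>.\<close>

lemma has_model_pencil_companion: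
  assumes xp: "br x p = C" and xq: "br x q = D" and yp: "br y p = D" and yq: "br y q = \<delta> *\<^sub>R C"
    and xy: "br x y = 0" and pq: "br p q = 0" and C: "central C" and D: "central D"
    and span: "span {x, y, p, q, C, D} = UNIV"
  shows has_model
proof -
  have flip: "br p x = - C" "br q x = - D" "br p y = - D" "br q y = - \<delta> *\<^sub>R C" "br y x = 0" "br q p = 0"
    using assms br_flip[of p x] br_flip[of q x] br_flip[of p y] br_flip[of q y]
      br_flip[of y x] br_flip[of q p] by simp_all
  note tbl = xp xq yp yq xy pq flip centralD[OF C] centralD[OF D]
  show ?thesis
  proof (cases rule: square_sign_cases[of \<delta>])
    case 1
    show ?thesis
      by (rule has_modelI[OF listed.G17], rule model_isomorphismI[OF span])
         (simp_all add: table_simps tbl 1)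
  next
    case (2 s)
    define X1 X2 Q1 Q2 where "X1 = y + s *\<^sub>R x" and "X2 = y - s *\<^sub>R x"
      and "Q1 = q + s *\<^sub>R p" and "Q2 = q - s *\<^sub>R p"
    define D1 D2 where "D1 = (2 * s) *\<^sub>R D + (2 * s * s) *\<^sub>R C" and "D2 = (2 * s * s) *\<^sub>R C - (2 * s) *\<^sub>R D"
    have br: "br X1 Q1 = D1" "br X2 Q2 = D2" "br X1 Q2 = 0" "br X2 Q1 = 0" "br X1 X2 = 0" "br Q1 Q2 = 0"
      by (simp_all add: X1_def X2_def Q1_def Q2_def D1_def D2_def br_simps tbl 2 algebra_simps
          flip: scaleR_2)
    have cen: "central D1" "central D2"
      unfolding D1_def D2_def using C D by (simp_all add: central_combination)
    have flip': "br Q1 X2 = 0" "br Q2 X1 = 0" "br X2 X1 = 0" "br Q2 Q1 = 0"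
      using br by (auto intro: br_zero_flip)
    have span': "span {X2, X1, Q1, Q2, D1, D2} = UNIV"
    proof (rule span_UNIV_trans[OF span])
      let ?S = "{X2, X1, Q1, Q2, D1, D2}"
      have mem: "X1 - X2 \<in> span ?S" "Q1 - Q2 \<in> span ?S" "D1 + D2 \<in> span ?S" "D1 - D2 \<in> span ?S"
        "X1 + X2 \<in> span ?S" "Q1 + Q2 \<in> span ?S"
        by (simp_all add: span_rules)
      have eq: "X1 - X2 = (s + s) *\<^sub>R x + 0" "Q1 - Q2 = (s + s) *\<^sub>R p + 0"
        "X1 + X2 = (1 + 1) *\<^sub>R y + 0" "Q1 + Q2 = (1 + 1) *\<^sub>R q + 0"
        "D1 + D2 = (2 * s * s + 2 * s * s) *\<^sub>R C + 0" "D1 - D2 = (2 * s + 2 * s) *\<^sub>R D + 0"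
        unfolding X1_def X2_def Q1_def Q2_def D1_def D2_def scaleR_add_left by simp_all
      note solve = span_solve[OF _ span_0]
      have "x \<in> span ?S" by (rule solve[OF mem(1) eq(1)]) (use 2 in simp)
      moreover have "p \<in> span ?S" by (rule solve[OF mem(2) eq(2)]) (use 2 in simp)
      moreover have "y \<in> span ?S" by (rule solve[OF mem(5) eq(3)]) simp
      moreover have "q \<in> span ?S" by (rule solve[OF mem(6) eq(4)]) simp
      moreover have "C \<in> span ?S" by (rule solve[OF mem(3) eq(5)]) (use 2 in simp)
      moreover have "D \<in> span ?S" by (rule solve[OF mem(4) eq(6)]) (use 2 in simp)
      ultimately show "{x, y, p, q, C, D} \<subseteq> span ?S" by blast
    qed
    show ?thesis
      by (rule has_modelI[OF listed.G24], rule model_isomorphismI[OF span'])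
         (simp_all add: table_simps br flip' centralD cen)
  next
    case (3 s)
    define q' y' D' where "q' = inverse s *\<^sub>R q" and "y' = - inverse s *\<^sub>R y" and "D' = inverse s *\<^sub>R D"
    have inv: "inverse s * (inverse s * (s * s)) = 1" using 3 by (simp add: field_simps)
    have br: "br x p = C" "br x q' = D'" "br x y' = 0" "br p q' = 0" "br p y' = D'" "br q' y' = - C"
      using 3 by (simp_all add: q'_def y'_def D'_def br_simps tbl inv)
    have cen: "central D'" unfolding D'_def using D by (simp add: central_combination)
    have span': "span {x, p, q', y', C, D'} = UNIV"
    proof (rule span_UNIV_trans[OF span])
      let ?S = "{x, p, q', y', C, D'}"
      have "q = s *\<^sub>R q'" "y = - s *\<^sub>R y'" "D = s *\<^sub>R D'" using 3 by (simp_all add: q'_def y'_def D'_def)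
      then have "q \<in> span ?S" "y \<in> span ?S" "D \<in> span ?S" by (simp_all only: span_rules insert_iff simp_thms)
      then show "{x, y, p, q, C, D} \<subseteq> span ?S" by (simp add: span_base)
    qed
    show ?thesis
      by (rule has_modelI[OF listed.G16], rule model_isomorphismI[OF span'])
         (simp_all add: table_simps br centralD cen C)
  qed
qed

text \<open>Subtracting from \<^term>\<open>y\<close> the multiple of \<^term>\<open>x\<close> by half the trace makes the second matrix
  trace-free, and \<^term>\<open>p\<close> is a cyclic vector of it because \<^prop>\<open>\<alpha> \<noteq> 0\<close>; multiples of \<^term>\<open>p\<close> and
  \<^term>\<open>q'\<close> then absorb the bracket of \<^term>\<open>x\<close> and \<^term>\<open>y\<close>.\<close>

lemma has_model_pencil:
  assumes xp: "br x p = C" and xq: "br x q = D"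
    and yp: "br y p = t1 *\<^sub>R C + \<alpha> *\<^sub>R D" and yq: "br y q = \<beta> *\<^sub>R C + t2 *\<^sub>R D" and \<alpha>: "\<alpha> \<noteq> 0"
    and xy: "br x y = m *\<^sub>R C + n *\<^sub>R D" and pq: "br p q = 0" and C: "central C" and D: "central D"
    and span: "span {x, y, p, q, C, D} = UNIV"
  shows has_model
proof -
  define s t where "s = (t1 + t2) / 2" and "t = (t1 - t2) / 2"
  have st: "t1 = s + t" "t2 = s - t" by (simp_all add: s_def t_def field_simps)
  define q' D' where "q' = t *\<^sub>R p + \<alpha> *\<^sub>R q" and "D' = t *\<^sub>R C + \<alpha> *\<^sub>R D"
  define n' m' where "n' = n / \<alpha>" and "m' = m - n' * t"
  have n: "n = n' * \<alpha>" "m = m' + n' * t" using \<alpha> by (simp_all add: n'_def m'_def)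
  define y' where "y' = y - s *\<^sub>R x - m' *\<^sub>R p - n' *\<^sub>R q'"
  have qp: "br q p = 0" using br_zero_flip[OF pq] .
  note tbl = xp xq yp yq xy pq qp
  have "br x q' = D'" "br y' p = D'" "br y' q' = (t * t + \<alpha> * \<beta>) *\<^sub>R C" "br x y' = 0" "br p q' = 0"
    by (simp_all add: q'_def D'_def y'_def br_simps tbl st n algebra_simps)
  moreover have "central D'" unfolding D'_def using C D by (simp add: central_combination)
  moreover have "span {x, y', p, q', C, D'} = UNIV"
  proof (rule span_UNIV_trans[OF span])
    let ?S = "{x, y', p, q', C, D'}"
    have S: "x \<in> span ?S" "y' \<in> span ?S" "p \<in> span ?S" "q' \<in> span ?S" "C \<in> span ?S" "D' \<in> span ?S"
      by (simp_all add: span_base)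
    have "D \<in> span ?S"
      by (rule span_solve[OF S(6) _ _ \<alpha>, where w = "t *\<^sub>R C"]) (simp_all add: D'_def S span_rules)
    moreover have "q \<in> span ?S"
      by (rule span_solve[OF S(4) _ _ \<alpha>, where w = "t *\<^sub>R p"]) (simp_all add: q'_def S span_rules)
    moreover have "y = y' + s *\<^sub>R x + m' *\<^sub>R p + n' *\<^sub>R q'" by (simp add: y'_def)
    then have "y \<in> span ?S" using S by (simp only: span_rules)
    ultimately show "{x, y, p, q, C, D} \<subseteq> span ?S" using S by blast
  qed
  ultimately show ?thesis using has_model_pencil_companion[OF xp] C by blast
qed

lemma has_model_split_pencil:
  assumes xp: "br x p = 0" and xq: "br x q = D" and yp: "br y p = C" and yq: "br y q = 0"
    and xy: "br x y = m *\<^sub>R C + n *\<^sub>R D" and pq: "br p q = 0" and C: "central C" and D: "central D"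
    and span: "span {x, y, p, q, C, D} = UNIV"
  shows has_model
proof -
  define x' y' where "x' = x + m *\<^sub>R p" and "y' = y - n *\<^sub>R q"
  have flip: "br p y = - C" using br_flip[of p y] yp by simp
  have qp: "br q p = 0" using br_zero_flip[OF pq] .
  have br: "br x' p = 0" "br x' q = D" "br y' p = C" "br y' q = 0" "br x' y' = 0"
    by (simp_all add: x'_def y'_def br_simps xp xq yp yq xy pq qp flip)
  have span': "span {y', x', q, p, D, C} = UNIV"
  proof (rule span_UNIV_trans[OF span])
    let ?S = "{y', x', q, p, D, C}"
    have "x = x' - m *\<^sub>R p" "y = y' + n *\<^sub>R q" by (simp_all add: x'_def y'_def)
    then have "x \<in> span ?S" "y \<in> span ?S" by (simp_all only: span_rules insert_iff simp_thms)
    then show "{x, y, p, q, C, D} \<subseteq> span ?S" by (simp add: span_base)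
  qed
  show ?thesis
    by (rule has_modelI[OF listed.G24], rule model_isomorphismI[OF span'])
       (simp_all add: table_simps br br_zero_flip[OF br(5)] centralD C D qp)
qed

end

context nilpotent_lie_algebra_6
begin

subsection \<open>Three-step algebras\<close>

text \<open>Now \<^term>\<open>w\<close> is itself a commutator. Bracketing \<^term>\<open>x\<close>, \<^term>\<open>y\<close> with \<^term>\<open>w\<close> and with
  \<^term>\<open>q\<close> gives two 2 by 2 matrices, the first of them determined up to a factor, the second up to
  multiples of the first. If the first is invertible, their quotient is again put into trace-free
  companion form.\<close>

lemma has_model_three_step_companion:
  assumes xy: "br x y = w" and xw: "br x w = C" and yw: "br y w = D"
    and xq: "br x q = D" and yq: "br y q = \<delta> *\<^sub>R C" and wq: "br w q = 0"
    and C: "central C" and D: "central D" and span: "span {x, y, w, q, C, D} = UNIV"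
  shows has_model
proof -
  have flip: "br y x = - w" "br q w = 0" using xy br_flip[of y x] br_zero_flip[OF wq] by simp_all
  note tbl = xy xw yw xq yq wq flip centralD[OF C] centralD[OF D]
  show ?thesis
  proof (cases rule: square_sign_cases[of \<delta>])
    case 1
    have span': "span {x, y, q, w, C, D} = UNIV" using span by (simp add: insert_commute)
    show ?thesis
      by (rule has_modelI[OF listed.G10], rule model_isomorphismI[OF span'])
         (simp_all add: table_simps tbl 1)
  next
    case (2 s)
    define P M where "P = y + s *\<^sub>R x" and "M = y - s *\<^sub>R x"
    define e3 e4 e5 e6 where "e3 = s *\<^sub>R w - q" and "e4 = s *\<^sub>R w + s *\<^sub>R w"
      and "e5 = s *\<^sub>R D + s *\<^sub>R D + ((s * s) *\<^sub>R C + (s * s) *\<^sub>R C)"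
      and "e6 = s *\<^sub>R D + s *\<^sub>R D - ((s * s) *\<^sub>R C + (s * s) *\<^sub>R C)"
    have br: "br P M = e4" "br P e4 = e5" "br M e4 = e6" "br P e3 = 0" "br M e3 = e6" "br e3 e4 = 0"
      by (simp_all add: P_def M_def e3_def e4_def e5_def e6_def br_simps tbl 2 algebra_simps)
    have cen: "central e5" "central e6"
      unfolding e5_def e6_def using C D by (simp_all add: central_combination)
    have span': "span {P, M, e3, e4, e5, e6} = UNIV"
    proof (rule span_UNIV_trans[OF span])
      let ?S = "{P, M, e3, e4, e5, e6}"
      have S: "P \<in> span ?S" "M \<in> span ?S" "e3 \<in> span ?S" "e4 \<in> span ?S" "e5 \<in> span ?S" "e6 \<in> span ?S"
        by (simp_all add: span_base)
      have eq: "P + M = (1 + 1) *\<^sub>R y + 0" "P - M = (s + s) *\<^sub>R x + 0" "e4 = (s + s) *\<^sub>R w + 0"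
        "e5 + e6 = ((s + s) + (s + s)) *\<^sub>R D + 0" "e5 - e6 = ((s * s + s * s) + (s * s + s * s)) *\<^sub>R C + 0"
        unfolding P_def M_def e4_def e5_def e6_def scaleR_add_left by simp_all
      note solve = span_solve[OF _ span_0]
      have "y \<in> span ?S" by (rule solve[OF span_add[OF S(1,2)] eq(1)]) simp
      moreover have "x \<in> span ?S" by (rule solve[OF span_diff[OF S(1,2)] eq(2)]) (use 2 in simp)
      moreover have w: "w \<in> span ?S" by (rule solve[OF S(4) eq(3)]) (use 2 in simp)
      moreover have "D \<in> span ?S" by (rule solve[OF span_add[OF S(5,6)] eq(4)]) (use 2 in simp)
      moreover have "C \<in> span ?S"
        by (rule solve[OF span_diff[OF S(5,6)] eq(5)]) (use 2 in simp)
      moreover have "q = s *\<^sub>R w - e3" by (simp add: e3_def)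
      then have "q \<in> span ?S" using w S(3) by (simp only: span_rules)
      ultimately show "{x, y, w, q, C, D} \<subseteq> span ?S" by blast
    qed
    show ?thesis
      by (rule has_modelI[OF listed.G11], rule model_isomorphismI[OF span'])
         (simp_all add: table_simps br centralD cen)
  next
    case (3 s)
    define r where "r = inverse s"
    define e2 e3 e4 e5 e6 where "e2 = r *\<^sub>R y" and "e3 = (r * r) *\<^sub>R q" and "e4 = r *\<^sub>R w"
      and "e5 = r *\<^sub>R C" and "e6 = (r * r) *\<^sub>R D"
    have inv: "r * (r * (s * s)) = 1" "r * s = 1" "r \<noteq> 0" using 3 by (simp_all add: r_def field_simps)
    have br: "br x e2 = e4" "br x e4 = e5" "br e2 e4 = e6" "br x e3 = e6" "br e2 e3 = - e5" "br e3 e4 = 0"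
      by (simp_all add: e2_def e3_def e4_def e5_def e6_def br_simps tbl 3 inv)
    have cen: "central e5" "central e6"
      unfolding e5_def e6_def using C D by (simp_all add: central_combination)
    have span': "span {x, e2, e3, e4, e5, e6} = UNIV"
    proof (rule span_UNIV_trans[OF span])
      let ?S = "{x, e2, e3, e4, e5, e6}"
      have S: "x \<in> span ?S" "e2 \<in> span ?S" "e3 \<in> span ?S" "e4 \<in> span ?S" "e5 \<in> span ?S" "e6 \<in> span ?S"
        by (simp_all add: span_base)
      have eq: "e2 = r *\<^sub>R y + 0" "e3 = (r * r) *\<^sub>R q + 0" "e4 = r *\<^sub>R w + 0" "e5 = r *\<^sub>R C + 0"
        "e6 = (r * r) *\<^sub>R D + 0"
        by (simp_all add: e2_def e3_def e4_def e5_def e6_def)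
      note solve = span_solve[OF _ span_0]
      have "r * r \<noteq> 0" using inv by simp
      then show "{x, y, w, q, C, D} \<subseteq> span ?S"
        using S(1) solve[OF S(2) eq(1) inv(3)] solve[OF S(3) eq(2)] solve[OF S(4) eq(3) inv(3)]
          solve[OF S(5) eq(4) inv(3)] solve[OF S(6) eq(5)] by blast
    qed
    obtain t :: real where t: "t \<notin> {0, 1, - 1}" by (rule that[of 2]) simp
    show ?thesis
      by (rule has_modelI[OF listed.G12[OF t]], rule model_isomorphismI[OF span'])
         (simp_all add: table_simps br centralD cen)
  qed
qed

text \<open>The vector \<^term>\<open>x\<close> is cyclic because \<^prop>\<open>t21 \<noteq> 0\<close>; \<^term>\<open>Y\<close> is its image under the trace-free part,
  and the remaining vectors are rescaled to match.\<close>

lemma has_model_three_step_rank2_cyclic: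
  assumes xy: "br x y = w" and xw: "br x w = A" and yw: "br y w = B"
    and xq: "br x q = t11 *\<^sub>R A + t21 *\<^sub>R B" and yq: "br y q = t12 *\<^sub>R A + t22 *\<^sub>R B" and t21: "t21 \<noteq> 0"
    and wq: "br w q = 0" and A: "central A" and B: "central B" and span: "span {x, y, w, q, A, B} = UNIV"
  shows has_model
proof -
  define s t where "s = (t11 + t22) / 2" and "t = (t11 - t22) / 2"
  have st: "t11 = s + t" "t22 = s - t" by (simp_all add: s_def t_def field_simps)
  define Y w' C D q' where "Y = t *\<^sub>R x + t21 *\<^sub>R y" and "w' = t21 *\<^sub>R w" and "C = t21 *\<^sub>R A"
    and "D = t21 *\<^sub>R (t *\<^sub>R A + t21 *\<^sub>R B)" and "q' = t21 *\<^sub>R (q - s *\<^sub>R w)"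
  note tbl = xy xw yw xq yq wq
  have "br x Y = w'" "br x w' = C" "br Y w' = D" "br x q' = D" "br Y q' = (t * t + t12 * t21) *\<^sub>R C" "br w' q' = 0"
    by (simp_all add: Y_def w'_def C_def D_def q'_def br_simps tbl st algebra_simps)
  moreover have "central C" "central D"
    unfolding C_def D_def using A B by (simp_all add: central_combination)
  moreover have "span {x, Y, w', q', C, D} = UNIV"
  proof (rule span_UNIV_trans[OF span])
    let ?S = "{x, Y, w', q', C, D}"
    have S: "x \<in> span ?S" "Y \<in> span ?S" "w' \<in> span ?S" "q' \<in> span ?S" "C \<in> span ?S" "D \<in> span ?S"
      by (simp_all add: span_base)
    have w: "w \<in> span ?S" by (rule span_solve[OF S(3) span_0 _ t21]) (simp add: w'_def)
    have a: "A \<in> span ?S" by (rule span_solve[OF S(5) span_0 _ t21]) (simp add: C_def)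
    have "y \<in> span ?S"
      by (rule span_solve[OF S(2) span_scale[OF S(1), of t] _ t21]) (simp add: Y_def)
    moreover have "B \<in> span ?S"
      by (rule span_solve[OF S(6) span_scale[OF a, of "t21 * t"], of "t21 * t21"])
         (use t21 in \<open>simp_all add: D_def algebra_simps\<close>)
    moreover have "q \<in> span ?S"
      by (rule span_solve[OF S(4) span_scale[OF w, of "- (t21 * s)"] _ t21])
         (simp add: q'_def algebra_simps)
    ultimately show "{x, y, w, q, A, B} \<subseteq> span ?S" using S w a by blast
  qed
  ultimately show ?thesis by (rule has_model_three_step_companion)
qed

text \<open>A matrix that is not scalar has \<^term>\<open>x\<close>, \<^term>\<open>y\<close> or \<^term>\<open>x + y\<close> as a cyclic vector.\<close>

lemma has_model_three_step_rank2:
  assumes xy: "br x y = w" and xw: "br x w = A" and yw: "br y w = B"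
    and xq: "br x q = t11 *\<^sub>R A + t21 *\<^sub>R B" and yq: "br y q = t12 *\<^sub>R A + t22 *\<^sub>R B"
    and nonscalar: "t21 \<noteq> 0 \<or> t12 \<noteq> 0 \<or> t11 \<noteq> t22"
    and wq: "br w q = 0" and A: "central A" and B: "central B" and span: "span {x, y, w, q, A, B} = UNIV"
  shows has_model
proof -
  consider "t21 \<noteq> 0" | "t12 \<noteq> 0" | "t21 = 0" "t12 = 0" "t11 \<noteq> t22" using nonscalar by blast
  then show ?thesis
  proof cases
    case 1
    then show ?thesis using assms by (intro has_model_three_step_rank2_cyclic)
  next
    case 2
    have "br y x = - w" "br (- w) q = 0" using xy wq br_flip[of y x] by (simp_all add: br_simps)
    moreover have "br y (- w) = - B" "br x (- w) = - A" using xw yw by (simp_all add: br_simps)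
    moreover have "br y q = (- t22) *\<^sub>R (- B) + (- t12) *\<^sub>R (- A)" "br x q = (- t21) *\<^sub>R (- B) + (- t11) *\<^sub>R (- A)"
      using xq yq by simp_all
    moreover have "central (- A)" "central (- B)" using A B by (simp_all add: central_combination)
    moreover have "span {y, x, - w, q, - B, - A} = UNIV"
    proof (rule span_UNIV_trans[OF span])
      let ?S = "{y, x, - w, q, - B, - A}"
      have "w = - (- w)" "A = - (- A)" "B = - (- B)" by simp_all
      then have "w \<in> span ?S" "A \<in> span ?S" "B \<in> span ?S"
        by (metis insertI1 insertI2 span_base span_neg)+
      then show "{x, y, w, q, A, B} \<subseteq> span ?S" by (simp add: span_base)
    qed
    ultimately show ?thesis using 2
      by (intro has_model_three_step_rank2_cyclic[of y x "- w" "- B" "- A" q "- t22" "- t12" "- t21" "- t11"]) simp_all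
  next
    case 3
    define X A' where "X = x + y" and "A' = A + B"
    have "br X y = w" "br X w = A'" "br X q = t11 *\<^sub>R A' + (t22 - t11) *\<^sub>R B" "br y q = 0 *\<^sub>R A' + t22 *\<^sub>R B"
      using assms 3 by (simp_all add: X_def A'_def br_simps algebra_simps)
    moreover have "central A'" unfolding A'_def using A B by (simp add: central_combination)
    moreover have "span {X, y, w, q, A', B} = UNIV"
    proof (rule span_UNIV_trans[OF span])
      let ?S = "{X, y, w, q, A', B}"
      have "x = X - y" "A = A' - B" by (simp_all add: X_def A'_def)
      then have "x \<in> span ?S" "A \<in> span ?S" by (simp_all only: span_rules insert_iff simp_thms)
      then show "{x, y, w, q, A, B} \<subseteq> span ?S" by (simp add: span_base)
    qed
    moreover have "t22 - t11 \<noteq> 0" using 3 by simp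
    ultimately show ?thesis using yw wq B has_model_three_step_rank2_cyclic by metis
  qed
qed

lemma has_model_three_step_rank1:
  assumes xy: "br x y = w" and xw: "br x w = R" and yw: "br y w = 0"
    and xq: "br x q = \<alpha>1 *\<^sub>R S + \<alpha>2 *\<^sub>R R" and yq: "br y q = \<beta>1 *\<^sub>R S + \<beta>2 *\<^sub>R R"
    and nz: "\<alpha>1 \<noteq> 0 \<or> \<beta>1 \<noteq> 0 \<or> \<beta>2 \<noteq> 0"
    and wq: "br w q = 0" and R: "central R" and S: "central S" and span: "span {x, y, w, q, R, S} = UNIV"
  shows has_model
proof -
  have yx: "br y x = - w" and qw: "br q w = 0" using xy br_flip[of y x] br_zero_flip[OF wq] by simp_all
  note tbl = xy xw yw xq yq wq yx qw centralD[OF R] centralD[OF S]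
  consider "\<beta>1 \<noteq> 0" | "\<beta>1 = 0" "\<alpha>1 \<noteq> 0" "\<beta>2 = 0" | "\<beta>1 = 0" "\<alpha>1 \<noteq> 0" "\<beta>2 \<noteq> 0" | "\<beta>1 = 0" "\<alpha>1 = 0" "\<beta>2 \<noteq> 0"
    using nz by blast
  then show ?thesis
  proof cases
    case 1
    define \<gamma> where "\<gamma> = \<alpha>1 / \<beta>1"
    have \<gamma>: "\<alpha>1 = \<gamma> * \<beta>1" using 1 by (simp add: \<gamma>_def)
    define X q' S' where "X = x - \<gamma> *\<^sub>R y" and "q' = q - (\<alpha>2 - \<gamma> * \<beta>2) *\<^sub>R w" and "S' = \<beta>1 *\<^sub>R S + \<beta>2 *\<^sub>R R"
    have br: "br X y = w" "br X q' = 0" "br X w = R" "br y q' = S'" "br q' w = 0"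
      by (simp_all add: X_def q'_def S'_def br_simps tbl \<gamma> algebra_simps)
    have cen: "central S'" unfolding S'_def using R S by (simp add: central_combination)
    have span': "span {X, y, q', w, S', R} = UNIV"
    proof (rule span_UNIV_trans[OF span])
      let ?S = "{X, y, q', w, S', R}"
      have "x = X + \<gamma> *\<^sub>R y" "q = q' + (\<alpha>2 - \<gamma> * \<beta>2) *\<^sub>R w" by (simp_all add: X_def q'_def)
      then have "x \<in> span ?S" "q \<in> span ?S" by (simp_all only: span_rules insert_iff simp_thms)
      moreover have "S \<in> span ?S"
        by (rule span_solve[of S' _ "\<beta>2 *\<^sub>R R" \<beta>1]) (simp_all add: S'_def 1 span_rules)
      ultimately show "{x, y, w, q, R, S} \<subseteq> span ?S" by (simp add: span_base)
    qed
    show ?thesis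
      by (rule has_modelI[OF listed.G15], rule model_isomorphismI[OF span'])
         (simp_all add: table_simps br yw centralD cen R)
  next
    case 2
    define q' S' where "q' = q - \<alpha>2 *\<^sub>R w" and "S' = \<alpha>1 *\<^sub>R S"
    have br: "br x q' = S'" "br y q' = 0" "br q' w = 0"
      by (simp_all add: q'_def S'_def br_simps tbl 2)
    have cen: "central S'" unfolding S'_def using S by (simp add: central_combination)
    have span': "span {x, y, q', w, S', R} = UNIV"
    proof (rule span_UNIV_trans[OF span])
      let ?S = "{x, y, q', w, S', R}"
      have "q = q' + \<alpha>2 *\<^sub>R w" by (simp add: q'_def)
      then have "q \<in> span ?S" by (simp only: span_rules insert_iff simp_thms)
      moreover have "S \<in> span ?S"
        by (rule span_solve[of S' _ 0 \<alpha>1]) (simp_all add: S'_def 2 span_rules)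
      ultimately show "{x, y, w, q, R, S} \<subseteq> span ?S" by (simp add: span_base)
    qed
    show ?thesis
      by (rule has_modelI[OF listed.G14], rule model_isomorphismI[OF span'])
         (simp_all add: table_simps br xy xw yw centralD cen R)
  next
    case 3
    define q' S' where "q' = inverse \<beta>2 *\<^sub>R (q - \<alpha>2 *\<^sub>R w)" and "S' = (inverse \<beta>2 * \<alpha>1) *\<^sub>R S"
    have br: "br x q' = S'" "br y q' = R" "br q' w = 0"
      using 3 by (simp_all add: q'_def S'_def br_simps tbl)
    have cen: "central S'" unfolding S'_def using S by (simp add: central_combination)
    have span': "span {x, y, q', w, S', R} = UNIV"
    proof (rule span_UNIV_trans[OF span])
      let ?S = "{x, y, q', w, S', R}"
      have "q = \<beta>2 *\<^sub>R q' + \<alpha>2 *\<^sub>R w" using 3 by (simp add: q'_def)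
      then have "q \<in> span ?S" by (simp only: span_rules insert_iff simp_thms)
      moreover have "S \<in> span ?S"
        by (rule span_solve[of S' _ 0 "inverse \<beta>2 * \<alpha>1"]) (use 3 in \<open>simp_all add: S'_def span_rules\<close>)
      ultimately show "{x, y, w, q, R, S} \<subseteq> span ?S" by (simp add: span_base)
    qed
    show ?thesis
      by (rule has_modelI[OF listed.G13_2], rule model_isomorphismI[OF span'])
         (simp_all add: table_simps br xy xw yw centralD cen R)
  next
    case 4
    define q' where "q' = inverse \<beta>2 *\<^sub>R (q - \<alpha>2 *\<^sub>R w)"
    have br: "br x q' = 0" "br y q' = R" "br q' w = 0"
      using 4 by (simp_all add: q'_def br_simps tbl)
    have span': "span {x, y, q', w, S, R} = UNIV"
    proof (rule span_UNIV_trans[OF span])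
      let ?S = "{x, y, q', w, S, R}"
      have "q = \<beta>2 *\<^sub>R q' + \<alpha>2 *\<^sub>R w" using 4 by (simp add: q'_def)
      then have "q \<in> span ?S" by (simp only: span_rules insert_iff simp_thms)
      then show "{x, y, w, q, R, S} \<subseteq> span ?S" by (simp add: span_base)
    qed
    show ?thesis
      by (rule has_modelI[OF listed.G21], rule model_isomorphismI[OF span'])
         (simp_all add: table_simps br xy xw yw centralD S R)
  qed
qed

end

context nilpotent_lie_algebra_6
begin

subsection \<open>From the structure equations to the models\<close>

lemma centralI:
  assumes span: "span S = UNIV" and "\<And>s. s \<in> S \<Longrightarrow> br z s = 0"
  shows "central z"
  unfolding central_def
proof
  fix w have "w \<in> span S" using span by simp
  then show "br z w = 0"
  proof (rule span_induct)
    show "subspace {w. br z w = 0}" by (auto simp: subspace_def br_simps)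
  qed (use assms(2) in auto)
qed

text \<open>With \<^term>\<open>Q = br y p\<close>, the parameter \<^term>\<open>k\<close> decides whether repeated brackets with \<^term>\<open>y\<close> reach
  step four; otherwise the algebra is two-step with generators \<^term>\<open>x\<close>, \<^term>\<open>y\<close>, \<^term>\<open>p\<close>.\<close>

lemma has_model_normal_form_filiform:
  assumes nf: "normal_form x p c d q y k l m n e f g e' f' g'"
    and span: "span {x, p, c, d, q, y} = UNIV" and e': "e' \<noteq> 0"
  shows has_model
proof -
  note nf = nf[unfolded normal_form_def]
  have c: "central c" and d: "central d" using nf by (auto simp: central_def)
  have efg: "e = 0" "f = 0" "g = 0" using nf e' by auto
  define Q L m' n' \<kappa> where "Q = e' *\<^sub>R q + f' *\<^sub>R d + g' *\<^sub>R c" and "L = l / e'"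
    and "m' = m - L * g'" and "n' = n - L * f'" and "\<kappa> = - (l + f')"
  have l: "l = L * e'" using e' by (simp add: L_def)
  have XY: "br x y = k *\<^sub>R p + L *\<^sub>R Q + m' *\<^sub>R c + n' *\<^sub>R d"
    using nf by (simp add: Q_def m'_def n'_def l algebra_simps)
  have XP: "br x p = \<kappa> *\<^sub>R c" and YP: "br y p = Q" using nf by (simp_all add: \<kappa>_def Q_def ac_simps)
  have XQ: "br x Q = 0" and PQ: "br p Q = 0" and YQ: "br y Q = (e' * k) *\<^sub>R d"
    using nf efg by (simp_all add: Q_def br_simps centralD[OF c] centralD[OF d])
  have flip: "br y x = - (k *\<^sub>R p + L *\<^sub>R Q + m' *\<^sub>R c + n' *\<^sub>R d)" "br p x = - \<kappa> *\<^sub>R c" "br p y = - Q"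
      "br Q x = 0" "br Q p = 0" "br Q y = - (e' * k) *\<^sub>R d"
    using XY XP YP XQ PQ YQ br_flip[of y x] br_flip[of p x] br_flip[of p y] br_flip[of Q x]
      br_flip[of Q p] br_flip[of Q y] by simp_all
  note tbl = XP YP XQ PQ YQ flip centralD[OF c] centralD[OF d]
  have spanQ: "span {x, y, p, Q, c, d} = UNIV"
  proof (rule span_UNIV_trans[OF span])
    let ?S = "{x, y, p, Q, c, d}"
    have "q \<in> span ?S"
      by (rule span_solve[of Q _ "f' *\<^sub>R d + g' *\<^sub>R c" e']) (simp_all add: Q_def e' span_rules)
    then show "{x, p, c, d, q, y} \<subseteq> span ?S" by (simp add: span_base)
  qed
  show ?thesis
  proof (cases "k = 0")
    case False
    define P' Q' D' where "P' = - (k *\<^sub>R p + L *\<^sub>R Q + m' *\<^sub>R c + n' *\<^sub>R d)"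
      and "Q' = - (k *\<^sub>R Q + (L * (e' * k)) *\<^sub>R d)" and "D' = - (k * (e' * k)) *\<^sub>R d"
    have br: "br y x = P'" "br y P' = Q'" "br y Q' = D'" "br x P' = (- (k * \<kappa>)) *\<^sub>R c" "br x Q' = 0"
        "br P' Q' = 0"
      by (simp_all add: P'_def Q'_def D'_def br_simps tbl)
    have D': "central D'" unfolding D'_def using d by (simp add: central_combination)
    have span': "span {y, x, P', Q', D', t *\<^sub>R c} = UNIV" if "t \<noteq> 0" for t
    proof (rule span_UNIV_trans[OF spanQ])
      let ?S = "{y, x, P', Q', D', t *\<^sub>R c}"
      have S: "P' \<in> span ?S" "Q' \<in> span ?S" "D' \<in> span ?S" "t *\<^sub>R c \<in> span ?S" by (simp_all add: span_base)
      have cS: "c \<in> span ?S" by (rule span_solve[OF S(4) span_0 _ that]) simp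
      have dS: "d \<in> span ?S"
        by (rule span_solve[OF S(3) span_0, of "- (k * (e' * k))"]) (use False e' in \<open>simp_all add: D'_def\<close>)
      have QS: "Q \<in> span ?S"
        by (rule span_solve[OF S(2), of "- (L * (e' * k)) *\<^sub>R d" "- k"])
           (use False dS in \<open>simp_all add: Q'_def span_rules\<close>)
      have "p \<in> span ?S"
        by (rule span_solve[OF S(1), of "- (L *\<^sub>R Q + m' *\<^sub>R c + n' *\<^sub>R d)" "- k"])
           (use False dS cS QS in \<open>simp_all add: P'_def span_rules\<close>)
      then show "{x, y, p, Q, c, d} \<subseteq> span ?S" using cS dS QS by (simp add: span_base)
    qed
    show ?thesis
    proof (cases "\<kappa> = 0")
      case True
      have "span {y, x, c, P', Q', D'} = UNIV" using span'[of 1] by (simp add: insert_commute)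
      then show ?thesis
        by (intro has_modelI[OF listed.G19] model_isomorphismI[where ?e1.0 = y and ?e2.0 = x and ?e3.0 = c
              and ?e4.0 = P' and ?e5.0 = Q' and ?e6.0 = D'])
           (simp_all add: table_simps br True centralD[OF c] centralD[OF D'])
    next
      case \<kappa>: False
      define t where "t = - (k * \<kappa>)"
      have "t \<noteq> 0" using \<kappa> False by (simp add: t_def)
      have tc: "central (t *\<^sub>R c)" using c by (simp add: central_combination)
      have xP: "br x P' = t *\<^sub>R c" using br(4) by (simp add: t_def)
      show ?thesis
        by (rule has_modelI[OF listed.G6], rule model_isomorphismI[OF span'[OF \<open>t \<noteq> 0\<close>]])
           (simp_all add: table_simps br(1-3,5,6) xP centralD[OF c] centralD[OF D'])
    qed
  next
    case True
    have Q: "central Q"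
      by (rule centralI[OF spanQ]) (use True in \<open>auto simp: tbl\<close>)
    define X where "X = x + L *\<^sub>R p"
    have br: "br X y = m' *\<^sub>R c + n' *\<^sub>R d" "br X p = \<kappa> *\<^sub>R c" "br p X = - \<kappa> *\<^sub>R c"
        "br y X = - (m' *\<^sub>R c + n' *\<^sub>R d)"
      by (simp_all add: X_def br_simps tbl XY True)
    have spanX: "span {X, y, p, Q, c, d} = UNIV"
    proof (rule span_UNIV_trans[OF spanQ])
      let ?S = "{X, y, p, Q, c, d}"
      have "x = X - L *\<^sub>R p" by (simp add: X_def)
      then have "x \<in> span ?S" by (simp only: span_rules insert_iff simp_thms)
      then show "{x, y, p, Q, c, d} \<subseteq> span ?S" by (simp add: span_base)
    qed
    have nQ: "central (- Q)" "central (- \<kappa> *\<^sub>R c)" "central (m' *\<^sub>R c + n' *\<^sub>R d)"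
      "central (- (m' *\<^sub>R c + n' *\<^sub>R d))"
      using Q c d by (simp_all add: central_combination)
    consider "\<kappa> \<noteq> 0" "n' \<noteq> 0" | "\<kappa> \<noteq> 0" "n' = 0" | "\<kappa> = 0" "m' \<noteq> 0" | "\<kappa> = 0" "m' = 0" "n' \<noteq> 0"
      | "\<kappa> = 0" "m' = 0" "n' = 0" by blast
    then show ?thesis
    proof cases
      case 1
      show ?thesis
      proof (rule has_model_free_two_step[OF br(3) flip(3) br(1) nQ(2,1,3)], rule span_UNIV_trans[OF spanX])
        let ?S = "{p, X, y, - \<kappa> *\<^sub>R c, - Q, m' *\<^sub>R c + n' *\<^sub>R d}"
        have cS: "c \<in> span ?S"
          by (rule span_solve[of "- \<kappa> *\<^sub>R c" _ 0 "- \<kappa>"]) (simp_all add: 1 span_rules)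
        have "Q \<in> span ?S" by (rule span_solve[of "- Q" _ 0 "- 1"]) (simp_all add: span_rules)
        moreover have "d \<in> span ?S"
          by (rule span_solve[of "m' *\<^sub>R c + n' *\<^sub>R d" _ "m' *\<^sub>R c" n']) (use 1 cS in \<open>simp_all add: span_rules\<close>)
        ultimately show "{X, y, p, Q, c, d} \<subseteq> span ?S" using cS by (simp add: span_base)
      qed
    next
      case 2
      have "br X y = (- m' / \<kappa>) *\<^sub>R (- \<kappa> *\<^sub>R c) + 0 *\<^sub>R (- Q)" using br(1) 2 by simp
      then show ?thesis
      proof (rule has_model_two_brackets[OF br(3) flip(3) _ nQ(2,1) d], intro span_UNIV_trans[OF spanX])
        let ?S = "{p, X, y, d, - \<kappa> *\<^sub>R c, - Q}"
        have "c \<in> span ?S"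
          by (rule span_solve[of "- \<kappa> *\<^sub>R c" _ 0 "- \<kappa>"]) (simp_all add: 2 span_rules)
        moreover have "Q \<in> span ?S" by (rule span_solve[of "- Q" _ 0 "- 1"]) (simp_all add: span_rules)
        ultimately show "{X, y, p, Q, c, d} \<subseteq> span ?S" by (simp add: span_base)
      qed
    next
      case 3
      have "br p X = 0 *\<^sub>R Q + 0 *\<^sub>R (- (m' *\<^sub>R c + n' *\<^sub>R d))" using br(3) 3 by simp
      then show ?thesis
      proof (rule has_model_two_brackets[OF YP br(4) _ Q nQ(4) d], intro span_UNIV_trans[OF spanX])
        let ?S = "{y, p, X, d, Q, - (m' *\<^sub>R c + n' *\<^sub>R d)}"
        have "c \<in> span ?S"
          by (rule span_solve[of "- (m' *\<^sub>R c + n' *\<^sub>R d)" _ "- n' *\<^sub>R d" "- m'"]) (simp_all add: 3 span_rules)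
        then show "{X, y, p, Q, c, d} \<subseteq> span ?S" by (simp add: span_base)
      qed
    next
      case 4
      have "br p X = 0 *\<^sub>R Q + 0 *\<^sub>R (- (m' *\<^sub>R c + n' *\<^sub>R d))" using br(3) 4 by simp
      then show ?thesis
      proof (rule has_model_two_brackets[OF YP br(4) _ Q nQ(4) c], intro span_UNIV_trans[OF spanX])
        let ?S = "{y, p, X, c, Q, - (m' *\<^sub>R c + n' *\<^sub>R d)}"
        have "d \<in> span ?S"
          by (rule span_solve[of "- (m' *\<^sub>R c + n' *\<^sub>R d)" _ "- m' *\<^sub>R c" "- n'"]) (simp_all add: 4 span_rules)
        then show "{X, y, p, Q, c, d} \<subseteq> span ?S" by (simp add: span_base)
      qed
    next
      case 5
      have "central X"
        by (rule centralI[OF spanX]) (use 5 in \<open>auto simp: br centralD[OF Q] centralD[OF c] centralD[OF d]\<close>)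
      moreover have "span {y, p, X, c, d, Q} = UNIV" using spanX by (simp add: insert_commute)
      ultimately show ?thesis using has_model_one_bracket[OF YP _ c d Q] by blast
    qed
  qed
qed

text \<open>Identify the span of \<^term>\<open>c\<close>, \<^term>\<open>d\<close> with that of \<^term>\<open>x\<close>, \<^term>\<open>y\<close>. Then bracketing with
  \<^term>\<open>w\<close> has trace 0, whereas bracketing with \<^term>\<open>q\<close> has trace \<^term>\<open>k\<close>. The second matrix is thus
  never a multiple of the first, and this is what excludes further three-step algebras. The number
  \<^term>\<open>N\<close> is minus the determinant of the first matrix.\<close>

lemma has_model_normal_form_three_step:
  assumes nf: "normal_form x p c d q y k l m n 0 f g 0 f' g'"
    and span: "span {x, p, c, d, q, y} = UNIV" and k: "k \<noteq> 0"
  shows has_model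
proof -
  note nf = nf[unfolded normal_form_def]
  have c: "central c" and d: "central d" using nf by (auto simp: central_def)
  have XQ: "br x q = f *\<^sub>R c + g *\<^sub>R d" and YQ: "br y q = (k - f) *\<^sub>R d"
    and XP: "br x p = - (l + f') *\<^sub>R c" and YP: "br y p = f' *\<^sub>R d + g' *\<^sub>R c" and PQ: "br p q = 0"
    using nf by simp_all
  define w a h N where "w = br x y" and "a = l * f - k * (l + f')" and "h = k * g'"
    and "N = a * a + l * g * h"
  have w: "w = k *\<^sub>R p + l *\<^sub>R q + m *\<^sub>R c + n *\<^sub>R d" using nf by (simp add: w_def)
  have XW: "br x w = a *\<^sub>R c + (l * g) *\<^sub>R d" and YW: "br y w = h *\<^sub>R c - a *\<^sub>R d" and WQ: "br w q = 0"
    unfolding w a_def h_def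
    by (simp_all add: br_simps XP XQ YP YQ PQ centralD[OF c] centralD[OF d] algebra_simps)
  have XY: "br x y = w" by (simp add: w_def)
  have YX: "br y x = - w" using XY br_flip[of y x] by simp
  have spanW: "span {x, y, w, q, c, d} = UNIV"
  proof (rule span_UNIV_trans[OF span])
    let ?S = "{x, y, w, q, c, d}"
    have "p \<in> span ?S"
      by (rule span_solve[of w _ "l *\<^sub>R q + m *\<^sub>R c + n *\<^sub>R d" k]) (simp_all add: w k span_rules)
    then show "{x, p, c, d, q, y} \<subseteq> span ?S" by (simp add: span_base)
  qed
  consider "N \<noteq> 0" | "N = 0" "h \<noteq> 0" | "N = 0" "h = 0" by blast
  then show ?thesis
  proof cases
    case 1
    define A B where "A = a *\<^sub>R c + (l * g) *\<^sub>R d" and "B = h *\<^sub>R c - a *\<^sub>R d"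
    define t11 t21 t12 t22 where "t11 = (f * a + g * h) / N" and "t21 = (f * (l * g) - g * a) / N"
      and "t12 = (k - f) * h / N" and "t22 = - ((k - f) * a) / N"
    have t: "t11 * a + t21 * h = f" "t11 * (l * g) - t21 * a = g" "t12 * a + t22 * h = 0"
        "t12 * (l * g) - t22 * a = k - f"
    proof -
      have "t11 * a + t21 * h = f * N / N" "t11 * (l * g) - t21 * a = g * N / N"
        "t12 * (l * g) - t22 * a = (k - f) * N / N" "t12 * a + t22 * h = 0"
        by (simp_all add: t11_def t21_def t12_def t22_def N_def algebra_simps
            flip: add_divide_distrib diff_divide_distrib)
      then show "t11 * a + t21 * h = f" "t11 * (l * g) - t21 * a = g" "t12 * a + t22 * h = 0"
        "t12 * (l * g) - t22 * a = k - f" using 1 by simp_all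
    qed
    have comb: "r *\<^sub>R A + s *\<^sub>R B = (r * a + s * h) *\<^sub>R c + (r * (l * g) - s * a) *\<^sub>R d" for r s
      by (simp add: A_def B_def algebra_simps)
    have "br x w = A" "br y w = B" using XW YW by (simp_all add: A_def B_def)
    moreover have "br x q = t11 *\<^sub>R A + t21 *\<^sub>R B" "br y q = t12 *\<^sub>R A + t22 *\<^sub>R B"
      unfolding comb t using XQ YQ by simp_all
    moreover have "t21 \<noteq> 0 \<or> t12 \<noteq> 0 \<or> t11 \<noteq> t22"
    proof (rule ccontr)
      assume "\<not> ?thesis"
      then have "f = t11 * a" "k - f = - (t11 * a)" using t by auto
      then show False using k by simp
    qed
    moreover have "central A" "central B"
      unfolding A_def B_def using c d by (simp_all add: central_combination)
    moreover have "span {x, y, w, q, A, B} = UNIV"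
    proof (rule span_UNIV_trans[OF spanW])
      let ?S = "{x, y, w, q, A, B}"
      have S: "r *\<^sub>R A + s *\<^sub>R B \<in> span ?S" for r s by (simp add: span_rules)
      have "a *\<^sub>R A + (l * g) *\<^sub>R B = N *\<^sub>R c + 0" "h *\<^sub>R A + (- a) *\<^sub>R B = N *\<^sub>R d + 0"
        unfolding comb by (simp_all add: N_def algebra_simps)
      then have "c \<in> span ?S" "d \<in> span ?S"
        using span_solve[OF S span_0 _ 1] by blast+
      then show "{x, y, w, q, c, d} \<subseteq> span ?S" by (simp add: span_base)
    qed
    ultimately show ?thesis using has_model_three_step_rank2[OF XY] WQ by blast
  next
    case 2
    define Y w' R \<beta>1 \<beta>2 where "Y = h *\<^sub>R x - a *\<^sub>R y" and "w' = - h *\<^sub>R w"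
      and "R = (- (h * h)) *\<^sub>R c + (h * a) *\<^sub>R d"
      and "\<beta>1 = h * g - a * (k - f) + f * a" and "\<beta>2 = - f / h"
    have "br y Y = w'" "br y w' = R" "br w' q = 0"
      by (simp_all add: Y_def w'_def R_def br_simps YX YW WQ algebra_simps)
    moreover have "br Y w' = 0"
    proof -
      have "br Y w' = (- h * N) *\<^sub>R d"
        by (simp add: Y_def w'_def br_simps XW YW N_def algebra_simps)
      then show ?thesis using 2 by simp
    qed
    moreover have "br y q = (k - f) *\<^sub>R d + 0 *\<^sub>R R" using YQ by simp
    moreover have "br Y q = \<beta>1 *\<^sub>R d + \<beta>2 *\<^sub>R R"
    proof -
      have "f = - (\<beta>2 * h)" using 2 by (simp add: \<beta>2_def)
      then have "h * f = - (\<beta>2 * h * h)" "h * g - a * (k - f) = \<beta>1 + \<beta>2 * h * a"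
        by (simp_all add: \<beta>1_def algebra_simps)
      moreover have "br Y q = (h * f) *\<^sub>R c + (h * g - a * (k - f)) *\<^sub>R d"
        by (simp add: Y_def br_simps XQ YQ algebra_simps)
      moreover have "\<beta>1 *\<^sub>R d + \<beta>2 *\<^sub>R R = (- (\<beta>2 * h * h)) *\<^sub>R c + (\<beta>1 + \<beta>2 * h * a) *\<^sub>R d"
        by (simp add: R_def algebra_simps)
      ultimately show ?thesis by simp
    qed
    moreover have "k - f \<noteq> 0 \<or> \<beta>1 \<noteq> 0 \<or> \<beta>2 \<noteq> 0" using k 2 by (auto simp: \<beta>2_def)
    moreover have "central R" unfolding R_def using c d by (simp add: central_combination)
    moreover have "span {y, Y, w', q, R, d} = UNIV"
    proof (rule span_UNIV_trans[OF spanW])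
      let ?S = "{y, Y, w', q, R, d}"
      have "x \<in> span ?S"
        by (rule span_solve[of Y _ "- a *\<^sub>R y" h]) (simp_all add: Y_def 2 span_rules)
      moreover have "w \<in> span ?S"
        by (rule span_solve[of w' _ 0 "- h"]) (simp_all add: w'_def 2 span_rules)
      moreover have "c \<in> span ?S"
        by (rule span_solve[of R _ "(h * a) *\<^sub>R d" "- (h * h)"]) (simp_all add: R_def 2 span_rules)
      ultimately show "{x, y, w, q, c, d} \<subseteq> span ?S" by (simp add: span_base)
    qed
    ultimately show ?thesis using has_model_three_step_rank1 d by blast
  next
    case 3
    then have a: "a = 0" by (simp add: N_def)
    show ?thesis
    proof (cases "l * g = 0")
      case False
      define R where "R = (l * g) *\<^sub>R d"
      have "br x w = R" "br y w = 0" using XW YW a 3 by (simp_all add: R_def)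
      moreover have "br x q = f *\<^sub>R c + (1 / l) *\<^sub>R R" "br y q = 0 *\<^sub>R c + ((k - f) / (l * g)) *\<^sub>R R"
        using XQ YQ False by (simp_all add: R_def)
      moreover have "f \<noteq> 0 \<or> (0::real) \<noteq> 0 \<or> (k - f) / (l * g) \<noteq> 0" using k False by auto
      moreover have "central R" unfolding R_def using d by (simp add: central_combination)
      moreover have "span {x, y, w, q, R, c} = UNIV"
      proof (rule span_UNIV_trans[OF spanW])
        let ?S = "{x, y, w, q, R, c}"
        have "d \<in> span ?S"
          by (rule span_solve[of R _ 0 "l * g"]) (use False in \<open>simp_all add: R_def span_rules\<close>)
        then show "{x, y, w, q, c, d} \<subseteq> span ?S" by (simp add: span_base)
      qed
      ultimately show ?thesis using has_model_three_step_rank1[OF XY] WQ c by blast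
    next
      case True
      have 0: "br x w = 0" "br y w = 0" using XW YW a 3 True by simp_all
      then have "br w x = 0" "br w y = 0" using br_zero_flip by blast+
      then have wc: "central w"
        by (intro centralI[OF spanW]) (auto simp: WQ centralD[OF c] centralD[OF d])
      define v where "v = f *\<^sub>R c + g *\<^sub>R d"
      have vc: "central v" unfolding v_def using c d by (simp add: central_combination)
      have XQ': "br x q = v" using XQ by (simp add: v_def)
      have cS: "c \<in> span S" if "v \<in> span S" "d \<in> span S" "f \<noteq> 0" for S
        by (rule span_solve[OF that(1), of "g *\<^sub>R d" f]) (use that in \<open>simp_all add: v_def span_rules\<close>)
      consider "f \<noteq> 0" "k - f \<noteq> 0" | "k = f" | "f = 0" by force
      then show ?thesis
      proof cases
        case 1
        have "central ((k - f) *\<^sub>R d)" using d by (simp add: central_combination)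
        moreover have "span {x, y, q, w, v, (k - f) *\<^sub>R d} = UNIV"
        proof (rule span_UNIV_trans[OF spanW])
          let ?S = "{x, y, q, w, v, (k - f) *\<^sub>R d}"
          have dS: "d \<in> span ?S"
            by (rule span_solve[of "(k - f) *\<^sub>R d" _ 0 "k - f"]) (use 1 in \<open>simp_all add: span_rules\<close>)
          then have "c \<in> span ?S" using 1 by (intro cS) (simp_all add: span_base)
          then show "{x, y, w, q, c, d} \<subseteq> span ?S" using dS by (simp add: span_base)
        qed
        ultimately show ?thesis using has_model_free_two_step[OF XY XQ' YQ wc vc] by blast
      next
        case 2
        have "br y q = 0 *\<^sub>R w + 0 *\<^sub>R v" using YQ 2 by simp
        moreover have "span {x, y, q, d, w, v} = UNIV"
        proof (rule span_UNIV_trans[OF spanW])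
          let ?S = "{x, y, q, d, w, v}"
          have "c \<in> span ?S" using 2 k by (intro cS) (simp_all add: span_base)
          then show "{x, y, w, q, c, d} \<subseteq> span ?S" by (simp add: span_base)
        qed
        ultimately show ?thesis using has_model_two_brackets[OF XY XQ' _ wc vc d] by blast
      next
        case 3
        have "br y q = k *\<^sub>R d" using YQ 3 by simp
        moreover have "br x q = 0 *\<^sub>R (- w) + (g / k) *\<^sub>R (k *\<^sub>R d)" using XQ 3 k by simp
        moreover have "central (- w)" "central (k *\<^sub>R d)" using wc d by (simp_all add: central_combination)
        moreover have "span {y, x, q, c, - w, k *\<^sub>R d} = UNIV"
        proof (rule span_UNIV_trans[OF spanW])
          let ?S = "{y, x, q, c, - w, k *\<^sub>R d}"
          have "d \<in> span ?S" by (rule span_solve[of "k *\<^sub>R d" _ 0 k]) (simp_all add: k span_rules)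
          moreover have "w \<in> span ?S" by (rule span_solve[of "- w" _ 0 "- 1"]) (simp_all add: span_rules)
          ultimately show "{x, y, w, q, c, d} \<subseteq> span ?S" by (simp add: span_base)
        qed
        ultimately show ?thesis using has_model_two_brackets[OF YX] c by blast
      qed
    qed
  qed
qed

end

context nilpotent_lie_algebra_6
begin

text \<open>The brackets of \<^term>\<open>x\<close>, \<^term>\<open>y\<close> with \<^term>\<open>p\<close>, \<^term>\<open>q\<close> form a pencil of 2 by 2 matrices with values in
  the span of \<^term>\<open>c\<close>, \<^term>\<open>d\<close>; the cases follow its rank and the number of its singular members.\<close>

lemma has_model_normal_form_two_step:
  assumes nf: "normal_form x p c d q y 0 0 m n 0 f g 0 f' g'"
    and span: "span {x, p, c, d, q, y} = UNIV" and noncommutative: "\<not> commutative_lie br"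
    and g: "g \<noteq> 0 \<or> g' = 0"
  shows has_model
proof -
  note nf = nf[unfolded normal_form_def]
  have c: "central c" and d: "central d" using nf by (auto simp: central_def)
  have XY: "br x y = m *\<^sub>R c + n *\<^sub>R d" and XP: "br x p = - f' *\<^sub>R c" and XQ: "br x q = f *\<^sub>R c + g *\<^sub>R d"
    and YP: "br y p = f' *\<^sub>R d + g' *\<^sub>R c" and YQ: "br y q = - f *\<^sub>R d" and PQ: "br p q = 0"
    using nf by simp_all
  have flip: "br y x = - (m *\<^sub>R c + n *\<^sub>R d)" "br p x = f' *\<^sub>R c" "br q x = - (f *\<^sub>R c + g *\<^sub>R d)"
      "br p y = - (f' *\<^sub>R d + g' *\<^sub>R c)" "br q y = f *\<^sub>R d" "br q p = 0"
    using XY XP XQ YP YQ PQ br_flip[of y x] br_flip[of p x] br_flip[of q x] br_flip[of p y]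
      br_flip[of q y] br_flip[of q p] by simp_all
  note tbl = XY XP XQ YP YQ PQ flip centralD[OF c] centralD[OF d]
  note cd = central_combination c d
  consider "g \<noteq> 0" "f' \<noteq> 0" | "g \<noteq> 0" "f' = 0" "g' \<noteq> 0" | "g \<noteq> 0" "f' = 0" "g' = 0" "f \<noteq> 0"
    | "g \<noteq> 0" "f' = 0" "g' = 0" "f = 0" "m \<noteq> 0" | "g \<noteq> 0" "f' = 0" "g' = 0" "f = 0" "m = 0"
    | "g = 0" "g' = 0" "f \<noteq> 0" | "g = 0" "g' = 0" "f = 0" "f' \<noteq> 0" | "g = 0" "g' = 0" "f = 0" "f' = 0"
    using g by blast
  then show ?thesis
  proof cases
    case 1
    define C D where "C = - f' *\<^sub>R c" and "D = f *\<^sub>R c + g *\<^sub>R d"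
    have comb: "r *\<^sub>R C + s *\<^sub>R D = (s * f - r * f') *\<^sub>R c + (s * g) *\<^sub>R d" for r s
      by (simp add: C_def D_def algebra_simps)
    have "br y p = (f / g - g' / f') *\<^sub>R C + (f' / g) *\<^sub>R D"
      unfolding comb YP using 1 by (simp add: field_simps)
    moreover have "br y q = (- (f * f) / (g * f')) *\<^sub>R C + (- f / g) *\<^sub>R D"
      unfolding comb YQ using 1 by (simp add: field_simps)
    moreover have "br x y = (((n / g) * f - m) / f') *\<^sub>R C + (n / g) *\<^sub>R D"
      unfolding comb XY using 1 by (simp add: field_simps)
    moreover have "br x p = C" "br x q = D" "central C" "central D" "f' / g \<noteq> 0"
      using 1 by (simp_all add: C_def D_def XP XQ cd)
    moreover have "span {x, y, p, q, C, D} = UNIV"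
    proof (rule span_UNIV_trans[OF span])
      let ?S = "{x, y, p, q, C, D}"
      have S: "C \<in> span ?S" "D \<in> span ?S" by (simp_all add: span_base)
      have cS: "c \<in> span ?S" by (rule span_solve[OF S(1) span_0, of "- f'"]) (simp_all add: C_def 1)
      have "d \<in> span ?S"
        by (rule span_solve[OF S(2) span_scale[OF cS, of f] _ 1(1)]) (simp add: D_def)
      then show "{x, p, c, d, q, y} \<subseteq> span ?S" using cS by (simp add: span_base)
    qed
    ultimately show ?thesis using has_model_pencil[where x = x and y = y and p = p and q = q] PQ by blast
  next
    case 2
    define \<phi> \<psi> C D where "\<phi> = f / g" and "\<psi> = \<phi> * f / g'" and "C = g' *\<^sub>R c" and "D = f *\<^sub>R c + g *\<^sub>R d"
    have f: "f = \<phi> * g" "\<phi> * (\<phi> * g) = \<psi> * g'" using 2 by (simp_all add: \<phi>_def \<psi>_def)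
    define Y Q where "Y = y + \<phi> *\<^sub>R x" and "Q = q - \<psi> *\<^sub>R p"
    have comb: "r *\<^sub>R C + s *\<^sub>R D = (r * g' + s * f) *\<^sub>R c + (s * g) *\<^sub>R d" for r s
      by (simp add: C_def D_def algebra_simps)
    have "br x Y = ((m - (n / g) * f) / g') *\<^sub>R C + (n / g) *\<^sub>R D"
      unfolding comb using 2 by (simp add: Y_def br_simps XY field_simps)
    moreover have "br x p = 0" "br x Q = D" "br Y p = C" "br Y Q = 0" "br p Q = 0"
      using 2(2) f by (simp_all add: Y_def Q_def C_def D_def br_simps tbl algebra_simps)
    moreover have "central C" "central D" by (simp_all add: C_def D_def cd)
    moreover have "span {x, Y, p, Q, C, D} = UNIV"
    proof (rule span_UNIV_trans[OF span])
      let ?S = "{x, Y, p, Q, C, D}"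
      have S: "C \<in> span ?S" "D \<in> span ?S" by (simp_all add: span_base)
      have cS: "c \<in> span ?S" by (rule span_solve[OF S(1) span_0, of g']) (simp_all add: C_def 2)
      have dS: "d \<in> span ?S"
        by (rule span_solve[OF S(2) span_scale[OF cS, of f] _ 2(1)]) (simp add: D_def)
      have "y = Y - \<phi> *\<^sub>R x" "q = Q + \<psi> *\<^sub>R p" by (simp_all add: Y_def Q_def)
      then have "y \<in> span ?S" "q \<in> span ?S" by (simp_all only: span_rules insert_iff simp_thms)
      then show "{x, p, c, d, q, y} \<subseteq> span ?S" using cS dS by (simp add: span_base)
    qed
    ultimately show ?thesis by (intro has_model_split_pencil[where x = x and y = Y and p = p and q = Q])
  next
    case 3
    define \<phi> where "\<phi> = f / g"
    have f: "f = \<phi> * g" and \<phi>: "\<phi> \<noteq> 0" using 3 by (simp_all add: \<phi>_def)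
    define Y u v where "Y = y + \<phi> *\<^sub>R x" and "u = - (f *\<^sub>R c + g *\<^sub>R d)" and "v = - (\<phi> * f) *\<^sub>R c"
    have "br q x = u" "br q Y = v"
      by (simp_all add: u_def v_def Y_def br_simps tbl f algebra_simps)
    moreover have "br x Y = (- n / g) *\<^sub>R u + ((- m + (n / g) * f) / (\<phi> * f)) *\<^sub>R v"
    proof -
      have comb: "r *\<^sub>R u + s *\<^sub>R v = (- (r * f) - s * (\<phi> * f)) *\<^sub>R c + (- (r * g)) *\<^sub>R d" for r s
        by (simp add: u_def v_def algebra_simps)
      have coeff: "- ((- n / g) * f) - ((- m + (n / g) * f) / (\<phi> * f)) * (\<phi> * f) = m" "- ((- n / g) * g) = n"
        using 3 \<phi> by simp_all
      have "br x Y = m *\<^sub>R c + n *\<^sub>R d" by (simp add: Y_def br_simps XY)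
      then show ?thesis by (simp only: comb coeff)
    qed
    moreover have "central p"
      by (rule centralI[OF span]) (use 3 in \<open>auto simp: tbl\<close>)
    moreover have "central u" "central v" by (simp_all add: u_def v_def cd)
    moreover have "span {q, x, Y, p, u, v} = UNIV"
    proof (rule span_UNIV_trans[OF span])
      let ?S = "{q, x, Y, p, u, v}"
      have S: "u \<in> span ?S" "v \<in> span ?S" by (simp_all add: span_base)
      have cS: "c \<in> span ?S"
        by (rule span_solve[OF S(2) span_0, of "- (\<phi> * f)"]) (use \<phi> 3 in \<open>simp_all add: v_def\<close>)
      have dS: "d \<in> span ?S"
        by (rule span_solve[OF S(1) span_scale[OF cS, of "- f"], of "- g"]) (use 3 in \<open>simp_all add: u_def\<close>)
      have "y = Y - \<phi> *\<^sub>R x" by (simp add: Y_def)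
      then have "y \<in> span ?S" by (simp only: span_rules insert_iff simp_thms)
      then show "{x, p, c, d, q, y} \<subseteq> span ?S" using cS dS by (simp add: span_base)
    qed
    ultimately show ?thesis by (intro has_model_two_brackets[where a = q and b = x and r = Y])
  next
    case 4
    define u v where "u = g *\<^sub>R d" and "v = m *\<^sub>R c + n *\<^sub>R d"
    have "br x q = u" "br x y = v" "br q y = 0 *\<^sub>R u + 0 *\<^sub>R v"
      using 4 by (simp_all add: u_def v_def tbl)
    moreover have "central p"
      by (rule centralI[OF span]) (use 4 in \<open>auto simp: tbl\<close>)
    moreover have "central u" "central v" by (simp_all add: u_def v_def cd)
    moreover have "span {x, q, y, p, u, v} = UNIV"
    proof (rule span_UNIV_trans[OF span])
      let ?S = "{x, q, y, p, u, v}"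
      have S: "u \<in> span ?S" "v \<in> span ?S" by (simp_all add: span_base)
      have dS: "d \<in> span ?S" by (rule span_solve[OF S(1) span_0, of g]) (use 4 in \<open>simp_all add: u_def\<close>)
      have "c \<in> span ?S"
        by (rule span_solve[OF S(2) span_scale[OF dS, of n], of m]) (use 4 in \<open>simp_all add: v_def\<close>)
      then show "{x, p, c, d, q, y} \<subseteq> span ?S" using dS by (simp add: span_base)
    qed
    ultimately show ?thesis by (intro has_model_two_brackets[where a = x and b = q and r = y])
  next
    case 5
    define Y u where "Y = y - (n / g) *\<^sub>R q" and "u = g *\<^sub>R d"
    have span': "span {x, q, Y, p, c, u} = UNIV"
    proof (rule span_UNIV_trans[OF span])
      let ?S = "{x, q, Y, p, c, u}"
      have "d \<in> span ?S" by (rule span_solve[of u _ 0 g]) (use 5 in \<open>simp_all add: u_def span_rules\<close>)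
      moreover have "y = Y + (n / g) *\<^sub>R q" by (simp add: Y_def)
      then have "y \<in> span ?S" by (simp only: span_rules insert_iff simp_thms)
      ultimately show "{x, p, c, d, q, y} \<subseteq> span ?S" by (simp add: span_base)
    qed
    have "br x q = u" using 5 by (simp add: u_def tbl)
    moreover have "central Y" "central p"
      by (rule centralI[OF span]; use 5 in \<open>auto simp: Y_def br_simps tbl\<close>)+
    moreover have "central u" by (simp add: u_def cd)
    ultimately show ?thesis using has_model_one_bracket[of x q u Y p c] c span' by blast
  next
    case 6
    define s u v where "s = p + (f' / f) *\<^sub>R q" and "u = - f *\<^sub>R c" and "v = f *\<^sub>R d"
    have "br q x = u" "br q y = v" "br x y = (- m / f) *\<^sub>R u + (n / f) *\<^sub>R v"
      using 6 by (simp_all add: u_def v_def tbl)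
    moreover have "central s"
      by (rule centralI[OF span]) (use 6 in \<open>auto simp: s_def br_simps tbl\<close>)
    moreover have "central u" "central v" by (simp_all add: u_def v_def cd)
    moreover have "span {q, x, y, s, u, v} = UNIV"
    proof (rule span_UNIV_trans[OF span])
      let ?S = "{q, x, y, s, u, v}"
      have S: "u \<in> span ?S" "v \<in> span ?S" by (simp_all add: span_base)
      have "d \<in> span ?S" by (rule span_solve[OF S(2) span_0, of f]) (use 6 in \<open>simp_all add: v_def\<close>)
      moreover have "c \<in> span ?S" by (rule span_solve[OF S(1) span_0, of "- f"]) (use 6 in \<open>simp_all add: u_def\<close>)
      moreover have "p = s - (f' / f) *\<^sub>R q" by (simp add: s_def)
      then have "p \<in> span ?S" by (simp only: span_rules insert_iff simp_thms)
      ultimately show "{x, p, c, d, q, y} \<subseteq> span ?S" by (simp add: span_base)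
    qed
    ultimately show ?thesis by (intro has_model_two_brackets[where a = q and b = x and r = y])
  next
    case 7
    define u v where "u = f' *\<^sub>R c" and "v = - f' *\<^sub>R d"
    have "br p x = u" "br p y = v" "br x y = (m / f') *\<^sub>R u + (- n / f') *\<^sub>R v"
      using 7 by (simp_all add: u_def v_def tbl)
    moreover have "central q"
      by (rule centralI[OF span]) (use 7 in \<open>auto simp: tbl\<close>)
    moreover have "central u" "central v" by (simp_all add: u_def v_def cd)
    moreover have "span {p, x, y, q, u, v} = UNIV"
    proof (rule span_UNIV_trans[OF span])
      let ?S = "{p, x, y, q, u, v}"
      have S: "u \<in> span ?S" "v \<in> span ?S" by (simp_all add: span_base)
      have "c \<in> span ?S" by (rule span_solve[OF S(1) span_0, of f']) (use 7 in \<open>simp_all add: u_def\<close>)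
      moreover have "d \<in> span ?S" by (rule span_solve[OF S(2) span_0, of "- f'"]) (use 7 in \<open>simp_all add: v_def\<close>)
      ultimately show "{x, p, c, d, q, y} \<subseteq> span ?S" by (simp add: span_base)
    qed
    ultimately show ?thesis by (intro has_model_two_brackets[where a = p and b = x and r = y])
  next
    case 8
    define u where "u = m *\<^sub>R c + n *\<^sub>R d"
    have XYu: "br x y = u" using XY by (simp add: u_def)
    have pq: "central p" "central q"
      by (rule centralI[OF span]; use 8 in \<open>auto simp: tbl\<close>)+
    have u: "central u" by (simp add: u_def cd)
    consider "m \<noteq> 0" | "n \<noteq> 0" | "m = 0" "n = 0" by blast
    then show ?thesis
    proof cases
      case 1
      have "span {x, y, p, q, d, u} = UNIV"
      proof (rule span_UNIV_trans[OF span])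
        let ?S = "{x, y, p, q, d, u}"
        have "c \<in> span ?S"
          by (rule span_solve[of u _ "n *\<^sub>R d" m]) (use 1 in \<open>simp_all add: u_def span_rules\<close>)
        then show "{x, p, c, d, q, y} \<subseteq> span ?S" by (simp add: span_base)
      qed
      then show ?thesis using has_model_one_bracket[OF XYu pq d u] by blast
    next
      case 2
      have "span {x, y, p, q, c, u} = UNIV"
      proof (rule span_UNIV_trans[OF span])
        let ?S = "{x, y, p, q, c, u}"
        have "d \<in> span ?S"
          by (rule span_solve[of u _ "m *\<^sub>R c" n]) (use 2 in \<open>simp_all add: u_def span_rules\<close>)
        then show "{x, p, c, d, q, y} \<subseteq> span ?S" by (simp add: span_base)
      qed
      then show ?thesis using has_model_one_bracket[OF XYu pq c u] by blast
    next
      case 3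
      have "central x" "central y"
        by (rule centralI[OF span]; use 3 8 in \<open>auto simp: tbl\<close>)+
      have "central z" for z
      proof (rule centralI[OF span])
        fix s assume "s \<in> {x, p, c, d, q, y}"
        then have "central s" using pq c d \<open>central x\<close> \<open>central y\<close> by blast
        then show "br z s = 0" by (rule centralD)
      qed
      then have "commutative_lie br" by (simp add: commutative_lie_def central_def)
      then show ?thesis using noncommutative by blast
    qed
  qed
qed

theorem has_model_normal_form:
  assumes nf: "normal_form x p c d q y k l m n e f g e' f' g'"
    and span: "span {x, p, c, d, q, y} = UNIV" and noncommutative: "\<not> commutative_lie br"
  shows has_model
proof -
  note swap = normal_form_swap[OF nf]
  have span_swap: "span {y, q, d, c, p, x} = UNIV" using span by (simp add: insert_commute)
  consider "e' \<noteq> 0" | "e \<noteq> 0" | "e = 0" "e' = 0" "k \<noteq> 0" | "e = 0" "e' = 0" "l \<noteq> 0"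
    | "e = 0" "e' = 0" "k = 0" "l = 0" "g \<noteq> 0 \<or> g' = 0" | "e = 0" "e' = 0" "k = 0" "l = 0" "g' \<noteq> 0"
    by blast
  then show ?thesis
  proof cases
    case 1
    then show ?thesis using has_model_normal_form_filiform[OF nf span] by blast
  next
    case 2
    then show ?thesis using has_model_normal_form_filiform[OF swap span_swap] by blast
  next
    case 3
    then show ?thesis using has_model_normal_form_three_step nf span by blast
  next
    case 4
    then have "- l \<noteq> 0" by simp
    then show ?thesis using has_model_normal_form_three_step[OF _ span_swap] swap 4 by blast
  next
    case 5
    then show ?thesis using has_model_normal_form_two_step[OF _ span noncommutative] nf by blast
  next
    case 6
    then have "normal_form y q d c p x 0 0 (- n) (- m) 0 f' g' 0 f g" using swap by simp
    then show ?thesis using has_model_normal_form_two_step[OF _ span_swap noncommutative] 6 by blast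
  qed
qed

end

section \<open>Transport along isomorphisms\<close>

lemma dim_linear_inj_image:
  fixes h :: "'a::real_vector \<Rightarrow> 'b::real_vector"
  assumes h: "linear h" "inj h"
  shows "dim (h ` S) = dim S"
proof -
  obtain B where B: "B \<subseteq> S" "independent B" "S \<subseteq> span B" "card B = dim S" by (rule basis_exists)
  have "independent (h ` B)"
    using linear_independent_injective_image[OF h(1) B(2)] h(2) by (simp add: inj_on_subset)
  moreover have "h ` S \<subseteq> span (h ` B)"
    using linear_span_image[OF h(1), of B] B(3) by blast
  moreover have "h ` B \<subseteq> h ` S" using B(1) by blast
  ultimately have "dim (h ` S) = card (h ` B)" using basis_card_eq_dim by metis
  also have "\<dots> = card B" using h(2) by (simp add: card_image inj_on_subset)
  finally show ?thesis using B(4) by simp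
qed

lemma symplectic_form_pullback:
  assumes h: "linear h" "bij h" "\<And>x y. h (br x y) = br' (h x) (h y)"
    and \<omega>': "symplectic_form br' \<omega>'"
  shows "symplectic_form br (\<lambda>x y. \<omega>' (h x) (h y))"
proof -
  have bil: "bilinear \<omega>'" using \<omega>' by (simp add: symplectic_form_def)
  have "bilinear (\<lambda>x y. \<omega>' (h x) (h y))"
    by (auto simp: bilinear_def linear_add[OF h(1)] linear_scale[OF h(1)] bilinear_ladd[OF bil]
        bilinear_radd[OF bil] bilinear_lmul[OF bil] bilinear_rmul[OF bil] intro!: linearI)
  moreover have "x = 0" if 0: "\<forall>y. \<omega>' (h x) (h y) = 0" for x
  proof -
    have "\<omega>' (h x) y = 0" for y
      using 0[rule_format, of "inv h y"] h(2) by (simp add: bij_is_surj surj_f_inv_f)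
    then have "h x = h 0" using \<omega>' linear_0[OF h(1)] by (simp add: symplectic_form_def)
    then show ?thesis using h(2) by (metis bij_is_inj injD)
  qed
  ultimately show ?thesis
    using \<omega>' unfolding symplectic_form_def by (simp add: h(3))
qed

lemma para_kaehler_pullback:
  fixes br :: "'a::real_vector \<Rightarrow> 'a \<Rightarrow> 'a"
  assumes h: "linear h" "bij h" "\<And>x y. h (br x y) = br' (h x) (h y)"
    and pk: "para_kaehler br' J' \<omega>'"
  shows "\<exists>J \<omega>. para_kaehler br J \<omega>"
proof -
  define J where "J x = inv h (J' (h x))" for x
  have J': "linear J'" "\<And>x. J' (J' x) = x" "dim {x. x - J' x = 0} = dim {x. x + J' x = 0}"
    and N: "\<And>x y. br' x y + br' (J' x) (J' y) - J' (br' (J' x) y) - J' (br' x (J' y)) = 0"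
    and comp: "\<And>x y. \<omega>' (J' x) (J' y) = - \<omega>' x y" and symp: "symplectic_form br' \<omega>'"
    using pk by (simp_all add: para_kaehler_def para_complex_def almost_para_complex_def compatible_def
        nijenhuis_def)
  have inv: "h (inv h z) = z" "inv h (h v) = v" for z v
    using h(2) by (simp_all add: bij_is_surj surj_f_inv_f bij_is_inj)
  have hJ: "h (J x) = J' (h x)" for x by (simp add: J_def inv)
  have eqI: "x = y" if "h x = h y" for x y using that h(2) by (metis bij_is_inj injD)
  note lin = linear_add[OF h(1)] linear_diff[OF h(1)] linear_scale[OF h(1)] linear_0[OF h(1)]
    linear_add[OF J'(1)] linear_scale[OF J'(1)]
  have "linear J"
    by (rule linearI; rule eqI) (simp_all add: hJ lin)
  moreover have "J (J x) = x" for x by (rule eqI) (simp add: hJ J')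
  moreover have "dim {x. x - J x = 0} = dim {x. x + J x = 0}"
  proof -
    have image: "h ` {x. P x} = {x. Q x}" if PQ: "\<And>x. Q (h x) \<longleftrightarrow> P x" for P Q
    proof
      show "h ` {x. P x} \<subseteq> {x. Q x}" using PQ by blast
      show "{x. Q x} \<subseteq> h ` {x. P x}"
      proof
        fix z assume "z \<in> {x. Q x}"
        then have "inv h z \<in> {x. P x}" using PQ[of "inv h z"] by (simp add: inv)
        then have "h (inv h z) \<in> h ` {x. P x}" by (rule imageI)
        then show "z \<in> h ` {x. P x}" by (simp only: inv)
      qed
    qed
    have zero: "h x = 0 \<longleftrightarrow> x = 0" for x using eqI[of x 0] by (auto simp: lin)
    have minus: "h x - J' (h x) = 0 \<longleftrightarrow> x - J x = 0" for x
      using zero[of "x - J x"] by (simp only: lin hJ)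
    have plus: "h x + J' (h x) = 0 \<longleftrightarrow> x + J x = 0" for x
      using zero[of "x + J x"] by (simp only: lin hJ)
    have "dim {x. x - J x = 0} = dim {x. x - J' x = 0}"
      using dim_linear_inj_image[OF h(1) bij_is_inj[OF h(2)], of "{x. x - J x = 0}"]
      by (simp only: image[where P = "\<lambda>x. x - J x = 0" and Q = "\<lambda>x. x - J' x = 0", OF minus])
    also note J'(3)
    also have "dim {x. x + J' x = 0} = dim {x. x + J x = 0}"
      using dim_linear_inj_image[OF h(1) bij_is_inj[OF h(2)], of "{x. x + J x = 0}"]
      by (simp only: image[where P = "\<lambda>x. x + J x = 0" and Q = "\<lambda>x. x + J' x = 0", OF plus])
    finally show ?thesis .
  qed
  moreover have "nijenhuis br J x y = 0" for x y
  proof (rule eqI)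
    show "h (nijenhuis br J x y) = h 0"
      using N[of "h x" "h y"] by (simp add: nijenhuis_def lin h(3) hJ)
  qed
  moreover have "compatible J (\<lambda>x y. \<omega>' (h x) (h y))"
    by (simp add: compatible_def hJ comp)
  ultimately have "para_kaehler br J (\<lambda>x y. \<omega>' (h x) (h y))"
    using symplectic_form_pullback[OF h symp]
    by (simp add: para_kaehler_def para_complex_def almost_para_complex_def)
  then show ?thesis by blast
qed

section \<open>The classification theorem\<close>

lemma para_kaehler_has_model:
  fixes br :: "'a::real_vector \<Rightarrow> 'a \<Rightarrow> 'a"
  assumes lie: "lie_algebra br" and dim6: "dim (UNIV :: 'a set) = 6" and nil: "nilpotent_lie br"
    and noncommutative: "\<not> commutative_lie br" and pk: "para_kaehler br J \<omega>"
  shows "\<exists>br' \<omega>'. listed br' \<omega>' \<and> lie_isomorphic br br'"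
proof -
  interpret para_kaehler_pair br \<omega> "{x. x - J x = 0}" "{x. x + J x = 0}" J
    by (rule para_kaehler_imp_pair[OF lie nil dim6 pk])
  interpret nilpotent_lie_algebra_6 br
    by unfold_locales (rule dim6)
  obtain c d where cd: "central_pair c d" using central_pair_exists by blast
  then obtain x p q y where b: "dual_basis x p c d q y"
    using dual_basis_exists unfolding central_pair_def by blast
  have "z \<in> span {x, p, c, d, q, y}" for z
    by (subst dual_basis_expand[OF b]) (simp add: span_rules)
  then have "span {x, p, c, d, q, y} = UNIV" by blast
  then have has_model
    using normal_form_exists[OF cd b] has_model_normal_form noncommutative by blast
  then show ?thesis by (simp add: has_model_def)
qed

lemma model_para_kaehler:
  assumes "listed br \<omega>"
  shows "\<exists>J \<omega>. para_kaehler br J \<omega>"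
  using assms
  by cases (simp_all only: para_kaehler_G6 para_kaehler_G10 para_kaehler_G11 para_kaehler_G12
      para_kaehler_G13 para_kaehler_G14 para_kaehler_G15 para_kaehler_G16 para_kaehler_G17
      para_kaehler_G18 para_kaehler_G19 para_kaehler_G21 para_kaehler_G23 para_kaehler_G24 para_kaehler_G25)

lemma model_nilpotent_ricci_flat:
  assumes m: "listed br \<omega>" and J: "para_complex br J" "compatible J \<omega>"
  shows "nilpotent_structure br J \<and> ricci_flat br (assoc_metric J \<omega>)"
proof -
  have "para_kaehler br J \<omega>" using J model_symplectic[OF m] by (simp add: para_kaehler_def)
  then interpret para_kaehler_pair br \<omega> "{x. x - J x = 0}" "{x. x + J x = 0}" J
    by (intro para_kaehler_imp_pair model_lie_algebra[OF m] model_nilpotent[OF m]) simp_all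
  show ?thesis using nilpotent_J ricci_flat_metric by blast
qed

text \<open>The form on the given algebra is the pullback of the listed one in one direction, and a structure is
  pulled back in the other.\<close>

theorem theorem3p4:
  "(\<forall>br :: 'a::real_vector \<Rightarrow> 'a \<Rightarrow> 'a.
      lie_algebra br \<and> dim (UNIV :: 'a set) = 6 \<and> nilpotent_lie br \<and> \<not> commutative_lie br \<longrightarrow>
      ((\<exists>J \<omega>. para_kaehler br J \<omega>) \<longleftrightarrow>
       (\<exists>\<omega>. symplectic_form br \<omega> \<and>
          (\<exists>br' \<omega>'. listed br' \<omega>' \<and> symplecto_isomorphic br \<omega> br' \<omega>')))) \<and>
   (\<forall>br \<omega>. listed br \<omega> \<longrightarrow>
      (\<forall>J. para_complex br J \<and> compatible J \<omega> \<longrightarrow>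
         nilpotent_structure br J \<and> ricci_flat br (assoc_metric J \<omega>)))"
proof (rule conjI; intro allI impI)
  fix br :: "'a \<Rightarrow> 'a \<Rightarrow> 'a"
  assume "lie_algebra br \<and> dim (UNIV :: 'a set) = 6 \<and> nilpotent_lie br \<and> \<not> commutative_lie br"
  then have br: "lie_algebra br" "dim (UNIV :: 'a set) = 6" "nilpotent_lie br" "\<not> commutative_lie br"
    by blast+
  show "(\<exists>J \<omega>. para_kaehler br J \<omega>) \<longleftrightarrow>
       (\<exists>\<omega>. symplectic_form br \<omega> \<and>
          (\<exists>br' \<omega>'. listed br' \<omega>' \<and> symplecto_isomorphic br \<omega> br' \<omega>'))"
  proof
    assume "\<exists>J \<omega>. para_kaehler br J \<omega>"
    then obtain br' \<omega>' h where m: "listed br' \<omega>'"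
      and h: "linear h" "bij h" "\<And>x y. h (br x y) = br' (h x) (h y)"
      using para_kaehler_has_model[OF br] unfolding lie_isomorphic_def by metis
    have "symplectic_form br (\<lambda>x y. \<omega>' (h x) (h y))"
      by (rule symplectic_form_pullback[where h = h, OF h model_symplectic[OF m]])
    moreover have "symplecto_isomorphic br (\<lambda>x y. \<omega>' (h x) (h y)) br' \<omega>'"
      unfolding symplecto_isomorphic_def using h by blast
    ultimately show "\<exists>\<omega>. symplectic_form br \<omega> \<and>
        (\<exists>br' \<omega>'. listed br' \<omega>' \<and> symplecto_isomorphic br \<omega> br' \<omega>')"
      using m by blast
  next
    assume "\<exists>\<omega>. symplectic_form br \<omega> \<and> (\<exists>br' \<omega>'. listed br' \<omega>' \<and> symplecto_isomorphic br \<omega> br' \<omega>')"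
    then obtain br' \<omega>' h where m: "listed br' \<omega>'"
      and h: "linear h" "bij h" "\<And>x y. h (br x y) = br' (h x) (h y)"
      unfolding symplecto_isomorphic_def by blast
    show "\<exists>J \<omega>. para_kaehler br J \<omega>"
      using model_para_kaehler[OF m] para_kaehler_pullback[where h = h and br = br and br' = br', OF h] by blast
  qed
next
  fix br and \<omega> :: "real^6 \<Rightarrow> real^6 \<Rightarrow> real" and J
  assume m: "listed br \<omega>" and J: "para_complex br J \<and> compatible J \<omega>"
  show "nilpotent_structure br J \<and> ricci_flat br (assoc_metric J \<omega>)"
    by (rule model_nilpotent_ricci_flat[OF m J[THEN conjunct1] J[THEN conjunct2]])
qed

end
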